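(* Let $0<\alpha<1$, $\rho>0$, $t_0>0$ and $A\in\mathbb{R}^{d\times d}$ with $\sigma(A)\subset\{\lambda\in\mathbb{C}:\ |\arg(\lambda)|>\frac{\alpha\pi}{2}\}$. Let $f:\mathbb{R}^d\to\mathbb{R}^d$ be a locally Lipschitz continuous function with $f(0)=0$ and $\lim_{r\to 0}\ell_f(r)=0$, where $$\ell_f(r):=\sup_{x,y\in B_{\mathbb{R}^d}(0,r),\,x\neq y}\frac{\|f(x)-f(y)\|}{\|x-y\|}.$$ Then the zero solution of the system $$^{C}D_{t_0^{+}}^{\alpha,\rho}x(t)=Ax(t)+f(x(t)),\quad t\ge t_0,$$ is asymptotically stable.
   Context: For $0<\alpha<1$, $\rho>0$ and $a>0$, the Caputo-Katugampola fractional derivative of a function $u$ is $$^{C}D_{a^{+}}^{\alpha,\rho}u(t)=\frac{\rho^{\alpha}}{\Gamma(1-\alpha)}\,t^{1-\rho}\frac{d}{dt}\int_a^t\frac{s^{\rho-1}[u(s)-u(a)]}{(t^\rho-s^\rho)^{\alpha}}\,ds,$$ applied componentwise to vector-valued functions. Solutions of initial value problems with $x(t_0)=x_0$ exist and are unique; $x(t,x_0)$ denotes the solution on its maximal interval of existence $[t_0,t_{max}(x_0))$. The equilibrium $0$ is stable if for every $\varepsilon>0$ there is $\delta>0$ such that $\|x_0\|\le\delta$ implies $t_{max}(x_0)=\infty$ and $\|x(t,x_0)\|\le\varepsilon$ for all $t\ge t_0$; it is asymptotically stable if it is stable and there exists $c>0$ such that $\|x_0\|\le c$ implies $\lim_{t\to\infty}x(t,x_0)=0$.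 *)

theory Defs
  imports "HOL-Analysis.Analysis"
begin

definition complex_spectrum :: "real^'n^'n \<Rightarrow> complex set" where
  "complex_spectrum A = {lam. \<exists>v :: complex^'n. v \<noteq> 0 \<and>
      (\<chi> i j. complex_of_real (A$i$j)) *v v = lam *s v}"

definition locally_lipschitz :: "('a::metric_space \<Rightarrow> 'b::metric_space) \<Rightarrow> bool" where
  "locally_lipschitz f \<longleftrightarrow> (\<forall>x. \<exists>U L. open U \<and> x \<in> U \<and> lipschitz_on L U f)"

definition lip_const :: "('a::real_normed_vector \<Rightarrow> 'b::real_normed_vector) \<Rightarrow> real \<Rightarrow> real" where
  "lip_const f r = Sup {norm (f x - f y) / norm (x - y) | x y.
      x \<in> ball 0 r \<and> y \<in> ball 0 r \<and> x \<noteq> y}"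

definition CK_kernel :: "real \<Rightarrow> real \<Rightarrow> real \<Rightarrow> (real \<Rightarrow> 'a::real_normed_vector) \<Rightarrow> real \<Rightarrow> real \<Rightarrow> 'a" where
  "CK_kernel \<alpha> \<rho> a u t s = (s powr (\<rho> - 1) / (t powr \<rho> - s powr \<rho>) powr \<alpha>) *\<^sub>R (u s - u a)"

definition CK_int :: "real \<Rightarrow> real \<Rightarrow> real \<Rightarrow> (real \<Rightarrow> 'a::euclidean_space) \<Rightarrow> real \<Rightarrow> 'a" where
  "CK_int \<alpha> \<rho> a u t = integral {a..t} (CK_kernel \<alpha> \<rho> a u t)"

definition has_CK_derivative :: "real \<Rightarrow> real \<Rightarrow> real \<Rightarrow> (real \<Rightarrow> 'a::euclidean_space) \<Rightarrow> 'a \<Rightarrow> real \<Rightarrow> bool" where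
  "has_CK_derivative \<alpha> \<rho> a u D t \<longleftrightarrow>
     (\<exists>e>0. \<forall>\<tau>. a < \<tau> \<and> \<bar>\<tau> - t\<bar> < e \<longrightarrow> CK_kernel \<alpha> \<rho> a u \<tau> integrable_on {a..\<tau>}) \<and>
     (\<exists>I'. (CK_int \<alpha> \<rho> a u has_vector_derivative I') (at t) \<and>
           D = (\<rho> powr \<alpha> / Gamma (1 - \<alpha>) * t powr (1 - \<rho>)) *\<^sub>R I')"

definition CK_solution ::
  "real \<Rightarrow> real \<Rightarrow> real \<Rightarrow> real^'n^'n \<Rightarrow> (real^'n \<Rightarrow> real^'n) \<Rightarrow> real^'n \<Rightarrow> real set \<Rightarrow> (real \<Rightarrow> real^'n) \<Rightarrow> bool" where
  "CK_solution \<alpha> \<rho> t0 A f x0 J x \<longleftrightarrow>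
     x t0 = x0 \<and> continuous_on J x \<and>
     (\<forall>t\<in>J. t > t0 \<longrightarrow> has_CK_derivative \<alpha> \<rho> t0 x (A *v x t + f (x t)) t)"

text \<open>Stability notions for the equilibrium 0, phrased via global solutions on [t0,oo)
  (solutions are unique, so "t_max(x0) = oo" means a global solution exists).\<close>
definition CK_stable where
  "CK_stable \<alpha> \<rho> t0 A f \<longleftrightarrow>
     (\<forall>\<epsilon>>0. \<exists>\<delta>>0. \<forall>x0. norm x0 \<le> \<delta> \<longrightarrow>
        (\<exists>x. CK_solution \<alpha> \<rho> t0 A f x0 {t0..} x) \<and>
        (\<forall>x. CK_solution \<alpha> \<rho> t0 A f x0 {t0..} x \<longrightarrow> (\<forall>t\<ge>t0. norm (x t) \<le> \<epsilon>)))"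

definition CK_asymptotically_stable where
  "CK_asymptotically_stable \<alpha> \<rho> t0 A f \<longleftrightarrow>
     CK_stable \<alpha> \<rho> t0 A f \<and>
     (\<exists>c>0. \<forall>x0. norm x0 \<le> c \<longrightarrow>
        (\<exists>x. CK_solution \<alpha> \<rho> t0 A f x0 {t0..} x) \<and>
        (\<forall>x. CK_solution \<alpha> \<rho> t0 A f x0 {t0..} x \<longrightarrow> (x \<longlongrightarrow> 0) at_top))"

end

theory Submission
  imports Defs "HOL-Complex_Analysis.Complex_Analysis" "HOL-Real_Asymp.Real_Asymp"
    "HOL-Computational_Algebra.Fundamental_Theorem_Algebra"
begin

text \<open>
  The substitution \<open>\<sigma> = (t powr \<rho> - t0 powr \<rho>) / \<rho>\<close> turns the equation into an ordinary Caputo equation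
  of order \<open>\<alpha>\<close>, hence into the Volterra equation \<open>v = x0 + k * (A v + f(v))\<close> with the kernel
  \<open>k(t) = t powr (\<alpha> - 1) / Gamma \<alpha>\<close>. If \<open>\<bar>Arg \<lambda>\<bar> > \<alpha> pi / 2\<close>, the scalar resolvent kernel \<open>r\<close> with Laplace
  transform \<open>1 / (p powr \<alpha> - \<lambda>)\<close> is given by an integral over two rays in the open left half plane
  and is integrable over the half-line; moreover \<open>1 + \<lambda> \<integral>r\<close> tends to \<open>0\<close>. This bounds the solution of a scalar equation by its
  forcing term, both uniformly and asymptotically. Writing \<open>(A - \<lambda>\<^sub>1) \<dots> (A - \<lambda>\<^sub>m) = 0\<close> with eigenvalues \<open>\<lambda>\<^sub>i\<close>,
  the functions \<open>w\<^sub>i = (A - \<lambda>\<^sub>1) \<dots> (A - \<lambda>\<^sub>i) v\<close> satisfy scalar equations with eigenvalue \<open>\<lambda>\<^sub>i\<^sub>+\<^sub>1\<close> and forcing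
  \<open>w\<^sub>i\<^sub>+\<^sub>1\<close> plus a multiple of \<open>f(v)\<close>, so descending from \<open>w\<^sub>m = 0\<close> bounds \<open>v\<close> by \<open>x0\<close> and \<open>f(v)\<close>.
  As \<open>f\<close> has small Lipschitz constant near \<open>0\<close>, a first-exit argument gives stability
  and repeated halving of the asymptotic bound gives attraction.
\<close>

section \<open>Exponential integrals along rays\<close>

text \<open>The Caputo operator has memory: a solution cannot be restarted at a later time, so
  semigroup arguments do not apply and every estimate is made for the Volterra equation from its
  initial time. Integrability of \<open>r\<close> replaces them: old values of the forcing are
  weighted by a tail of \<open>r\<close>, so their influence fades. The eigenvalue condition enters
  in one place. The rays need an argument \<open>\<theta>\<close> > pi / 2 for exp (t s) to decay
  along them, and no zero of s powr alpha - lam may lie between them, which needs alpha *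
  \<open>\<theta>\<close> < |Arg lam|; such a \<open>\<theta>\<close> exists exactly when |Arg lam|
  > alpha * pi / 2. The annihilating product takes the place of a Jordan form: only scalar equations
  occur, and repeated eigenvalues need no separate treatment. Existence comes from composing f with
  the projection onto a small ball, which makes the nonlinearity globally Lipschitz; the a priori
  bound then shows that the projection never acted.\<close>

lemma set_integrable_lborelI_nonneg_integral:
  fixes f :: "real \<Rightarrow> real"
  assumes "f integrable_on S" "S \<in> sets borel" "f \<in> borel_measurable borel" "\<And>x. x \<in> S \<Longrightarrow> 0 \<le> f x"
  shows "set_integrable lborel S f"
proof -
  have "f absolutely_integrable_on S"
    using assms by (intro nonnegative_absolutely_integrable_1) auto
  then show ?thesis
    using assms unfolding set_integrable_def
    by (subst (asm) integrable_completion) auto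
qed

lemma set_integrable_exp_minus:
  fixes a b :: real
  assumes "0 < a"
  shows "set_integrable lborel {b..} (\<lambda>t. exp (- (a * t)))"
    "(LBINT t:{b..}. exp (- (a * t))) = exp (- (a * b)) / a"
proof -
  show *: "set_integrable lborel {b..} (\<lambda>t. exp (- (a * t)))"
    using integrable_on_exp_minus_to_infinity[OF assms, of b]
    by (intro set_integrable_lborelI_nonneg_integral) auto
  show "(LBINT t:{b..}. exp (- (a * t))) = exp (- (a * b)) / a"
    using set_borel_integral_eq_integral(2)[OF *] has_integral_exp_minus_to_infinity[OF assms, of b]
    by (simp add: integral_unique)
qed

lemma norm_exp_real_mult: "norm (exp (complex_of_real t * w)) = exp (t * Re w)"
  by (simp add: norm_exp_eq_Re)

lemma set_integral_exp_complex:
  fixes w :: complex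
  assumes "Re w < 0"
  shows "set_integrable lborel {b..} (\<lambda>t. exp (of_real t * w))" (is ?A)
    and "(LBINT t:{b..}. exp (of_real t * w)) = - exp (of_real b * w) / w"
proof -
  show A: ?A
  proof (rule set_integrable_bound)
    show "set_integrable lborel {b..} (\<lambda>t. exp (- (- Re w * t)))"
      using set_integrable_exp_minus(1)[of "- Re w" b] assms by simp
    show "set_borel_measurable lborel {b..} (\<lambda>t. exp (complex_of_real t * w))"
      unfolding set_borel_measurable_def by measurable
    show "AE x in lborel. x \<in> {b..} \<longrightarrow> norm (exp (complex_of_real x * w)) \<le> norm (exp (- (- Re w * x)))"
      by (simp add: norm_exp_real_mult mult.commute)
  qed
  have w: "w \<noteq> 0" using assms by auto
  have "((\<lambda>T. LBINT t:{b..T}. exp (of_real t * w)) \<longlongrightarrow> (LBINT t:{b..}. exp (of_real t * w))) at_top"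
    by (rule tendsto_set_lebesgue_integral_at_top[OF _ A]) auto
  moreover have "((\<lambda>T. LBINT t:{b..T}. exp (of_real t * w)) \<longlongrightarrow> 0 - exp (of_real b * w) / w) at_top"
  proof (rule Lim_transform_eventually)
    have "((\<lambda>T. exp (T * Re w) / norm w) \<longlongrightarrow> 0 / norm w) at_top"
      by (rule tendsto_divide[OF _ tendsto_const]) (use assms w in \<open>real_asymp, simp\<close>)
    then have "((\<lambda>T. norm (exp (complex_of_real T * w) / w)) \<longlongrightarrow> 0) at_top"
      by (simp add: norm_divide norm_exp_real_mult)
    then have "((\<lambda>T. exp (complex_of_real T * w) / w) \<longlongrightarrow> 0) at_top"
      using tendsto_norm_zero_iff by blast
    then show "((\<lambda>T. exp (complex_of_real T * w) / w - exp (of_real b * w) / w) \<longlongrightarrow> 0 - exp (of_real b * w) / w) at_top"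
      by (intro tendsto_intros)
    show "\<forall>\<^sub>F T in at_top. exp (complex_of_real T * w) / w - exp (of_real b * w) / w = (LBINT t:{b..T}. exp (of_real t * w))"
      using eventually_ge_at_top[of b]
    proof eventually_elim
      case (elim T)
      have 1: "((\<lambda>t. exp (of_real t * w)) has_integral (exp (of_real T * w) / w - exp (of_real b * w) / w)) {b..T}"
        using elim w
        by (intro fundamental_theorem_of_calculus)
           (auto intro!: derivative_eq_intros has_vector_derivative_real_field simp: field_simps)
      have 2: "set_integrable lborel {b..T} (\<lambda>t. exp (complex_of_real t * w))"
        by (rule set_integrable_subset[OF A]) auto
      show ?case
        using set_borel_integral_eq_integral(2)[OF 2] 1 by (simp add: integral_unique)
    qed
  qed
  ultimately show "(LBINT t:{b..}. exp (of_real t * w)) = - exp (of_real b * w) / w"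
    using tendsto_unique[OF trivial_limit_at_top_linorder] by fastforce
qed

text \<open>In the variable x = ln |s|, power decay of an integrand at s = 0 and at infinity becomes
  exponential decay on both sides; this is the common majorant for the ray integrals.\<close>

lemma integrable_exp_minus_abs:
  fixes a :: real
  assumes "0 < a"
  shows "integrable lborel (\<lambda>x::real. exp (- (a * \<bar>x\<bar>)))"
proof -
  have 1: "integrable lborel (\<lambda>x. indicator {0..} x *\<^sub>R exp (- (a * x)))"
    using set_integrable_exp_minus(1)[OF assms, of 0] by (simp add: set_integrable_def)
  have 2: "integrable lborel (\<lambda>x. indicator {0..} (-x) *\<^sub>R exp (- (a * (-x))))"
    using lborel_integrable_real_affine[OF 1, of "-1" 0] by simp
  show ?thesis
    by (rule Bochner_Integration.integrable_bound[OF Bochner_Integration.integrable_add[OF 1 2]])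
       (auto simp: indicator_def)
qed

text \<open>Everything is parametrised by \<open>s = exp z\<close> with \<open>z\<close> in a horizontal strip, which makes
  \<open>s powr \<alpha> = exp (\<alpha> z)\<close> single valued and turns the two rays of the contour into horizontal lines.\<close>

lemma strip_denominator_bound:
  fixes lam :: complex and \<alpha> \<theta> :: real
  assumes "0 < \<alpha>" "0 \<le> \<theta>" "\<alpha> * \<theta> < \<bar>Arg lam\<bar>"
  obtains m where "0 < m"
    "\<And>z. \<bar>Im z\<bar> \<le> \<theta> \<Longrightarrow> m * (1 + exp (\<alpha> * Re z)) \<le> norm (exp (of_real \<alpha> * z) - lam)"
proof -
  \<comment> \<open>The closed sector of half-angle \<open>\<alpha> * \<theta>\<close>, described by
    cosines so that closedness is immediate. It contains exp (alpha z) for every z in the strip and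
    omits \<open>lam\<close>, which therefore has a positive distance \<open>d\<close> from
    it.\<close>
  define S where "S = {w. norm w * cos (\<alpha> * \<theta>) \<le> Re w}"
  have lam0: "lam \<noteq> 0" using assms by (auto simp: Arg_zero mult_less_0_iff)
  have "closed S" unfolding S_def by (intro closed_Collect_le continuous_intros)
  moreover have "lam \<notin> S"
  proof -
    have "Re lam = norm lam * cos \<bar>Arg lam\<bar>"
      using arg_cong[OF rcis_cmod_Arg[of lam], of Re] by simp
    also have "\<dots> < norm lam * cos (\<alpha> * \<theta>)"
      using lam0 assms Arg_bounded[of lam] by (intro mult_strict_left_mono cos_monotone_0_pi) auto
    finally show ?thesis by (simp add: S_def)
  qed
  ultimately obtain d where d: "0 < d" "\<forall>w\<in>S. d \<le> dist lam w"
    using separate_point_closed[of S lam] by auto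
  define n where "n = norm lam"
  have "0 < n" using lam0 by (simp add: n_def)
  show thesis
  proof
    \<comment> \<open>Blends two lower bounds for |w - lam|: \<open>d\<close>, which serves small
      |w|, and |w| - \<open>n\<close>, which serves large |w|.\<close>
    show "0 < d / (1 + d + n)" using d \<open>0 < n\<close> by simp
    fix z assume z: "\<bar>Im z\<bar> \<le> \<theta>"
    define w where "w = exp (of_real \<alpha> * z)"
    have nw: "norm w = exp (\<alpha> * Re z)" by (simp add: w_def norm_exp_eq_Re)
    have "Re w = norm w * cos (\<alpha> * \<bar>Im z\<bar>)"
      by (cases "0 \<le> Im z") (simp_all add: w_def norm_exp_eq_Re Re_exp)
    also have "\<dots> \<ge> norm w * cos (\<alpha> * \<theta>)"
      using z assms Arg_bounded[of lam]
      by (intro mult_left_mono cos_monotone_0_pi_le) auto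
    finally have "w \<in> S" by (simp add: S_def)
    then have D1: "d \<le> norm (w - lam)" using d by (metis dist_norm norm_minus_commute)
    have D2: "norm w \<le> norm (w - lam) + n" using norm_triangle_sub[of w lam] by (simp add: n_def)
    have "d * (1 + norm w) \<le> d * (1 + norm (w - lam) + n)"
      using D2 d by simp
    also have "\<dots> \<le> (1 + d + n) * norm (w - lam)"
      using mult_right_mono[OF D1, of "1 + n"] \<open>0 < n\<close> by (simp add: algebra_simps)
    finally have "d / (1 + d + n) * (1 + norm w) \<le> norm (w - lam)"
      using d \<open>0 < n\<close> by (simp add: divide_le_eq mult.commute)
    then show "d / (1 + d + n) * (1 + exp (\<alpha> * Re z)) \<le> norm (exp (of_real \<alpha> * z) - lam)"
      by (simp only: nw) (simp only: w_def)
  qed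
qed

text \<open>Fubini. Integrating |exp (t w)| over t >= b gives exp (b Re w) / (- Re w), so
  \<open>int\<close> is precisely absolute integrability of the double integral. The case b = 0
  yields Laplace transforms, the case b = 1 integrability for large times.\<close>

lemma superposed_exponentials:
  fixes w \<phi> :: "real \<Rightarrow> complex" and b :: real
  assumes [measurable]: "w \<in> borel_measurable borel" "\<phi> \<in> borel_measurable borel"
    and neg: "\<And>x. Re (w x) < 0"
    and int: "integrable lborel (\<lambda>x. exp (b * Re (w x)) * norm (\<phi> x) / (- Re (w x)))"
  shows "set_integrable lborel {b..} (\<lambda>t. LBINT x. exp (of_real t * w x) * \<phi> x)"
    and "(LBINT t:{b..}. LBINT x. exp (of_real t * w x) * \<phi> x)
          = (LBINT x. - exp (of_real b * w x) / w x * \<phi> x)"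
proof -
  define f where "f = (\<lambda>x t. indicator {b..} t *\<^sub>R (exp (of_real t * w x) * \<phi> x))"
  have normf: "norm (f x t) = indicator {b..} t *\<^sub>R exp (- (- Re (w x) * t)) * norm (\<phi> x)" for x t
    by (simp add: f_def norm_mult norm_exp_real_mult mult.commute indicator_def)
  have intt: "integrable lborel (f x)" for x
    using set_integral_exp_complex(1)[OF neg[of x], of b]
    unfolding set_integrable_def f_def by (simp only: mult_scaleR_left[symmetric] integrable_mult_left)
  have J: "integrable (lborel \<Otimes>\<^sub>M lborel) (case_prod f)"
  proof (rule lborel_pair.Fubini_integrable)
    show "case_prod f \<in> borel_measurable (lborel \<Otimes>\<^sub>M lborel)"
      unfolding f_def by measurable
    have "(\<integral>t. norm (f x t) \<partial>lborel) = exp (b * Re (w x)) * norm (\<phi> x) / (- Re (w x))" for x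
      using set_integrable_exp_minus(2)[of "- Re (w x)" b] neg[of x]
      by (simp add: normf set_lebesgue_integral_def mult.commute)
    then show "integrable lborel (\<lambda>x. \<integral>t. norm (case_prod f (x, t)) \<partial>lborel)"
      using int by simp
    show "AE x in lborel. integrable lborel (\<lambda>t. case_prod f (x, t))"
      using intt by simp
  qed
  have sn: "(LBINT x. f x t) = indicator {b..} t *\<^sub>R (LBINT x. exp (of_real t * w x) * \<phi> x)" for t
    by (auto simp: f_def indicator_def)
  show "set_integrable lborel {b..} (\<lambda>t. LBINT x. exp (of_real t * w x) * \<phi> x)"
    using lborel_pair.integrable_snd[OF J] by (simp add: sn set_integrable_def)
  have "(LBINT t:{b..}. LBINT x. exp (of_real t * w x) * \<phi> x)
      = (LBINT t. LBINT x. f x t)"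
    by (simp add: sn set_lebesgue_integral_def)
  also have "\<dots> = (LBINT x. LBINT t. f x t)"
    by (rule lborel_pair.Fubini_integral[OF J])
  also have "\<dots> = (LBINT x. - exp (of_real b * w x) / w x * \<phi> x)"
  proof (rule Bochner_Integration.integral_cong[OF refl])
    fix x
    show "(LBINT t. f x t) = - exp (of_real b * w x) / w x * \<phi> x"
    using set_integral_exp_complex(2)[OF neg[of x], of b]
    unfolding set_lebesgue_integral_def f_def by (simp only: mult_scaleR_left[symmetric] integral_mult_left_zero)
  qed
  finally show "(LBINT t:{b..}. LBINT x. exp (of_real t * w x) * \<phi> x)
          = (LBINT x. - exp (of_real b * w x) / w x * \<phi> x)" .
qed

lemma Re_exp_line: "Re (exp (Complex x th)) = exp x * cos th"
  by (simp add: Re_exp)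

lemma norm_exp_line: "norm (exp (Complex x th)) = exp x"
  by (simp add: norm_exp_eq_Re)

lemma borel_measurable_Complex_line [measurable]: "(\<lambda>x. Complex x th) \<in> borel_measurable borel"
  unfolding Complex_eq by measurable

text \<open>With s = exp (x + i th) the second factor is ds/dx, so this is the integral of exp (t s)
  along the ray of argument th. The Jacobian gives decay towards the origin, the negative real part
  of s gives it towards infinity.\<close>

lemma exp_ray_integrable:
  assumes "0 < t" "cos th < 0"
  shows "integrable lborel (\<lambda>x. exp (of_real t * exp (Complex x th)) * exp (Complex x th))"
proof (rule Bochner_Integration.integrable_bound)
  define c where "c = - cos th"
  have c: "0 < c" using assms by (simp add: c_def)
  show "integrable lborel (\<lambda>x::real. (1 + 2 / (c * t)\<^sup>2) * exp (- (1 * \<bar>x\<bar>)))"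
    by (intro integrable_mult_right integrable_exp_minus_abs) auto
  show "AE x in lborel. norm (exp (of_real t * exp (Complex x th)) * exp (Complex x th))
      \<le> norm ((1 + 2 / (c * t)\<^sup>2) * exp (- (1 * \<bar>x\<bar>)))"
  proof (rule AE_I2)
    fix x :: real
    define u where "u = c * t * exp x"
    have u: "0 < u" using c assms by (simp add: u_def)
    have n: "norm (exp (of_real t * exp (Complex x th)) * exp (Complex x th)) = exp (- u) * exp x"
      by (simp add: norm_mult norm_exp_real_mult norm_exp_line Re_exp_line u_def c_def mult_ac)
    have "exp (- u) * exp x \<le> (1 + 2 / (c * t)\<^sup>2) * exp (- \<bar>x\<bar>)"
    proof (cases "0 \<le> x")
      case True
      \<comment> \<open>Of the two powers of exp x gained here, one pays for the Jacobian and the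
        other leaves exp (- x).\<close>
      have "u\<^sup>2 / 2 \<le> exp u" using exp_lower_Taylor_quadratic[of u] u by simp
      then have "exp (- u) \<le> 2 / u\<^sup>2" using u by (simp add: exp_minus field_simps)
      then have "exp (- u) * exp x \<le> 2 / u\<^sup>2 * exp x" by (intro mult_right_mono) auto
      also have "\<dots> = 2 / (c * t)\<^sup>2 * exp (- x)"
        using c assms by (simp add: u_def power_mult_distrib exp_minus field_simps power2_eq_square)
      also have "\<dots> \<le> (1 + 2 / (c * t)\<^sup>2) * exp (- \<bar>x\<bar>)" using True by (simp add: distrib_right)
      finally show ?thesis .
    next
      case False
      have "exp (- u) * exp x \<le> 1 * exp (- \<bar>x\<bar>)" using u False by (intro mult_mono) auto
      also have "\<dots> \<le> (1 + 2 / (c * t)\<^sup>2) * exp (- \<bar>x\<bar>)" by (intro mult_right_mono) auto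
      finally show ?thesis .
    qed
    then show "norm (exp (of_real t * exp (Complex x th)) * exp (Complex x th))
      \<le> norm ((1 + 2 / (c * t)\<^sup>2) * exp (- (1 * \<bar>x\<bar>)))"
      unfolding n by (simp add: abs_mult)
  qed
qed measurable

text \<open>The primitive exp (t s) / t is 1 / t at s = 0 and vanishes at infinity. The value does
  not depend on th, which is what lets the corrections on the two rays cancel.\<close>

lemma exp_ray_integral:
  assumes "0 < t" "cos th < 0"
  shows "(LBINT x. exp (of_real t * exp (Complex x th)) * exp (Complex x th)) = - 1 / of_real t"
proof -
  let ?f = "\<lambda>x. exp (of_real t * exp (Complex x th)) * exp (Complex x th)"
  define F where "F x = exp (of_real t * exp (Complex x th)) / of_real t" for x
  have lines: "Complex x th = of_real x + \<i> * of_real th" for x by (simp add: Complex_eq)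
  have "(LBINT x=-\<infinity>..\<infinity>. ?f x) = 0 - 1 / of_real t"
  proof (rule interval_integral_FTC_integrable)
    show "(F has_vector_derivative ?f x) (at x)" for x
      unfolding F_def lines using assms
      by (auto intro!: derivative_eq_intros has_vector_derivative_real_field)
    show "isCont ?f x" for x unfolding lines by (intro continuous_intros)
    show "set_integrable lborel (einterval (- \<infinity>) \<infinity>) ?f"
      using exp_ray_integrable[OF assms] by (simp add: set_integrable_def)
    have "((\<lambda>x. exp (of_real t * (of_real (exp x) * exp (\<i> * of_real th))) / of_real t)
            \<longlongrightarrow> exp (of_real t * (of_real 0 * exp (\<i> * of_real th))) / of_real t) at_bot"
      using assms by (intro tendsto_intros exp_at_bot) auto
    then have "(F \<longlongrightarrow> 1 / of_real t) at_bot"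
      by (simp add: F_def[abs_def] lines exp_add exp_of_real)
    then show "((F \<circ> real_of_ereal) \<longlongrightarrow> 1 / of_real t) (at_right (- \<infinity>))"
      by (simp add: ereal_tendsto_simps)
    have "((\<lambda>x. exp (t * (exp x * cos th)) / t) \<longlongrightarrow> 0) at_top"
    proof -
      define d where "d = - (t * cos th)"
      have d: "0 < d" using assms by (simp add: d_def mult_less_0_iff)
      then have "((\<lambda>x. exp (- (d * exp x)) / t) \<longlongrightarrow> 0 / t) at_top"
        using assms(1) by (intro tendsto_divide tendsto_const) (real_asymp, simp)
      moreover have "t * (exp x * cos th) = - (d * exp x)" for x by (simp add: d_def)
      ultimately show ?thesis by simp
    qed
    then have "((\<lambda>x. norm (F x)) \<longlongrightarrow> 0) at_top"
      using assms by (simp add: F_def norm_divide norm_exp_real_mult Re_exp_line)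
    then have "(F \<longlongrightarrow> 0) at_top" by (simp add: tendsto_norm_zero_iff)
    then show "((F \<circ> real_of_ereal) \<longlongrightarrow> 0) (at_left \<infinity>)"
      by (simp add: ereal_tendsto_simps)
  qed auto
  then show ?thesis by (simp add: interval_integral_to_infinity_eq interval_lebesgue_integral_def set_lebesgue_integral_def)
qed


text \<open>Near \<open>t = 0\<close> integrability is read off the ray integral directly. For large \<open>t\<close> the factor
  \<open>1 / (s powr \<alpha> - \<lambda>)\<close> decays too slowly at \<open>s = 0\<close>; adding \<open>1 / \<lambda>\<close> to it repairs this and changes the integral by
  \<open>- 1 / (t \<lambda>)\<close> on each ray, which cancels in the difference of the two rays.\<close>

lemma resolvent_ray_branch:
  fixes \<alpha> th m :: real and lam :: complex
  assumes \<alpha>: "0 < \<alpha>" "\<alpha> < 1" and th: "cos th < 0" and lam: "lam \<noteq> 0" and m: "0 < m"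
    and bound: "\<And>x. m * (1 + exp (\<alpha> * x)) \<le> norm (exp (of_real \<alpha> * Complex x th) - lam)"
  defines "Z \<equiv> \<lambda>x. Complex x th"
  defines "G \<equiv> \<lambda>t. LBINT x. exp (of_real t * exp (Z x)) * (exp (Z x) / (exp (of_real \<alpha> * Z x) - lam))"
  shows "0 < p \<Longrightarrow> set_integrable lborel {0..} (\<lambda>t. of_real (exp (- (p * t))) * G t)"
    and "0 < p \<Longrightarrow> (LBINT t:{0..}. of_real (exp (- (p * t))) * G t)
      = (LBINT x. exp (Z x) / ((exp (of_real \<alpha> * Z x) - lam) * (of_real p - exp (Z x))))"
    and "0 < p \<Longrightarrow> integrable lborel (\<lambda>x. exp (Z x) / ((exp (of_real \<alpha> * Z x) - lam) * (of_real p - exp (Z x))))"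
    and "set_integrable lborel {1..} (\<lambda>t. G t - 1 / (of_real t * lam))"
proof -
  let ?D = "\<lambda>x. exp (of_real \<alpha> * Z x) - lam"
  let ?E = "\<lambda>t x. exp (of_real t * exp (Z x))"
  define c where "c = - cos th"
  have c: "0 < c" using th by (simp add: c_def)
  define \<phi> where "\<phi> x = exp (Z x) / (?D x)" for x
  have Zm[measurable]: "Z \<in> borel_measurable borel" unfolding Z_def by measurable
  have \<phi>m[measurable]: "\<phi> \<in> borel_measurable borel" unfolding \<phi>_def by measurable
  have nZ: "norm (exp (Z x)) = exp x" "Re (exp (Z x)) = - (c * exp x)" for x
    by (simp_all add: Z_def norm_exp_line Re_exp_line c_def)
  have [simp]: "Re (Z x) = x" for x by (simp add: Z_def)
  have D0: "0 < norm (?D x)" for x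
    using bound[of x] m by (smt (verit) Z_def exp_gt_zero mult_pos_pos)
  have D: "inverse (norm (?D x)) \<le> 1 / (m * (1 + exp (\<alpha> * x)))" for x
    using le_imp_inverse_le[OF bound[of x]] m by (simp add: Z_def inverse_eq_divide add_pos_pos)
  have n\<phi>: "norm (\<phi> x) \<le> exp x / (m * (1 + exp (\<alpha> * x)))" for x
    using mult_left_mono[OF D[of x], of "exp x"] by (simp add: \<phi>_def norm_mult norm_inverse nZ divide_inverse)
  have n\<phi>': "norm (\<phi> x) \<le> exp x / m" for x
    using n\<phi>[of x] by (rule order_trans) (use m in \<open>auto intro!: divide_left_mono mult_pos_pos add_pos_pos\<close>)
  {
    assume p: "0 < p"
    \<comment> \<open>For x >= 0 the growth of s powr alpha in the denominator gives the decay. For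
      x < 0 the factor exp x is available and is weakened to exp (alpha x), so that one majorant
      serves both sides.\<close>
    have est: "norm (\<phi> x) / (p + c * exp x) \<le> (1 / (m * c) + 1 / (m * p)) * exp (- (\<alpha> * \<bar>x\<bar>))" for x
    proof (cases "0 \<le> x")
      case True
      have "norm (\<phi> x) / (p + c * exp x) \<le> (exp x / (m * exp (\<alpha> * x))) / (c * exp x)"
        using m c p by (intro frac_le order_trans[OF n\<phi>]) (auto intro!: divide_left_mono mult_pos_pos add_pos_pos)
      also have "\<dots> = 1 / (m * c) * exp (- (\<alpha> * x))"
        using m c by (simp add: field_simps exp_minus)
      also have "\<dots> \<le> (1 / (m * c) + 1 / (m * p)) * exp (- (\<alpha> * \<bar>x\<bar>))"
        using True m p by (simp add: distrib_right)
      finally show ?thesis .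
    next
      case False
      have "x \<le> \<alpha> * x" using False \<alpha> mult_right_mono_neg[of \<alpha> 1 x] by simp
      have "norm (\<phi> x) / (p + c * exp x) \<le> (exp x / m) / p"
        using m c p by (intro frac_le n\<phi>') auto
      also have "\<dots> \<le> 1 / (m * p) * exp (\<alpha> * x)"
        using \<open>x \<le> \<alpha> * x\<close> m p by (simp add: divide_right_mono)
      also have "\<dots> \<le> (1 / (m * c) + 1 / (m * p)) * exp (- (\<alpha> * \<bar>x\<bar>))"
        using False m c by (simp add: distrib_right)
      finally show ?thesis .
    qed
    \<comment> \<open>The Laplace weight exp (- p t) shifts the exponent from s to s - p, whose real
      part is at most - p; the transform is thus again a superposition of decaying
      exponentials.\<close>
    define w where "w x = exp (Z x) - of_real p" for x
    have wm[measurable]: "w \<in> borel_measurable borel" unfolding w_def by measurable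
    have Rew: "- Re (w x) = p + c * exp x" for x by (simp add: w_def nZ)
    have neg: "Re (w x) < 0" for x using Rew[of x] p c by (smt (verit) exp_gt_zero mult_pos_pos)
    have I: "integrable lborel (\<lambda>x. norm (\<phi> x) / (p + c * exp x))"
    proof (rule Bochner_Integration.integrable_bound)
      show "integrable lborel (\<lambda>x::real. (1 / (m * c) + 1 / (m * p)) * exp (- (\<alpha> * \<bar>x\<bar>)))"
        by (intro integrable_mult_right integrable_exp_minus_abs \<alpha>)
      show "AE x in lborel. norm (norm (\<phi> x) / (p + c * exp x)) \<le> norm ((1 / (m * c) + 1 / (m * p)) * exp (- (\<alpha> * \<bar>x\<bar>)))"
        using est p c m by (intro AE_I2) (smt (verit) exp_gt_zero mult_pos_pos divide_nonneg_pos norm_ge_zero real_norm_def)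
    qed measurable
    then have int: "integrable lborel (\<lambda>x. exp (0 * Re (w x)) * norm (\<phi> x) / (- Re (w x)))"
      by (simp add: Rew)
    have eqG: "(LBINT x. exp (of_real t * w x) * \<phi> x) = of_real (exp (- (p * t))) * G t" for t
    proof -
      have "exp (of_real t * w x) * \<phi> x = of_real (exp (- (p * t))) * (?E t x * \<phi> x)" for x
        unfolding w_def right_diff_distrib exp_diff
        by (simp add: exp_minus field_simps flip: exp_of_real)
      then show ?thesis unfolding G_def \<phi>_def[symmetric] by (simp only: integral_mult_right_zero)
    qed
    note SE = superposed_exponentials[OF wm \<phi>m neg int]
    show "set_integrable lborel {0..} (\<lambda>t. of_real (exp (- (p * t))) * G t)"
      using SE(1) by (simp add: eqG)
    have alt: "- exp (of_real 0 * w x) / w x * \<phi> x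
        = exp (Z x) / ((?D x) * (of_real p - exp (Z x)))" for x
    proof -
      define d where "d = of_real p - exp (Z x)"
      have "w x = - d" by (simp add: w_def d_def)
      then show ?thesis unfolding d_def[symmetric] by (simp add: \<phi>_def mult.commute)
    qed
    show "(LBINT t:{0..}. of_real (exp (- (p * t))) * G t)
      = (LBINT x. exp (Z x) / ((?D x) * (of_real p - exp (Z x))))"
      using SE(2) unfolding eqG alt .
    show "integrable lborel (\<lambda>x. exp (Z x) / ((?D x) * (of_real p - exp (Z x))))"
    proof (rule Bochner_Integration.integrable_bound[OF I])
      have "norm (\<phi> x / (of_real p - exp (Z x))) \<le> norm (\<phi> x) / (p + c * exp x)" for x
      proof -
        have "p + c * exp x \<le> norm (of_real p - exp (Z x))"
          using complex_Re_le_cmod[of "of_real p - exp (Z x)"] by (simp add: nZ)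
        moreover have "0 < p + c * exp x" using p c by (simp add: add_pos_pos)
        ultimately show ?thesis unfolding norm_divide by (intro frac_le) auto
      qed
      then show "AE x in lborel. norm (exp (Z x) / ((?D x) * (of_real p - exp (Z x))))
          \<le> norm (norm (\<phi> x) / (p + c * exp x))"
        by (intro AE_I2) (metis \<phi>_def abs_ge_self divide_divide_eq_left order_trans real_norm_def)
    qed measurable
  }
  \<comment> \<open>Since 1 / (P - lam) + 1 / lam = P / (lam (P - lam)) with P = s powr alpha, the
    corrected density carries an extra factor P, which is small at the origin.\<close>
  define \<psi> where "\<psi> x = \<phi> x + exp (Z x) / lam" for x
  have \<psi>m[measurable]: "\<psi> \<in> borel_measurable borel" unfolding \<psi>_def by measurable
  have \<psi>: "norm (\<psi> x) \<le> exp x * (exp (\<alpha> * x) / (norm lam * m * (1 + exp (\<alpha> * x))))" for x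
  proof -
    have ne: "?D x \<noteq> 0" using D0[of x] by force
    have "\<psi> x = exp (Z x) * exp (of_real \<alpha> * Z x) / lam * inverse (?D x)"
      using ne lam unfolding \<psi>_def \<phi>_def by (simp add: field_simps)
    then have "norm (\<psi> x) = exp x * exp (\<alpha> * x) / norm lam * inverse (norm (?D x))"
      by (simp add: norm_mult norm_divide norm_inverse nZ)
    also have "\<dots> \<le> exp x * exp (\<alpha> * x) / norm lam * (1 / (m * (1 + exp (\<alpha> * x))))"
      by (intro mult_left_mono D) auto
    finally show ?thesis by (simp add: mult_ac)
  qed
  define K where "K = 1 / (norm lam * m * c)"
  have K: "0 < K" using lam m c by (simp add: K_def)
  \<comment> \<open>The weight 1 / (- Re s) from the time integral uses up the Jacobian. What
    remains decays like P for x -> - infinity, and through exp (Re s), left over by the lower limit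
    1, for x -> infinity.\<close>
  have est2: "exp (1 * Re (exp (Z x))) * norm (\<psi> x) / (- Re (exp (Z x))) \<le> K * (1 + 1 / c) * exp (- (\<alpha> * \<bar>x\<bar>))" for x
  proof -
    have "exp (1 * Re (exp (Z x))) * norm (\<psi> x) / (- Re (exp (Z x)))
        \<le> exp (- (c * exp x)) * (exp x * (exp (\<alpha> * x) / (norm lam * m * (1 + exp (\<alpha> * x))))) / (c * exp x)"
      unfolding nZ mult_1 minus_minus using \<psi>[of x] c by (intro divide_right_mono mult_left_mono) auto
    also have "\<dots> = K * (exp (- (c * exp x)) * (exp (\<alpha> * x) / (1 + exp (\<alpha> * x))))"
      unfolding K_def by simp
    also have "exp (- (c * exp x)) * (exp (\<alpha> * x) / (1 + exp (\<alpha> * x))) \<le> (1 + 1 / c) * exp (- (\<alpha> * \<bar>x\<bar>))"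
    proof (cases "0 \<le> x")
      case True
      have "c * exp x \<le> exp (c * exp x)" using exp_ge_add_one_self[of "c * exp x"] by linarith
      then have "exp (- (c * exp x)) \<le> 1 / c * exp (- x)" using c by (simp add: exp_minus field_simps)
      moreover have "exp (- x) \<le> exp (- (\<alpha> * x))" using True \<alpha> mult_right_mono[of \<alpha> 1 x] by simp
      ultimately have 1: "exp (- (c * exp x)) \<le> 1 / c * exp (- (\<alpha> * x))"
        using c by (smt (verit) divide_pos_pos mult_left_mono)
      have 2: "exp (\<alpha> * x) / (1 + exp (\<alpha> * x)) \<le> 1" by (simp add: divide_le_eq add_pos_pos)
      have "exp (- (c * exp x)) * (exp (\<alpha> * x) / (1 + exp (\<alpha> * x))) \<le> (1 / c * exp (- (\<alpha> * x))) * 1"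
        using c by (intro mult_mono 1 2) (auto intro!: divide_nonneg_pos add_pos_pos)
      also have "\<dots> \<le> (1 + 1 / c) * exp (- (\<alpha> * \<bar>x\<bar>))" using True by (simp add: distrib_right)
      finally show ?thesis .
    next
      case False
      have "exp (- (c * exp x)) * (exp (\<alpha> * x) / (1 + exp (\<alpha> * x))) \<le> 1 * exp (\<alpha> * x)"
        using c by (intro mult_mono) (auto simp: divide_le_eq add_pos_pos intro!: divide_nonneg_pos)
      also have "\<dots> \<le> (1 + 1 / c) * exp (- (\<alpha> * \<bar>x\<bar>))" using False c by (simp add: distrib_right)
      finally show ?thesis .
    qed
    finally show ?thesis using K by (simp add: mult_ac)
  qed
  have int2: "integrable lborel (\<lambda>x. exp (1 * Re (exp (Z x))) * norm (\<psi> x) / (- Re (exp (Z x))))"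
  proof (rule Bochner_Integration.integrable_bound)
    show "integrable lborel (\<lambda>x::real. K * (1 + 1 / c) * exp (- (\<alpha> * \<bar>x\<bar>)))"
      by (intro integrable_mult_right integrable_exp_minus_abs \<alpha>)
    show "AE x in lborel. norm (exp (1 * Re (exp (Z x))) * norm (\<psi> x) / (- Re (exp (Z x))))
        \<le> norm (K * (1 + 1 / c) * exp (- (\<alpha> * \<bar>x\<bar>)))"
    proof (rule AE_I2)
      fix x
      have "0 \<le> exp (1 * Re (exp (Z x))) * norm (\<psi> x) / (- Re (exp (Z x)))"
        unfolding nZ using c by simp
      then show "norm (exp (1 * Re (exp (Z x))) * norm (\<psi> x) / (- Re (exp (Z x))))
        \<le> norm (K * (1 + 1 / c) * exp (- (\<alpha> * \<bar>x\<bar>)))"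
        using est2[of x] unfolding real_norm_def by linarith
    qed
  qed measurable
  have ezm: "(\<lambda>x. exp (Z x)) \<in> borel_measurable borel" by measurable
  have "set_integrable lborel {1..} (\<lambda>t. LBINT x. ?E t x * \<psi> x)"
    by (rule superposed_exponentials(1)[OF ezm \<psi>m _ int2]) (use c in \<open>simp add: nZ\<close>)
  moreover have "(LBINT x. ?E t x * \<psi> x) = G t - 1 / (of_real t * lam)" if "t \<in> {1..}" for t
  proof -
    have t: "0 < t" using that by simp
    have E: "integrable lborel (\<lambda>x. ?E t x * exp (Z x))"
      unfolding Z_def by (rule exp_ray_integrable[OF t th])
    have iG: "integrable lborel (\<lambda>x. ?E t x * \<phi> x)"
    proof (rule Bochner_Integration.integrable_bound)
      show "integrable lborel (\<lambda>x. complex_of_real (1 / m) * (?E t x * exp (Z x)))"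
        by (intro integrable_mult_right E)
      show "AE x in lborel. norm (?E t x * \<phi> x)
          \<le> norm (of_real (1 / m) * (?E t x * exp (Z x)))"
      proof (rule AE_I2)
        fix x
        show "norm (?E t x * \<phi> x)
          \<le> norm (of_real (1 / m) * (?E t x * exp (Z x)))"
          using mult_left_mono[OF n\<phi>'[of x], of "exp (- (t * (c * exp x)))"] m
          by (simp add: norm_mult nZ norm_divide)
      qed
    qed measurable
    have "(LBINT x. ?E t x * \<psi> x)
        = (LBINT x. ?E t x * \<phi> x + (?E t x * exp (Z x)) / lam)"
      by (simp add: \<psi>_def distrib_left)
    also have "\<dots> = G t + (LBINT x. ?E t x * exp (Z x)) / lam"
      using iG E by (subst Bochner_Integration.integral_add) (auto simp: G_def \<phi>_def)
    finally show ?thesis using exp_ray_integral[OF t th] by (simp add: Z_def)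
  qed
  ultimately show "set_integrable lborel {1..} (\<lambda>t. G t - 1 / (of_real t * lam))"
    by (rule set_integrable_cong[OF refl refl, THEN iffD1, rotated])
qed

section \<open>Evaluation of the contour integral by Cauchy's formula\<close>

text \<open>Removes the singularity at 0, so that p - exp z can be written as z - ln p times a
  holomorphic function.\<close>

lemma expm1_quotient_holomorphic:
  "(\<lambda>u::complex. if u = 0 then 1 else (exp u - 1) / u) holomorphic_on UNIV"
proof -
  have "(\<lambda>z. if z = 0 then deriv (\<lambda>z. exp z - 1) 0 else (exp z - 1) / z - (exp 0 - 1) / (z - (0::complex))) holomorphic_on UNIV"
    by (rule pole_theorem) (auto intro!: holomorphic_intros)
  moreover have "deriv (\<lambda>z::complex. exp z - 1) 0 = 1"
    by (rule DERIV_imp_deriv) (auto intro!: derivative_eq_intros)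
  ultimately show ?thesis by (simp cong: if_cong)
qed

text \<open>Ensures that ln p is the only zero of p - exp z in the strip |Im z| <=
  \<open>\<theta>\<close> < pi.\<close>

lemma exp_eq_1_strip:
  fixes u :: complex
  assumes "exp u = 1" "\<bar>Im u\<bar> < 2 * pi"
  shows "u = 0"
proof -
  obtain n where n: "Re u = 0" "Im u = of_int (2 * n) * pi"
    using assms(1) unfolding exp_eq_1 by auto
  have "\<bar>of_int (2 * n) * pi\<bar> < 2 * pi" using assms(2) n by simp
  then have "\<bar>real_of_int n\<bar> * (2 * pi) < 1 * (2 * pi)" by (simp add: abs_mult mult_ac)
  then have "\<bar>real_of_int n\<bar> < 1" by (subst (asm) mult_less_cancel_right_pos) auto
  then have "n = 0" by linarith
  then show ?thesis using n by (simp add: complex_eq_iff)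
qed

lemma sequentially_integral_symmetric_interval:
  fixes f :: "real \<Rightarrow> complex"
  assumes "integrable lborel f"
  shows "(\<lambda>n. integral {- real n..real n} f) \<longlonglongrightarrow> (LBINT x. f x)"
proof -
  have *: "set_integrable lborel {- real n..real n} f" for n
    unfolding set_integrable_def by (intro integrable_mult_indicator assms) auto
  have "(\<lambda>n. LBINT x. indicator {- real n..real n} x *\<^sub>R f x) \<longlonglongrightarrow> (LBINT x. f x)"
  proof (rule integral_dominated_convergence[where w="\<lambda>x. norm (f x)"])
    show "AE x in lborel. (\<lambda>n. indicator {- real n..real n} x *\<^sub>R f x) \<longlonglongrightarrow> f x"
    proof (rule AE_I2, rule tendsto_eventually)
      fix x :: real
      show "\<forall>\<^sub>F n in sequentially. indicator {- real n..real n} x *\<^sub>R f x = f x"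
        using eventually_ge_at_top[of "nat \<lceil>\<bar>x\<bar>\<rceil>"]
        by eventually_elim (auto simp: indicator_def nat_le_iff ceiling_le_iff abs_le_iff)
    qed
  qed (use assms in \<open>auto simp: indicator_def\<close>)
  then show ?thesis
    using set_borel_integral_eq_integral(2)[OF *] by (simp add: set_lebesgue_integral_def)
qed

text \<open>In the coordinate z = ln s the two rays bound a strip, exhausted by rectangles of
  half-length N. The only pole inside is z = ln p, with residue - 1 / (p powr alpha - lam). The
  vertical sides disappear in the limit: on the right because of the growth of s powr alpha, on the
  left because of the factor exp z.\<close>

lemma resolvent_contour_integral:
  fixes \<alpha> \<theta> m p :: real and lam :: complex
  assumes \<alpha>: "0 < \<alpha>" and \<theta>: "0 < \<theta>" "\<theta> < pi" and m: "0 < m" and p: "0 < p"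
    and bound: "\<And>z. \<bar>Im z\<bar> \<le> \<theta> \<Longrightarrow> m * (1 + exp (\<alpha> * Re z)) \<le> norm (exp (of_real \<alpha> * z) - lam)"
  defines "g \<equiv> \<lambda>z. exp z / ((exp (of_real \<alpha> * z) - lam) * (of_real p - exp z))"
  assumes i1: "integrable lborel (\<lambda>x. g (Complex x \<theta>))" and i2: "integrable lborel (\<lambda>x. g (Complex x (- \<theta>)))"
  shows "(LBINT x. g (Complex x \<theta>)) - (LBINT x. g (Complex x (- \<theta>)))
    = 2 * pi * \<i> / (of_real (p powr \<alpha>) - lam)"
proof -
  let ?I = "\<lambda>a b c d. contour_integral (linepath (Complex a b) (Complex c d)) g"
  let ?G = "\<lambda>\<tau> n. integral {- n..n} (\<lambda>x. g (Complex x \<tau>))"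
  let ?b = "\<lambda>x. exp x / (m * (1 + exp (\<alpha> * x)) * \<bar>p - exp x\<bar>)"
  define l where "l = ln p"
  \<comment> \<open>Splitting off \<open>q\<close>, which has no zero in the strip, gives
    \<open>g\<close> the form h z / (z - l) with \<open>h\<close> holomorphic, as Cauchy's formula
    for a convex set requires.\<close>
  define q :: "complex \<Rightarrow> complex" where "q u = (if u = 0 then 1 else (exp u - 1) / u)" for u
  have qh: "q holomorphic_on S" for S
    using expm1_quotient_holomorphic holomorphic_on_subset unfolding q_def[abs_def] by blast
  have q0: "q u \<noteq> 0" if "\<bar>Im u\<bar> \<le> \<theta>" for u
    using exp_eq_1_strip[of u] that \<theta> by (auto simp: q_def)
  have den: "exp (of_real \<alpha> * z) - lam \<noteq> 0" if "\<bar>Im z\<bar> \<le> \<theta>" for z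
    using bound[OF that] m by (smt (verit) exp_gt_zero mult_pos_pos norm_zero)
  have pl: "of_real p = exp (complex_of_real l)" using p by (simp add: l_def exp_of_real)
  have peq: "of_real p - exp z = - of_real p * (q (z - of_real l) * (z - of_real l))" for z
    by (auto simp: q_def pl exp_diff field_simps)
  define h where "h z = - exp z / ((exp (of_real \<alpha> * z) - lam) * of_real p * q (z - of_real l))" for z
  have gh: "g z = h z / (z - of_real l)" for z
    unfolding g_def h_def peq by (simp add: mult_ac)
  have hl: "h (of_real l) = - 1 / (of_real (p powr \<alpha>) - lam)"
  proof -
    have "exp (of_real \<alpha> * complex_of_real l) = of_real (p powr \<alpha>)"
      using p by (simp add: powr_def l_def flip: exp_of_real)
    then show ?thesis using p by (simp add: h_def q_def pl[symmetric])
  qed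
  have C: "?I (-N) (-\<theta>) N (-\<theta>)
         + ?I N (-\<theta>) N \<theta>
         + ?I N \<theta> (-N) \<theta>
         + ?I (-N) \<theta> (-N) (-\<theta>)
         = - 2 * pi * \<i> / (of_real (p powr \<alpha>) - lam)" (is "?L = _")
    and gcont: "continuous_on (closed_segment (Complex (-N) (-\<theta>)) (Complex N (-\<theta>))) g"
      "continuous_on (closed_segment (Complex N (-\<theta>)) (Complex N \<theta>)) g"
      "continuous_on (closed_segment (Complex N \<theta>) (Complex (-N) \<theta>)) g"
      "continuous_on (closed_segment (Complex (-N) \<theta>) (Complex (-N) (-\<theta>))) g" if N: "\<bar>l\<bar> < N" for N
  proof -
    define a b where "a = Complex (-N) (-\<theta>)" and "b = Complex N \<theta>"
    have lb: "of_real l \<in> box a b" using N \<theta> by (auto simp: in_box_complex_iff a_def b_def)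
    have hol: "h holomorphic_on cbox a b"
    proof -
      have "(\<lambda>z. q (z - of_real l)) holomorphic_on cbox a b"
        by (rule holomorphic_on_compose_gen[of "\<lambda>z. z - of_real l" "cbox a b" q UNIV, unfolded o_def])
           (auto intro!: holomorphic_intros qh)
      then show ?thesis unfolding h_def
        using den q0 p by (intro holomorphic_intros) (auto simp: in_cbox_complex_iff a_def b_def abs_le_iff)
    qed
    have le: "Re a \<le> Re b" "Im a \<le> Im b" using N \<theta> by (auto simp: a_def b_def)
    have im: "path_image (rectpath a b) \<subseteq> cbox a b - {of_real l}"
      using path_image_rectpath_subset_cbox[OF le] path_image_rectpath_inter_box[OF le] lb by blast
    have "(g has_contour_integral 2 * pi * \<i> * winding_number (rectpath a b) (of_real l) * h (of_real l)) (rectpath a b)"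
      unfolding gh[abs_def]
      by (rule Cauchy_integral_formula_convex_simple[OF convex_box(1) hol _ _ im]) (use lb in \<open>auto simp: interior_cbox\<close>)
    then have ci: "(g has_contour_integral - 2 * pi * \<i> / (of_real (p powr \<alpha>) - lam)) (rectpath a b)"
      by (simp add: winding_number_rectpath[OF lb] hl)
    have pim: "path_image (rectpath a b) = closed_segment a (Complex N (-\<theta>)) \<union> closed_segment (Complex N (-\<theta>)) b
       \<union> closed_segment b (Complex (-N) \<theta>) \<union> closed_segment (Complex (-N) \<theta>) a"
      unfolding rectpath_def Let_def by (auto simp: path_image_join a_def b_def)
    have gc: "continuous_on (path_image (rectpath a b)) g"
      unfolding gh[abs_def] using im
      by (intro continuous_intros continuous_on_subset[OF holomorphic_on_imp_continuous_on[OF hol]]) auto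
    show g: "continuous_on (closed_segment (Complex (-N) (-\<theta>)) (Complex N (-\<theta>))) g"
      "continuous_on (closed_segment (Complex N (-\<theta>)) (Complex N \<theta>)) g"
      "continuous_on (closed_segment (Complex N \<theta>) (Complex (-N) \<theta>)) g"
      "continuous_on (closed_segment (Complex (-N) \<theta>) (Complex (-N) (-\<theta>))) g"
      by (rule continuous_on_subset[OF gc], unfold pim, unfold a_def b_def, blast)+
    note gi = g[THEN contour_integrable_continuous_linepath]
    have "?L = contour_integral (rectpath a b) g"
      unfolding rectpath_def Let_def using gi by (simp add: a_def b_def add.assoc)
    then show "?L = - 2 * pi * \<i> / (of_real (p powr \<alpha>) - lam)"
      using contour_integral_unique[OF ci] by simp
  qed
  have hor: "?I (-N) \<tau> N \<tau> = integral {-N..N} (\<lambda>x. g (Complex x \<tau>))"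
    if "0 < N" for N \<tau>
  proof -
    have "linepath (Complex (-N) \<tau>) (Complex N \<tau>) x = linepath (of_real (-N)) (of_real N) x + \<i> * of_real \<tau>" for x
      by (simp add: linepath_def complex_eq_iff algebra_simps)
    moreover have "Complex N \<tau> - Complex (-N) \<tau> = complex_of_real N - complex_of_real (-N)"
      by (simp add: complex_eq_iff)
    ultimately have "?I (-N) \<tau> N \<tau>
        = contour_integral (linepath (of_real (-N)) (of_real N)) (\<lambda>z. g (z + \<i> * of_real \<tau>))"
      by (simp only: contour_integral_integral vector_derivative_linepath_at)
    also have "\<dots> = integral {-N..N} (\<lambda>x. g (Complex x \<tau>))"
      using that by (subst contour_integral_linepath_Reals_eq) (auto simp: Complex_eq)
    finally show ?thesis .
  qed
  \<comment> \<open>By the reverse triangle inequality |p - exp z| >= |p - exp (Re z)|; the bound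
    involves Re z only and is constant on each vertical side.\<close>
  have vert: "norm (g z) \<le> exp (Re z) / (m * (1 + exp (\<alpha> * Re z)) * \<bar>p - exp (Re z)\<bar>)" if "\<bar>Im z\<bar> \<le> \<theta>" "exp (Re z) \<noteq> p" for z
  proof -
    have 1: "\<bar>p - exp (Re z)\<bar> \<le> norm (of_real p - exp z)"
      using norm_triangle_ineq3[of "of_real p" "exp z"] p by (simp add: norm_exp_eq_Re)
    have "m * (1 + exp (\<alpha> * Re z)) * \<bar>p - exp (Re z)\<bar> \<le> norm (exp (of_real \<alpha> * z) - lam) * norm (of_real p - exp z)"
      using m by (intro mult_mono bound 1 that) auto
    then show ?thesis unfolding g_def norm_divide norm_mult
      using that m by (intro frac_le) (auto simp: norm_exp_eq_Re intro!: mult_pos_pos add_pos_pos)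
  qed
  have vlim: "(\<lambda>n. ?I (s n) u (s n) v) \<longlonglongrightarrow> 0"
    if uv: "\<bar>u\<bar> \<le> \<theta>" "\<bar>v\<bar> \<le> \<theta>"
      and lim: "(\<lambda>n. ?b (s n)) \<longlonglongrightarrow> 0"
      and ev: "\<forall>\<^sub>F n in sequentially. exp (s n) \<noteq> p \<and> continuous_on (closed_segment (Complex (s n) u) (Complex (s n) v)) g"
    for s :: "nat \<Rightarrow> real" and u v
  proof (rule Lim_null_comparison)
    have "(\<lambda>n. ?b (s n) * \<bar>v - u\<bar>) \<longlonglongrightarrow> 0 * \<bar>v - u\<bar>"
      by (intro tendsto_intros lim)
    then show "(\<lambda>n. ?b (s n) * \<bar>v - u\<bar>) \<longlonglongrightarrow> 0" by simp
    show "\<forall>\<^sub>F n in sequentially. norm (?I (s n) u (s n) v)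
       \<le> ?b (s n) * \<bar>v - u\<bar>"
      using ev
    proof eventually_elim
      case (elim n)
      have "norm (?I (s n) u (s n) v)
        \<le> ?b (s n) * norm (Complex (s n) v - Complex (s n) u)"
      proof (rule contour_integral_bound_linepath)
        show "g contour_integrable_on linepath (Complex (s n) u) (Complex (s n) v)"
          using elim by (simp add: contour_integrable_continuous_linepath)
        show "0 \<le> ?b (s n)"
          using m by (auto intro!: divide_nonneg_nonneg mult_nonneg_nonneg add_nonneg_nonneg)
        fix x assume "x \<in> closed_segment (Complex (s n) u) (Complex (s n) v)"
        then have "Re x = s n" "Im x \<in> closed_segment u v"
          by (auto simp: closed_segment_same_Re)
        then have "Re x = s n" "\<bar>Im x\<bar> \<le> \<theta>"
          using uv by (auto simp: closed_segment_eq_real_ivl abs_le_iff split: if_splits)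
        then show "norm (g x) \<le> ?b (s n)"
          using vert[of x] elim by simp
      qed
      then show ?case by (simp add: cmod_def)
    qed
  qed
  have evN: "\<forall>\<^sub>F n in sequentially. \<bar>l\<bar> < real n"
    using eventually_gt_at_top[of "nat \<lceil>\<bar>l\<bar>\<rceil>"] by eventually_elim linarith
  have nep: "exp x \<noteq> p" if "\<bar>l\<bar> < \<bar>x\<bar>" for x using that by (auto simp: l_def)
  have v1: "(\<lambda>n. ?I (real n) (-\<theta>) (real n) \<theta>) \<longlonglongrightarrow> 0"
  proof (rule vlim)
    show "(\<lambda>n. exp (real n) / (m * (1 + exp (\<alpha> * real n)) * \<bar>p - exp (real n)\<bar>)) \<longlonglongrightarrow> 0"
      using m \<alpha> p by real_asymp
    show "\<forall>\<^sub>F n in sequentially. exp (real n) \<noteq> p \<and> continuous_on (closed_segment (Complex (real n) (-\<theta>)) (Complex (real n) \<theta>)) g"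
      using evN by eventually_elim (intro conjI nep gcont, auto)
  qed (use \<theta> in auto)
  have v2: "(\<lambda>n. ?I (- real n) \<theta> (- real n) (-\<theta>)) \<longlonglongrightarrow> 0"
  proof (rule vlim)
    show "(\<lambda>n. exp (- real n) / (m * (1 + exp (\<alpha> * - real n)) * \<bar>p - exp (- real n)\<bar>)) \<longlonglongrightarrow> 0"
      using m \<alpha> p by real_asymp
    show "\<forall>\<^sub>F n in sequentially. exp (- real n) \<noteq> p \<and> continuous_on (closed_segment (Complex (- real n) \<theta>) (Complex (- real n) (-\<theta>))) g"
      using evN by eventually_elim (intro conjI nep gcont, auto)
  qed (use \<theta> in auto)
  \<comment> \<open>The rectangle is traversed counterclockwise, so the upper side runs from right
    to left and enters with a minus sign; the claim is the negative of this limit.\<close>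
  have L1: "(\<lambda>n. ?G (-\<theta>) (real n)
         + ?I (real n) (-\<theta>) (real n) \<theta>
         - ?G \<theta> (real n)
         + ?I (- real n) \<theta> (- real n) (-\<theta>))
       \<longlonglongrightarrow> (LBINT x. g (Complex x (- \<theta>))) + 0 - (LBINT x. g (Complex x \<theta>)) + 0"
    by (intro tendsto_intros v1 v2 sequentially_integral_symmetric_interval i1 i2)
  have L2: "\<forall>\<^sub>F n in sequentially. ?G (-\<theta>) (real n)
         + ?I (real n) (-\<theta>) (real n) \<theta>
         - ?G \<theta> (real n)
         + ?I (- real n) \<theta> (- real n) (-\<theta>)
       = - 2 * pi * \<i> / (of_real (p powr \<alpha>) - lam)"
    using evN
  proof eventually_elim
    case (elim n)
    have "?I (real n) \<theta> (- real n) \<theta>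
        = - ?I (- real n) \<theta> (real n) \<theta>"
      using contour_integral_reversepath[of "linepath (Complex (- real n) \<theta>) (Complex (real n) \<theta>)" g] by simp
    then show ?case using C[OF elim] hor[of "real n"] elim by simp
  qed
  have "(LBINT x. g (Complex x (- \<theta>))) + 0 - (LBINT x. g (Complex x \<theta>)) + 0
      = - 2 * pi * \<i> / (of_real (p powr \<alpha>) - lam)"
    using LIMSEQ_unique[OF L1 tendsto_eventually[OF L2]] by simp
  then show ?thesis by (simp add: algebra_simps)
qed

section \<open>The scalar resolvent kernel\<close>

text \<open>The function \<open>r\<close> is the inverse Laplace integral of 1 / (s powr alpha -
  lam) with the vertical line bent to the rays of argument \<open>\<theta>\<close> and -
  \<open>\<theta>\<close>, the lower one run inwards and the upper one outwards.\<close>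

theorem resolvent_kernel_exists:
  fixes \<alpha> :: real and lam :: complex
  assumes \<alpha>: "0 < \<alpha>" "\<alpha> < 1" and arg: "\<alpha> * pi / 2 < \<bar>Arg lam\<bar>"
  obtains r :: "real \<Rightarrow> complex" where "set_integrable lborel {0..} r"
    "\<And>p. 0 < p \<Longrightarrow> (LBINT t:{0..}. of_real (exp (- (p * t))) * r t) = 1 / (of_real (p powr \<alpha>) - lam)"
proof -
  \<comment> \<open>The upper limit for \<open>\<theta>\<close>: below pi there is only one zero of
    p - exp z, below |Arg lam| / alpha there is no zero of exp (alpha z) - lam. The hypothesis on
    Arg leaves room above pi / 2, and \<open>\<theta>\<close> is the midpoint.\<close>
  define b where "b = min pi (\<bar>Arg lam\<bar> / \<alpha>)"
  have b: "pi / 2 < b" using arg \<alpha> by (simp add: b_def field_simps)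
  define \<theta> where "\<theta> = (pi / 2 + b) / 2"
  have \<theta>1: "pi / 2 < \<theta>" and \<theta>b: "\<theta> < b" using b by (simp_all add: \<theta>_def)
  have \<theta>: "0 < \<theta>" "\<theta> < pi" using \<theta>1 \<theta>b pi_gt_zero by (auto simp: b_def intro: less_trans[of 0 "pi/2"])
  have "\<theta> < \<bar>Arg lam\<bar> / \<alpha>" using \<theta>b by (simp add: b_def)
  then have \<alpha>\<theta>: "\<alpha> * \<theta> < \<bar>Arg lam\<bar>" using \<alpha> by (simp add: field_simps)
  have cos: "cos \<theta> < 0" "cos (- \<theta>) < 0" using cos_monotone_0_pi[of "pi/2" \<theta>] \<theta>1 \<theta> by auto
  have lam0: "lam \<noteq> 0" using arg \<alpha> by (auto simp: Arg_zero mult_less_0_iff)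
  obtain m where m: "0 < m"
    and bound: "\<And>z. \<bar>Im z\<bar> \<le> \<theta> \<Longrightarrow> m * (1 + exp (\<alpha> * Re z)) \<le> norm (exp (of_real \<alpha> * z) - lam)"
    using strip_denominator_bound[OF \<alpha>(1) _ \<alpha>\<theta>] \<theta> by auto
  have bd: "m * (1 + exp (\<alpha> * x)) \<le> norm (exp (of_real \<alpha> * Complex x \<theta>) - lam)"
    "m * (1 + exp (\<alpha> * x)) \<le> norm (exp (of_real \<alpha> * Complex x (- \<theta>)) - lam)" for x
    using bound[of "Complex x \<theta>"] bound[of "Complex x (- \<theta>)"] \<theta> by simp_all
  define G where "G \<tau> t = (LBINT x. exp (of_real t * exp (Complex x \<tau>)) * (exp (Complex x \<tau>) / (exp (of_real \<alpha> * Complex x \<tau>) - lam)))" for \<tau> t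
  define g where "g p z = exp z / ((exp (of_real \<alpha> * z) - lam) * (complex_of_real p - exp z))" for p z
  note B1 = resolvent_ray_branch[OF \<alpha> cos(1) lam0 m bd(1), folded G_def g_def]
  note B2 = resolvent_ray_branch[OF \<alpha> cos(2) lam0 m bd(2), folded G_def g_def]
  define r where "r t = (G \<theta> t - G (- \<theta>) t) / (2 * pi * \<i>)" for t
  have rexp: "of_real (exp (- (p * t))) * r t =
      (of_real (exp (- (p * t))) * G \<theta> t - of_real (exp (- (p * t))) * G (- \<theta>) t) / (2 * pi * \<i>)" for p t
    by (simp add: r_def right_diff_distrib)
  have i01: "set_integrable lborel {0..} (\<lambda>t. of_real (exp (- (p * t))) * r t)" if "0 < p" for p
    unfolding rexp using B1(1)[OF that] B2(1)[OF that] by (intro set_integrable_divide set_integral_diff) auto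
  show thesis
  proof
    \<comment> \<open>Laplace integrability at p = 1 already gives integrability here, because exp
      (- t) is bounded away from 0 on [0, 1].\<close>
    have A: "set_integrable lborel {0..1} r"
    proof (rule set_integrable_bound)
      have "set_integrable lborel {0..1} (\<lambda>t. of_real (exp (- (1 * t))) * r t)"
        by (rule set_integrable_subset[OF i01]) auto
      then show "set_integrable lborel {0..1} (\<lambda>t. of_real (exp 1) * (of_real (exp (- (1 * t))) * r t))"
        by (rule set_integrable_mult_right)
      have "set_borel_measurable lborel {0..1} (\<lambda>t. of_real (exp t) * (of_real (exp (- (1 * t))) * r t))"
      proof -
        have "(\<lambda>x. complex_of_real (exp x) * (indicator {0..1} x *\<^sub>R (of_real (exp (- (1 * x))) * r x))) \<in> borel_measurable lborel"
          using \<open>set_integrable lborel {0..1} (\<lambda>t. of_real (exp (- (1 * t))) * r t)\<close>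
          unfolding set_integrable_def by (intro borel_measurable_times[OF _ borel_measurable_integrable]) measurable
        then show ?thesis by (simp add: set_borel_measurable_def)
      qed
      moreover have "of_real (exp t) * (of_real (exp (- (1 * t))) * r t) = r t" for t
        by (simp add: exp_minus flip: of_real_mult mult.assoc)
      ultimately show "set_borel_measurable lborel {0..1} r" by (simp only:)
      show "AE x in lborel. x \<in> {0..1} \<longrightarrow> norm (r x) \<le> norm (of_real (exp 1) * (of_real (exp (- (1 * x))) * r x))"
      proof (intro AE_I2 impI)
        fix x :: real assume "x \<in> {0..1}"
        then have "1 * norm (r x) \<le> (exp 1 * exp (- x)) * norm (r x)"
          by (intro mult_right_mono) (auto simp flip: exp_add)
        then show "norm (r x) \<le> norm (of_real (exp 1) * (of_real (exp (- (1 * x))) * r x))"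
          by (simp add: norm_mult)
      qed
    qed
    have "set_integrable lborel {1..} (\<lambda>t. ((G \<theta> t - 1 / (of_real t * lam)) - (G (- \<theta>) t - 1 / (of_real t * lam))) / (2 * pi * \<i>))"
      by (rule set_integrable_divide[OF set_integral_diff(1)[OF B1(4) B2(4)]])
    then have "set_integrable lborel {1..} r" by (simp add: r_def[abs_def])
    then have "set_integrable lborel ({0..1} \<union> {1..}) r"
      using A by (intro set_integrable_Un) auto
    moreover have "{0..1} \<union> {1..} = {0::real..}" by auto
    ultimately show "set_integrable lborel {0..} r" by simp
    fix p :: real assume p: "0 < p"
    have "(LBINT t:{0..}. of_real (exp (- (p * t))) * r t) =
      ((LBINT t:{0..}. of_real (exp (- (p * t))) * G \<theta> t) - (LBINT t:{0..}. of_real (exp (- (p * t))) * G (- \<theta>) t)) / (2 * pi * \<i>)"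
      unfolding rexp using B1(1)[OF p] B2(1)[OF p] by (simp add: set_integral_divide_zero)
    also have "\<dots> = (2 * pi * \<i> / (of_real (p powr \<alpha>) - lam)) / (2 * pi * \<i>)"
      unfolding B1(2)[OF p] B2(2)[OF p]
      by (subst resolvent_contour_integral[OF \<alpha>(1) \<theta> m p bound, folded g_def, OF _ B1(3)[OF p] B2(3)[OF p]]) auto
    also have "\<dots> = 1 / (of_real (p powr \<alpha>) - lam)" by simp
    finally show "(LBINT t:{0..}. of_real (exp (- (p * t))) * r t) = 1 / (of_real (p powr \<alpha>) - lam)" .
  qed
qed

section \<open>Convolution on the half-line\<close>

definition half_conv :: "(real \<Rightarrow> 'b) \<Rightarrow> (real \<Rightarrow> 'b) \<Rightarrow> real \<Rightarrow> 'b::{real_normed_field, euclidean_space}" where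
  "half_conv a h t = (LBINT s:{0..t}. a (t - s) * h s)"

definition locally_integrable :: "(real \<Rightarrow> 'b::{real_normed_field, euclidean_space}) \<Rightarrow> bool" where
  "locally_integrable a \<longleftrightarrow> (\<forall>T. set_integrable lborel {0..T} a)"

text \<open>Cutting both factors off to [0, T] turns \<open>half_conv\<close> on [0, T] into a
  convolution over the whole line, to which translation, reflection and Fubini apply.\<close>

definition cutoff :: "real \<Rightarrow> (real \<Rightarrow> 'b) \<Rightarrow> real \<Rightarrow> 'b::real_vector" where
  "cutoff T a s = indicator {0..T} s *\<^sub>R a s"

lemma cutoff_integrable: "locally_integrable a \<Longrightarrow> integrable lborel (cutoff T a)"
  by (simp add: locally_integrable_def set_integrable_def cutoff_def[abs_def])

lemma norm_mult_le_bound: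
  fixes x y :: "'b::real_normed_field"
  shows "norm y \<le> M \<Longrightarrow> norm (x * y) \<le> M * norm x"
  by (metis mult.commute mult_right_mono norm_ge_zero norm_mult)

lemma cutoff_continuous:
  fixes h :: "real \<Rightarrow> 'b::{real_normed_field, euclidean_space}"
  assumes "continuous_on {0..} h"
  shows "cutoff T h \<in> borel_measurable borel" and "\<exists>M\<ge>0. \<forall>s. norm (cutoff T h s) \<le> M"
proof -
  have c: "continuous_on {0..T} h" by (rule continuous_on_subset[OF assms]) auto
  show "cutoff T h \<in> borel_measurable borel"
    unfolding cutoff_def[abs_def] by (rule borel_measurable_continuous_on_indicator[OF _ c]) auto
  have "compact (h ` {0..T})" by (rule compact_continuous_image[OF c]) auto
  then have "bounded (h ` {0..T})" by (rule compact_imp_bounded)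
  then obtain M where "\<forall>x\<in>h ` {0..T}. norm x \<le> M" unfolding bounded_iff by auto
  then show "\<exists>M\<ge>0. \<forall>s. norm (cutoff T h s) \<le> M"
    by (intro exI[of _ "max 0 M"]) (auto simp: cutoff_def indicator_def le_max_iff_disj)
qed

lemma continuous_locally_integrable:
  "continuous_on {0..} h \<Longrightarrow> locally_integrable h"
  unfolding locally_integrable_def by (auto intro!: borel_integrable_atLeastAtMost' elim: continuous_on_subset)

lemma half_conv_cutoff:
  assumes "t \<le> T"
  shows "half_conv a h t = (LBINT s. cutoff T a (t - s) * cutoff T h s)"
  unfolding half_conv_def set_lebesgue_integral_def
  by (rule Bochner_Integration.integral_cong) (use assms in \<open>auto simp: cutoff_def indicator_def\<close>)

lemma lborel_integral_reflect:
  fixes f :: "real \<Rightarrow> 'b::euclidean_space"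
  shows "(LBINT s. f (t - s)) = (LBINT s. f s)"
  using lborel_integral_real_affine[of "-1" f t] by simp

lemma lborel_integral_shift:
  fixes f :: "real \<Rightarrow> 'b::euclidean_space"
  shows "(LBINT s. f (s - u)) = (LBINT s. f s)"
  using lborel_integral_real_affine[of 1 f "- u"] by simp

lemma lborel_integrable_reflect:
  fixes f :: "real \<Rightarrow> 'b::euclidean_space"
  assumes "integrable lborel f"
  shows "integrable lborel (\<lambda>s. f (t - s))"
  using lborel_integrable_real_affine[OF assms, of "-1" t] by simp

lemma half_conv_commute: "half_conv a h t = half_conv h a t"
proof -
  have "half_conv a h t = (LBINT s. cutoff t a (t - s) * cutoff t h (t - (t - s)))"
    by (simp add: half_conv_cutoff[OF order_refl])
  also have "\<dots> = (LBINT s. cutoff t a s * cutoff t h (t - s))"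
    by (rule lborel_integral_reflect[of "\<lambda>s. cutoff t a s * cutoff t h (t - s)"])
  also have "\<dots> = half_conv h a t" by (simp add: half_conv_cutoff[OF order_refl] mult.commute)
  finally show ?thesis .
qed

lemma half_conv_0: "half_conv a h 0 = 0"
  unfolding half_conv_def set_lebesgue_integral_def
  by (subst integral_discrete_difference[where X="{0}" and g="\<lambda>_. 0"]) auto

lemma cutoff_product_integrable:
  assumes a: "locally_integrable a" and h: "continuous_on {0..} h"
  shows "integrable lborel (\<lambda>s. cutoff T a (t - s) * cutoff S h s)"
proof -
  obtain M where M: "0 \<le> M" "\<And>s. norm (cutoff S h s) \<le> M" using cutoff_continuous(2)[OF h] by blast
  note [measurable] = cutoff_continuous(1)[OF h, of S]
  note ia = lborel_integrable_reflect[OF cutoff_integrable[OF a, of T], of t]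
  show ?thesis
  proof (rule Bochner_Integration.integrable_bound)
    show "integrable lborel (\<lambda>s. M * norm (cutoff T a (t - s)))"
      using ia by (intro integrable_mult_right integrable_norm)
    show "AE s in lborel. norm (cutoff T a (t - s) * cutoff S h s) \<le> norm (M * norm (cutoff T a (t - s)))"
      using M by (intro AE_I2) (auto intro: order_trans[OF norm_mult_le_bound])
    show "(\<lambda>s. cutoff T a (t - s) * cutoff S h s) \<in> borel_measurable lborel"
      using borel_measurable_integrable[OF ia] by measurable
  qed
qed

lemma half_conv_integrable:
  assumes "locally_integrable a" "continuous_on {0..} h"
  shows "set_integrable lborel {0..t} (\<lambda>s. a (t - s) * h s)"
  unfolding set_integrable_def
  by (rule Bochner_Integration.integrable_cong[THEN iffD1, OF refl _ cutoff_product_integrable[OF assms, of t t t]])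
     (auto simp: cutoff_def indicator_def)

lemma half_conv_add:
  assumes "locally_integrable a" "continuous_on {0..} h" "continuous_on {0..} g"
  shows "half_conv a (\<lambda>s. h s + g s) t = half_conv a h t + half_conv a g t"
  unfolding half_conv_def distrib_left using assms by (intro set_integral_add half_conv_integrable)

lemma half_conv_cmult: "half_conv a (\<lambda>s. c * h s) t = c * half_conv a h t"
  unfolding half_conv_def set_lebesgue_integral_def
  by (simp add: mult.left_commute flip: mult_scaleR_right)

lemma half_conv_cong:
  assumes "\<And>s. 0 \<le> s \<Longrightarrow> s \<le> t \<Longrightarrow> h s = g s"
  shows "half_conv a h t = half_conv a g t"
  unfolding half_conv_def set_lebesgue_integral_def
  by (rule Bochner_Integration.integral_cong) (use assms in \<open>auto simp: indicator_def\<close>)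

text \<open>The kernels are compared only at positive arguments, s = t being a null set. This is
  needed for the convolution of two fractional kernels, which equals 1 for t > 0 but 0 at t =
  0.\<close>

lemma half_conv_cong_left:
  assumes "\<And>s. 0 < s \<Longrightarrow> s \<le> t \<Longrightarrow> a s = b s"
  shows "half_conv a h t = half_conv b h t"
  unfolding half_conv_def set_lebesgue_integral_def
  by (rule integral_discrete_difference[where X="{t}"]) (use assms in \<open>auto simp: indicator_def\<close>)

lemma half_conv_norm_le:
  assumes a: "locally_integrable a" and h: "continuous_on {0..} h"
    and M: "\<And>s. 0 \<le> s \<Longrightarrow> s \<le> t \<Longrightarrow> norm (h s) \<le> M"
  shows "norm (half_conv a h t) \<le> M * (LBINT s:{0..t}. norm (a s))"
proof -
  have ia: "integrable lborel (\<lambda>s. norm (cutoff t a s))" using cutoff_integrable[OF a] by simp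
  have "norm (half_conv a h t) \<le> (LBINT s. norm (cutoff t a (t - s) * cutoff t h s))"
    unfolding half_conv_cutoff[OF order_refl] by (rule integral_norm_bound)
  also have "\<dots> \<le> (LBINT s. M * norm (cutoff t a (t - s)))"
  proof (rule integral_mono)
    show "integrable lborel (\<lambda>s. norm (cutoff t a (t - s) * cutoff t h s))"
      by (intro integrable_norm cutoff_product_integrable[OF a h])
    show "integrable lborel (\<lambda>s. M * norm (cutoff t a (t - s)))"
      using lborel_integrable_reflect[OF ia] by (intro integrable_mult_right)
    show "norm (cutoff t a (t - s) * cutoff t h s) \<le> M * norm (cutoff t a (t - s))" for s
    proof (cases "0 \<le> s \<and> s \<le> t")
      case True
      then show ?thesis using M[of s] by (intro norm_mult_le_bound) (simp add: cutoff_def)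
    next
      case False
      then show ?thesis by (auto simp: cutoff_def)
    qed
  qed
  also have "\<dots> = M * (LBINT s. norm (cutoff t a s))"
    using lborel_integral_reflect[of "\<lambda>s. norm (cutoff t a s)" t] by simp
  also have "(LBINT s. norm (cutoff t a s)) = (LBINT s:{0..t}. norm (a s))"
    by (simp add: cutoff_def set_lebesgue_integral_def)
  finally show ?thesis .
qed

text \<open>Fubini for the cut-off functions. Boundedness of the cut-off \<open>h\<close> dominates
  the inner integral by a multiple of the L1 norm of \<open>b\<close>, which leaves only
  \<open>a\<close> to be integrated.\<close>

lemma half_conv_assoc:
  assumes a: "locally_integrable a" and b: "locally_integrable b" and h: "continuous_on {0..} h"
  shows "half_conv a (half_conv b h) t = half_conv (half_conv a b) h t"
proof -
  define a' b' h' where "a' = cutoff t a" and "b' = cutoff t b" and "h' = cutoff t h"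
  obtain M where M: "0 \<le> M" "\<And>s. norm (h' s) \<le> M" using cutoff_continuous(2)[OF h] unfolding h'_def by blast
  have hm[measurable]: "h' \<in> borel_measurable borel" unfolding h'_def by (rule cutoff_continuous(1)[OF h])
  have ia: "integrable lborel a'" and ib: "integrable lborel b'"
    unfolding a'_def b'_def using a b by (auto intro: cutoff_integrable)
  have am[measurable]: "a' \<in> borel_measurable borel" and bm[measurable]: "b' \<in> borel_measurable borel"
    using ia ib by auto
  define F where "F s u = a' (t - s) * (b' (s - u) * h' u)" for s u
  have ibh: "integrable lborel (\<lambda>u. b' (s - u) * h' u)" for s
    unfolding b'_def h'_def by (rule cutoff_product_integrable[OF b h])
  have J: "integrable (lborel \<Otimes>\<^sub>M lborel) (case_prod F)"
  proof (rule lborel_pair.Fubini_integrable)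
    show "case_prod F \<in> borel_measurable (lborel \<Otimes>\<^sub>M lborel)" unfolding F_def by measurable
    show "AE s in lborel. integrable lborel (\<lambda>u. case_prod F (s, u))"
      unfolding F_def using ibh by simp
    show "integrable lborel (\<lambda>s. \<integral>u. norm (case_prod F (s, u)) \<partial>lborel)"
    proof (rule Bochner_Integration.integrable_bound)
      show "integrable lborel (\<lambda>s. norm (a' (t - s)) * (M * (LBINT u. norm (b' u))))"
        using lborel_integrable_reflect[OF ia, of t] by (intro integrable_mult_left integrable_norm)
      show "(\<lambda>s. \<integral>u. norm (case_prod F (s, u)) \<partial>lborel) \<in> borel_measurable lborel"
        unfolding F_def by measurable
      show "AE s in lborel. norm (\<integral>u. norm (case_prod F (s, u)) \<partial>lborel)
          \<le> norm (norm (a' (t - s)) * (M * (LBINT u. norm (b' u))))"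
      proof (rule AE_I2)
        fix s
        have "(\<integral>u. norm (b' (s - u) * h' u) \<partial>lborel) \<le> (\<integral>u. M * norm (b' (s - u)) \<partial>lborel)"
        proof (rule integral_mono)
          show "integrable lborel (\<lambda>u. M * norm (b' (s - u)))"
            using lborel_integrable_reflect[OF ib, of s] by (intro integrable_mult_right integrable_norm)
          show "norm (b' (s - u) * h' u) \<le> M * norm (b' (s - u))" for u
            by (intro norm_mult_le_bound M)
        qed (use ibh in simp)
        also have "\<dots> = M * (LBINT u. norm (b' u))"
          using lborel_integral_reflect[of "\<lambda>u. norm (b' u)" s] by simp
        finally have "norm (a' (t - s)) * (\<integral>u. norm (b' (s - u) * h' u) \<partial>lborel)
            \<le> norm (a' (t - s)) * (M * (LBINT u. norm (b' u)))"
          by (intro mult_left_mono) auto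
        then show "norm (\<integral>u. norm (case_prod F (s, u)) \<partial>lborel)
            \<le> norm (norm (a' (t - s)) * (M * (LBINT u. norm (b' u))))"
          using M by (simp add: F_def norm_mult abs_mult)
      qed
    qed
  qed
  have 1: "half_conv a (half_conv b h) t = (LBINT s. LBINT u. F s u)"
    unfolding half_conv_cutoff[OF order_refl, of a]
  proof (rule Bochner_Integration.integral_cong[OF refl])
    fix s
    show "cutoff t a (t - s) * cutoff t (half_conv b h) s = (LBINT u. F s u)"
    proof (cases "0 \<le> s \<and> s \<le> t")
      case True
      then show ?thesis
        by (simp add: cutoff_def[of t "half_conv b h"] F_def half_conv_cutoff[of s t] a'_def b'_def h'_def)
    next
      case False
      have "F s u = 0" for u
        using False by (auto simp: F_def a'_def b'_def h'_def cutoff_def indicator_def)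
      then show ?thesis using False by (simp add: cutoff_def)
    qed
  qed
  have 2: "half_conv (half_conv a b) h t = (LBINT u. LBINT s. F s u)"
    unfolding half_conv_cutoff[OF order_refl, of _ h]
  proof (rule Bochner_Integration.integral_cong[OF refl])
    fix u
    show "cutoff t (half_conv a b) (t - u) * cutoff t h u = (LBINT s. F s u)"
    proof (cases "0 \<le> u \<and> u \<le> t")
      case True
      have "half_conv a b (t - u) = (LBINT s. a' (t - u - s) * b' s)"
        using True half_conv_cutoff[of "t - u" t a b] by (simp add: a'_def b'_def)
      also have "\<dots> = (LBINT s. a' (t - s) * b' (s - u))"
        using lborel_integral_shift[of "\<lambda>s. a' (t - u - s) * b' s" u] by simp
      finally have "half_conv a b (t - u) * h' u = (LBINT s. F s u)"
        by (simp add: F_def flip: mult.assoc)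
      then show ?thesis using True by (simp add: cutoff_def[of t "half_conv a b"] h'_def)
    next
      case False
      then show ?thesis by (simp add: F_def h'_def cutoff_def)
    qed
  qed
  show ?thesis unfolding 1 2 by (rule lborel_pair.Fubini_integral[OF J, symmetric])
qed

text \<open>The kernel may be singular, so the shift is moved to the continuous factor and dominated
  convergence is used with majorant M |a|. The cut-off of \<open>h\<close> jumps at 0, which spoils
  pointwise convergence only for u = t, a null set.\<close>

lemma continuous_on_half_conv:
  assumes a: "locally_integrable a" and h: "continuous_on {0..} h"
  shows "continuous_on {0..} (half_conv a h)"
  unfolding continuous_on_sequentially
proof (intro allI ballI impI)
  fix x and t :: real
  assume t: "t \<in> {0..}" and x: "(\<forall>n. x n \<in> {0..}) \<and> x \<longlonglongrightarrow> t"
  \<comment> \<open>The extra unit keeps \<open>x n\<close> eventually below \<open>T\<close>, also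
    when t is approached from the right.\<close>
  define T where "T = t + 1"
  have ev: "\<forall>\<^sub>F n in sequentially. x n < T" using x by (intro order_tendstoD) (auto simp: T_def)
  obtain M where M: "0 \<le> M" "\<And>s. norm (cutoff T h s) \<le> M" using cutoff_continuous(2)[OF h] by blast
  note [measurable] = cutoff_continuous(1)[OF h, of T]
  note ia = cutoff_integrable[OF a, of T]
  note [measurable] = borel_measurable_integrable[OF ia]
  have eq: "half_conv a h s = (LBINT u. cutoff T a u * cutoff T h (s - u))" if "s \<le> T" for s
    using half_conv_cutoff[OF that, of h a] by (simp add: half_conv_commute[of a] mult.commute)
  have "(\<lambda>n. LBINT u. cutoff T a u * cutoff T h (x n - u)) \<longlonglongrightarrow> (LBINT u. cutoff T a u * cutoff T h (t - u))"
  proof (rule integral_dominated_convergence[where w="\<lambda>u. M * norm (cutoff T a u)"])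
    show "integrable lborel (\<lambda>u. M * norm (cutoff T a u))" using ia by simp
    show "AE u in lborel. norm (cutoff T a u * cutoff T h (x n - u)) \<le> M * norm (cutoff T a u)" for n
      using M by (intro AE_I2 norm_mult_le_bound) auto
    show "AE u in lborel. (\<lambda>n. cutoff T a u * cutoff T h (x n - u)) \<longlonglongrightarrow> cutoff T a u * cutoff T h (t - u)"
      using AE_lborel_singleton[of t]
    proof eventually_elim
      case (elim u)
      have lim: "(\<lambda>n. x n - u) \<longlonglongrightarrow> t - u" using x by (intro tendsto_intros) auto
      consider "u < 0" | "0 \<le> u" "u < t" | "t < u" using elim by linarith
      then show ?case
      proof cases
        case 1
        then show ?thesis by (simp add: cutoff_def)
      next
        case 2
        have "isCont h (t - u)"
          using continuous_on_interior[OF h, of "t - u"] 2 by simp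
        then have "(\<lambda>n. h (x n - u)) \<longlonglongrightarrow> h (t - u)" using lim isCont_tendsto_compose by blast
        moreover have "\<forall>\<^sub>F n in sequentially. h (x n - u) = cutoff T h (x n - u)"
        proof -
          have "\<forall>\<^sub>F n in sequentially. 0 < x n - u" using order_tendstoD(1)[OF lim, of 0] 2 by simp
          with ev show ?thesis by eventually_elim (use 2 in \<open>auto simp: cutoff_def\<close>)
        qed
        ultimately have "(\<lambda>n. cutoff T h (x n - u)) \<longlonglongrightarrow> h (t - u)"
          by (rule Lim_transform_eventually)
        moreover have "cutoff T h (t - u) = h (t - u)" using 2 by (simp add: cutoff_def T_def)
        ultimately show ?thesis by (intro tendsto_intros) simp
      next
        case 3
        have "\<forall>\<^sub>F n in sequentially. cutoff T a u * cutoff T h (x n - u) = cutoff T a u * cutoff T h (t - u)"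
          using order_tendstoD(2)[OF lim, of 0] 3 by (auto elim!: eventually_mono simp: cutoff_def)
        then show ?thesis by (rule tendsto_eventually)
      qed
    qed
  qed measurable
  then have "(\<lambda>n. LBINT u. cutoff T a u * cutoff T h (x n - u)) \<longlonglongrightarrow> half_conv a h t"
    using eq[of t] by (simp add: T_def)
  then show "(half_conv a h \<circ> x) \<longlonglongrightarrow> half_conv a h t"
    by (rule Lim_transform_eventually) (use ev eq in \<open>auto elim!: eventually_mono\<close>)
qed

lemma half_conv_one:
  assumes "locally_integrable h" 
  shows "half_conv (\<lambda>_. 1) h t = integral {0..t} h"
  using set_borel_integral_eq_integral(2)[of "{0..t}" h] assms
  by (simp add: half_conv_def locally_integrable_def)

lemma half_conv_one_has_derivative:
  assumes h: "continuous_on {0..} h" and t: "0 < t"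
  shows "(half_conv (\<lambda>_. 1) h has_vector_derivative h t) (at t)"
proof -
  have "((\<lambda>u. integral {0..u} h) has_vector_derivative h t) (at t within {0..t + 1})"
    by (rule integral_has_vector_derivative) (use t in \<open>auto intro: continuous_on_subset[OF h]\<close>)
  moreover have "at t within {0..t + 1} = at t" using t by (intro at_within_interior) auto
  moreover have "half_conv (\<lambda>_. 1) h = (\<lambda>u. integral {0..u} h)"
    by (rule ext) (rule half_conv_one[OF continuous_locally_integrable[OF h]])
  ultimately show ?thesis by simp
qed

section \<open>Fractional kernels and Laplace transforms\<close>

text \<open>The kernel of the Riemann-Liouville fractional integral of order a.\<close>

definition frac_kernel :: "real \<Rightarrow> real \<Rightarrow> real" where
  "frac_kernel a t = t powr (a - 1) / Gamma a"

lemma frac_kernel_nonneg: "0 < a \<Longrightarrow> 0 \<le> frac_kernel a t"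
  by (simp add: frac_kernel_def Gamma_real_pos less_imp_le)

lemma borel_measurable_frac_kernel [measurable]: "frac_kernel a \<in> borel_measurable borel"
  unfolding frac_kernel_def[abs_def] by measurable

text \<open>Euler's integral for Gamma under the scaling t -> p t.\<close>

lemma frac_kernel_laplace:
  assumes a: "0 < a" and p: "0 < p"
  shows "set_integrable lborel {0..} (\<lambda>t. exp (- (p * t)) * frac_kernel a t)"
    and "(LBINT t:{0..}. exp (- (p * t)) * frac_kernel a t) = p powr (- a)"
proof -
  have G: "set_integrable lborel {0..} (\<lambda>t::real. t powr (a - 1) / exp t)"
    using Gamma_integral_real[OF a] by (intro set_integrable_lborelI_nonneg_integral) (auto simp: integrable_on_def)
  have GI: "(LBINT t:{0..}. t powr (a - 1) / exp t) = Gamma a"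
    using set_borel_integral_eq_integral(2)[OF G] Gamma_integral_real[OF a] by (simp add: integral_unique)
  have Gp: "0 < Gamma a" using a by (rule Gamma_real_pos)
  have eq: "indicator {0..} (0 + p * t) *\<^sub>R ((0 + p * t) powr (a - 1) / exp (0 + p * t))
      = (p powr (a - 1) * Gamma a) * (indicator {0..} t *\<^sub>R (exp (- (p * t)) * frac_kernel a t))" for t
    using p Gp by (auto simp: indicator_def zero_le_mult_iff powr_mult frac_kernel_def exp_minus field_simps)
  have "integrable lborel (\<lambda>t. (p powr (a - 1) * Gamma a) * (indicator {0..} t *\<^sub>R (exp (- (p * t)) * frac_kernel a t)))"
    using lborel_integrable_real_affine[OF G[unfolded set_integrable_def], of p 0] p unfolding eq by simp
  then show "set_integrable lborel {0..} (\<lambda>t. exp (- (p * t)) * frac_kernel a t)"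
    using p Gp unfolding set_integrable_def by simp
  have "Gamma a = p * ((p powr (a - 1) * Gamma a) * (LBINT t:{0..}. exp (- (p * t)) * frac_kernel a t))"
    using lborel_integral_real_affine[of p "\<lambda>t. indicator {0..} t *\<^sub>R (t powr (a - 1) / exp t)" 0] p GI
    unfolding eq by (simp add: set_lebesgue_integral_def)
  also have "\<dots> = p powr a * Gamma a * (LBINT t:{0..}. exp (- (p * t)) * frac_kernel a t)"
    using p by (simp add: powr_diff)
  finally show "(LBINT t:{0..}. exp (- (p * t)) * frac_kernel a t) = p powr (- a)"
    using Gp p by (simp add: powr_minus field_simps)
qed

lemma frac_kernel_locally_integrable:
  assumes "0 < a"
  shows "locally_integrable (\<lambda>t. of_real (frac_kernel a t) :: 'b::{real_normed_field, euclidean_space})"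
  unfolding locally_integrable_def
proof
  fix T :: real
  show "set_integrable lborel {0..T} (\<lambda>t. of_real (frac_kernel a t) :: 'b)"
  proof (rule set_integrable_bound)
    \<comment> \<open>The Laplace integrand at p = 1 dominates the kernel up to the factor exp
      T.\<close>
    have "set_integrable lborel {0..T} (\<lambda>t. exp (- (1 * t)) * frac_kernel a t)"
      by (rule set_integrable_subset[OF frac_kernel_laplace(1)[OF assms]]) auto
    then show "set_integrable lborel {0..T} (\<lambda>t. exp T * (exp (- (1 * t)) * frac_kernel a t))"
      by (rule set_integrable_mult_right)
    show "set_borel_measurable lborel {0..T} (\<lambda>t. of_real (frac_kernel a t) :: 'b)"
      unfolding set_borel_measurable_def by measurable
    show "AE x in lborel. x \<in> {0..T} \<longrightarrow> norm (of_real (frac_kernel a x) :: 'b) \<le> norm (exp T * (exp (- (1 * x)) * frac_kernel a x))"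
    proof (intro AE_I2 impI)
      fix x assume "x \<in> {0..T}"
      then have "1 * frac_kernel a x \<le> (exp T * exp (- x)) * frac_kernel a x"
        using frac_kernel_nonneg[OF assms] by (intro mult_right_mono) (auto simp flip: exp_add)
      then show "norm (of_real (frac_kernel a x) :: 'b) \<le> norm (exp T * (exp (- (1 * x)) * frac_kernel a x))"
        using frac_kernel_nonneg[OF assms, of x] by (simp add: abs_mult)
    qed
  qed
qed

lemma half_conv_of_real:
  "half_conv (\<lambda>t. of_real (a t)) (\<lambda>t. of_real (h t)) t = (of_real (half_conv a h t) :: 'b::{real_normed_field, euclidean_space})"
proof -
  \<comment> \<open>A bounded linear left inverse of \<open>of_real\<close>. With it
    \<open>of_real\<close> commutes with the integral whether or not the integrand is
    integrable.\<close>
  define T' :: "'b \<Rightarrow> real" where "T' y = (y \<bullet> 1) * inverse (1 \<bullet> (1 :: 'b))" for y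
  have "bounded_linear T'"
    unfolding T'_def by (intro bounded_linear_mult_const bounded_linear_inner_left)
  moreover have "T' (of_real x) = x" for x
    by (simp add: T'_def of_real_def)
  ultimately have "(LBINT s. of_real (indicator {0..t} s *\<^sub>R (a (t - s) * h s)) :: 'b)
      = of_real (LBINT s. indicator {0..t} s *\<^sub>R (a (t - s) * h s))"
    by (intro integral_bounded_linear'[OF bounded_linear_of_real]) auto
  then show ?thesis
    by (simp add: half_conv_def set_lebesgue_integral_def scaleR_conv_of_real)
qed

text \<open>The substitution s = t x turns the convolution into the Beta integral for (1 - a, a),
  equal to Gamma a * Gamma (1 - a), and all powers of t cancel. This identity is what inverts the
  Caputo operator below.\<close>

lemma frac_kernel_conv:
  assumes a: "0 < a" "a < 1" and t: "0 < t"
  shows "half_conv (\<lambda>t. of_real (frac_kernel a t)) (\<lambda>t. of_real (frac_kernel (1 - a) t)) t = (1 :: 'b::{real_normed_field, euclidean_space})"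
proof -
  have Gp: "0 < Gamma a" "0 < Gamma (1 - a)" using a by (auto intro: Gamma_real_pos)
  note B = integrable_Beta[of "1 - a" a]
  have BI: "(LBINT x:{0..1}. x powr (1 - a - 1) * (1 - x) powr (a - 1)) = Gamma a * Gamma (1 - a)"
    using set_borel_integral_eq_integral(2)[OF B] has_integral_Beta_real[of "1 - a" a] a
    by (simp add: integral_unique Beta_def)
  have eq: "indicator {0..t} (0 + t * x) *\<^sub>R (frac_kernel a (t - (0 + t * x)) * frac_kernel (1 - a) (0 + t * x))
     = 1 / (t * Gamma a * Gamma (1 - a)) * (indicator {0..1} x *\<^sub>R (x powr (1 - a - 1) * (1 - x) powr (a - 1)))" for x
  proof (cases "x \<in> {0..1}")
    case True
    have "t - t * x = t * (1 - x)" by (simp add: algebra_simps)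
    then have "frac_kernel a (t - (0 + t * x)) * frac_kernel (1 - a) (0 + t * x)
      = (t powr (a - 1) * t powr (- a)) * ((1 - x) powr (a - 1) * x powr (- a)) / (Gamma a * Gamma (1 - a))"
      using True t by (simp add: frac_kernel_def powr_mult)
    also have "t powr (a - 1) * t powr (- a) = 1 / t" using t by (simp add: powr_diff powr_minus field_simps)
    finally show ?thesis using True t Gp by (simp add: mult_left_le field_simps)
  next
    case False
    then have "t * x \<notin> {0..t}" using t by (auto simp: zero_le_mult_iff)
    then show ?thesis using False by simp
  qed
  have "half_conv (frac_kernel a) (frac_kernel (1 - a)) t =
      \<bar>t\<bar> *\<^sub>R (LBINT x. indicator {0..t} (0 + t * x) *\<^sub>R (frac_kernel a (t - (0 + t * x)) * frac_kernel (1 - a) (0 + t * x)))"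
    unfolding half_conv_def set_lebesgue_integral_def
    by (rule lborel_integral_real_affine) (use t in simp)
  also have "\<dots> = t * (1 / (t * Gamma a * Gamma (1 - a)) * (LBINT x:{0..1}. x powr (1 - a - 1) * (1 - x) powr (a - 1)))"
    unfolding eq set_lebesgue_integral_def integral_mult_right_zero using t by simp
  also have "\<dots> = 1" unfolding BI using t Gp by simp
  finally have "half_conv (frac_kernel a) (frac_kernel (1 - a)) t = 1" .
  then show ?thesis by (simp add: half_conv_of_real)
qed

section \<open>Laplace transforms at positive real arguments\<close>

lemma L1_convolution_integral:
  fixes a b :: "real \<Rightarrow> complex"
  assumes a: "integrable lborel a" and b: "integrable lborel b"
  shows "integrable lborel (\<lambda>t. LBINT s. a (t - s) * b s)"
    and "(LBINT t. LBINT s. a (t - s) * b s) = (LBINT t. a t) * (LBINT t. b t)"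
proof -
  have [measurable]: "a \<in> borel_measurable borel" "b \<in> borel_measurable borel" using a b by auto
  have ash: "integrable lborel (\<lambda>t. a (t - s))" for s
    using lborel_integrable_real_affine[OF a, of 1 "- s"] by simp
  have J: "integrable (lborel \<Otimes>\<^sub>M lborel) (\<lambda>(s, t). a (t - s) * b s)"
  proof (rule lborel_pair.Fubini_integrable)
    show "AE s in lborel. integrable lborel (\<lambda>t. case (s, t) of (s, t) \<Rightarrow> a (t - s) * b s)"
      using ash by simp
    have "(LBINT t. norm (a (t - s) * b s)) = (LBINT t. norm (a t)) * norm (b s)" for s
      using lborel_integral_shift[of "\<lambda>t. norm (a t)" s] by (simp add: norm_mult)
    then show "integrable lborel (\<lambda>s. LBINT t. norm (case (s, t) of (s, t) \<Rightarrow> a (t - s) * b s))"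
      using b by simp
  qed measurable
  show "integrable lborel (\<lambda>t. LBINT s. a (t - s) * b s)"
    using lborel_pair.integrable_snd[OF J] by simp
  have "(LBINT t. LBINT s. a (t - s) * b s) = (LBINT s. LBINT t. a (t - s) * b s)"
    by (rule lborel_pair.Fubini_integral[OF J])
  also have "\<dots> = (LBINT t. a t) * (LBINT t. b t)"
    using lborel_integral_shift[of a] by simp
  finally show "(LBINT t. LBINT s. a (t - s) * b s) = (LBINT t. a t) * (LBINT t. b t)" .
qed

text \<open>Real arguments p suffice: uniqueness below draws on integer values of p only, and the
  contour integral was evaluated for p > 0.\<close>

definition laplace :: "(real \<Rightarrow> complex) \<Rightarrow> real \<Rightarrow> complex" where
  "laplace a p = (LBINT t:{0..}. of_real (exp (- (p * t))) * a t)"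

definition laplace_integrable :: "(real \<Rightarrow> complex) \<Rightarrow> real \<Rightarrow> bool" where
  "laplace_integrable a p \<longleftrightarrow> set_integrable lborel {0..} (\<lambda>t. of_real (exp (- (p * t))) * a t)"

text \<open>The weight exp (- p t) is multiplicative, so weighting a convolution means convolving
  the weighted factors, and the integral of an L1 convolution is the product of the
  integrals.\<close>

lemma laplace_half_conv:
  assumes a: "laplace_integrable a p" and b: "laplace_integrable b p"
  shows "laplace_integrable (half_conv a b) p" and "laplace (half_conv a b) p = laplace a p * laplace b p"
proof -
  define a' b' where "a' t = indicator {0..} t *\<^sub>R (of_real (exp (- (p * t))) * a t)"
    and "b' t = indicator {0..} t *\<^sub>R (of_real (exp (- (p * t))) * b t)" for t
  have ia: "integrable lborel a'" and ib: "integrable lborel b'"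
    using a b by (auto simp: laplace_integrable_def set_integrable_def a'_def[abs_def] b'_def[abs_def])
  have eq: "(LBINT s. a' (t - s) * b' s) = indicator {0..} t *\<^sub>R (of_real (exp (- (p * t))) * half_conv a b t)" for t
  proof (cases "0 \<le> t")
    case True
    have "a' (t - s) * b' s = of_real (exp (- (p * t))) * (indicator {0..t} s *\<^sub>R (a (t - s) * b s))" for s
    proof -
      have "exp (- (p * (t - s))) * exp (- (p * s)) = exp (- (p * t))"
        by (simp add: algebra_simps flip: exp_add)
      then have "complex_of_real (exp (- (p * (t - s)))) * of_real (exp (- (p * s))) = of_real (exp (- (p * t)))"
        by (simp flip: of_real_mult)
      then have "(of_real (exp (- (p * (t - s)))) * a (t - s)) * (of_real (exp (- (p * s))) * b s)
         = of_real (exp (- (p * t))) * (a (t - s) * b s)"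
        by (metis (no_types, lifting) mult.assoc mult.left_commute)
      then show ?thesis by (auto simp: a'_def b'_def indicator_def)
    qed
    then have "(LBINT s. a' (t - s) * b' s) = of_real (exp (- (p * t))) * half_conv a b t"
      unfolding half_conv_def set_lebesgue_integral_def by (simp only: integral_mult_right_zero)
    then show ?thesis using True by simp
  next
    case False
    then have "(\<lambda>s. a' (t - s) * b' s) = (\<lambda>_. 0)" by (auto simp: a'_def b'_def indicator_def fun_eq_iff)
    then show ?thesis using False by simp
  qed
  note C = L1_convolution_integral[OF ia ib, unfolded eq]
  show "laplace_integrable (half_conv a b) p" using C(1) by (simp add: laplace_integrable_def set_integrable_def)
  show "laplace (half_conv a b) p = laplace a p * laplace b p"
    using C(2) by (simp add: laplace_def set_lebesgue_integral_def a'_def b'_def)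
qed


lemma set_integrable_continuous_bound:
  fixes f :: "real \<Rightarrow> 'b::euclidean_space" and w :: "real \<Rightarrow> real"
  assumes "continuous_on {0..} f" "set_integrable lborel {0..} w" "\<And>t. 0 \<le> t \<Longrightarrow> norm (f t) \<le> w t"
  shows "set_integrable lborel {0..} f"
proof (rule set_integrable_bound[OF assms(2)])
  show "set_borel_measurable lborel {0..} f"
    using borel_measurable_continuous_on_indicator[OF _ assms(1)] by (simp add: set_borel_measurable_def)
  show "AE x in lborel. x \<in> {0..} \<longrightarrow> norm (f x) \<le> norm (w x)"
    using assms(3) by (intro AE_I2 impI) (auto intro: order_trans[OF _ abs_ge_self])
qed

text \<open>Weierstrass approximation of \<open>g\<close> by polynomials in \<open>exp (- t)\<close>, against all of which \<open>g\<close> is orthogonal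
  for the weight \<open>exp (- t)\<close>.\<close>

lemma laplace_unique_real:
  fixes g :: "real \<Rightarrow> real"
  assumes cont: "continuous_on {0..} g" and bound: "\<And>t. 0 \<le> t \<Longrightarrow> \<bar>g t\<bar> \<le> B * exp (- t)"
    and zero: "\<And>n::nat. (LBINT t:{0..}. exp (- (real (Suc n) * t)) * g t) = 0"
    and t: "0 \<le> t"
  shows "g t = 0"
proof -
  have B0: "0 \<le> B" using bound[of 0] by simp
  have lim: "(g \<longlongrightarrow> 0) at_top"
  proof (rule Lim_null_comparison)
    show "\<forall>\<^sub>F t in at_top. norm (g t) \<le> B * exp (- t)"
      using eventually_ge_at_top[of 0] by eventually_elim (use bound in simp)
    have "((\<lambda>t::real. B * exp (- t)) \<longlongrightarrow> B * 0) at_top"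
      by (intro tendsto_intros) real_asymp
    then show "((\<lambda>t::real. B * exp (- t)) \<longlongrightarrow> 0) at_top" by simp
  qed
  \<comment> \<open>The substitution x = exp (- t) maps the half-line onto (0, 1]; decay of
    \<open>g\<close> makes the value 0 at x = 0 continuous.\<close>
  define G where "G x = (if x = 0 then 0 else g (- ln x))" for x :: real
  have Gc: "continuous_on {0..1} G"
    unfolding continuous_on_def
  proof
    fix x :: real assume x: "x \<in> {0..1}"
    show "(G \<longlongrightarrow> G x) (at x within {0..1})"
    proof (cases "x = 0")
      case True
      have "filterlim (\<lambda>x::real. - ln x) at_top (at_right 0)"
        by real_asymp
      then have "((\<lambda>x. g (- ln x)) \<longlongrightarrow> 0) (at_right 0)" by (rule filterlim_compose[OF lim])
      then have "(G \<longlongrightarrow> 0) (at_right 0)"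
        by (rule Lim_transform_eventually) (auto simp: G_def eventually_at_filter)
      then show ?thesis using True by (simp add: G_def at_within_Icc_at_right)
    next
      case False
      have "continuous_on {0<..1} (\<lambda>x. g (- ln x))"
        by (rule continuous_on_compose2[OF cont]) (auto intro!: continuous_intros)
      moreover have "continuous_on {0<..1} (\<lambda>x. g (- ln x)) = continuous_on {0<..1} G"
        by (rule continuous_on_cong) (auto simp: G_def)
      ultimately have "(G \<longlongrightarrow> G x) (at x within {0<..1})"
        using x False by (auto simp: continuous_on_def)
      moreover have "at x within {0<..1} = at x within {0..1}"
        by (rule at_within_nhd[of x "{0<..}"]) (use x False in auto)
      ultimately show ?thesis by simp
    qed
  qed
  have e1: "set_integrable lborel {0..} (\<lambda>t::real. B * exp (- (1 * t)))"
    by (intro set_integrable_mult_right set_integrable_exp_minus) auto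
  have int1: "set_integrable lborel {0..} (\<lambda>t. exp (- (real (Suc n) * t)) * g t)" for n
  proof (rule set_integrable_continuous_bound[OF _ e1])
    fix t :: real assume t: "0 \<le> t"
    have "exp (- (real (Suc n) * t)) \<le> 1" using t by simp
    then have "exp (- (real (Suc n) * t)) * \<bar>g t\<bar> \<le> 1 * (B * exp (- t))"
      using t by (intro mult_mono bound) auto
    then show "norm (exp (- (real (Suc n) * t)) * g t) \<le> B * exp (- (1 * t))" by (simp add: abs_mult)
  qed (intro continuous_intros cont)
  have int2: "set_integrable lborel {0..} (\<lambda>t. exp (- t) * (g t)\<^sup>2)"
  proof (rule set_integrable_continuous_bound[OF _ set_integrable_mult_right[OF e1, of B]])
    fix t :: real assume t: "0 \<le> t"
    have 1: "\<bar>g t\<bar> \<le> B" using bound[OF t] B0 t by (smt (verit) exp_le_one_iff mult_left_le)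
    have "exp (- t) * (\<bar>g t\<bar> * \<bar>g t\<bar>) \<le> 1 * (B * (B * exp (- t)))"
      using t B0 1 by (intro mult_mono bound) auto
    then show "norm (exp (- t) * (g t)\<^sup>2) \<le> B * (B * exp (- (1 * t)))"
      by (simp add: abs_mult power2_eq_square)
  qed (intro continuous_intros cont)
  define I where "I = (LBINT t:{0..}. exp (- t) * (g t)\<^sup>2)"
  \<comment> \<open>\<open>I\<close> integrates exp (- t) * g * g. Replacing one factor g by the
    approximating polynomial makes the integral vanish and costs at most e times the integral of exp
    (- t) |g|, hence at most e * B.\<close>
  have small: "I \<le> e * B" if e: "0 < e" for e
  proof -
    obtain q where q: "polynomial_function q" "\<And>x. x \<in> {0..1} \<Longrightarrow> norm (G x - q x) < e"
      using Stone_Weierstrass_polynomial_function[OF _ Gc e] by auto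
    then obtain a n where an: "q = (\<lambda>x. \<Sum>i\<le>n. a i * x ^ i)"
      unfolding real_polynomial_function_eq[symmetric] real_polynomial_function_iff_sum by auto
    have qt: "\<bar>g t - (\<Sum>i\<le>n. a i * exp (- t) ^ i)\<bar> < e" if "0 \<le> t" for t
      using q(2)[of "exp (- t)"] that by (simp add: G_def an)
    \<comment> \<open>The weight exp (- t) raises the exponent from i to \<open>Suc i\<close>, so
      the constant term of the polynomial is covered by \<open>zero\<close> too.\<close>
    have summand: "exp (- t) * g t * (a i * exp (- t) ^ i) = a i * (exp (- (real (Suc i) * t)) * g t)" for i t
      using exp_of_nat_mult[of "Suc i" "- t"] by simp
    have iint: "integrable lborel (\<lambda>t. indicator {0..} t *\<^sub>R (a i * (exp (- (real (Suc i) * t)) * g t)))" for i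
      using set_integrable_mult_right[OF int1[of i], of "a i"] by (simp add: set_integrable_def)
    have izero: "(LBINT t. indicator {0..} t *\<^sub>R (a i * (exp (- (real (Suc i) * t)) * g t))) = 0" for i
      using zero[of i] set_integral_mult_right[of lborel "{0..}" "a i" "\<lambda>t. exp (- (real (Suc i) * t)) * g t"]
      by (simp only: set_lebesgue_integral_def mult_zero_right)
    have intq: "set_integrable lborel {0..} (\<lambda>t. exp (- t) * g t * (\<Sum>i\<le>n. a i * exp (- t) ^ i))"
      unfolding sum_distrib_left summand set_integrable_def scaleR_sum_right
      by (intro Bochner_Integration.integrable_sum iint)
    have "(LBINT t:{0..}. exp (- t) * g t * (\<Sum>i\<le>n. a i * exp (- t) ^ i)) = 0"
      unfolding sum_distrib_left summand set_lebesgue_integral_def scaleR_sum_right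
      by (subst Bochner_Integration.integral_sum[OF iint]) (simp only: izero sum.neutral_const)
    then have "I = (LBINT t:{0..}. exp (- t) * (g t)\<^sup>2 - exp (- t) * g t * (\<Sum>i\<le>n. a i * exp (- t) ^ i))"
      using int2 intq by (simp add: I_def)
    also have "\<dots> \<le> (LBINT t:{0..}. e * (B * exp (- (1 * t))))"
    proof (rule set_integral_mono)
      show "set_integrable lborel {0..} (\<lambda>t. exp (- t) * (g t)\<^sup>2 - exp (- t) * g t * (\<Sum>i\<le>n. a i * exp (- t) ^ i))"
        using int2 intq by simp
      show "set_integrable lborel {0..} (\<lambda>t. e * (B * exp (- (1 * t))))"
        by (rule set_integrable_mult_right[OF e1])
      fix t :: real assume "t \<in> {0..}"
      then have t: "0 \<le> t" by simp
      have "exp (- t) * (g t)\<^sup>2 - exp (- t) * g t * (\<Sum>i\<le>n. a i * exp (- t) ^ i)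
          = exp (- t) * (g t * (g t - (\<Sum>i\<le>n. a i * exp (- t) ^ i)))"
        by (simp add: algebra_simps power2_eq_square)
      also have "\<dots> \<le> 1 * (\<bar>g t\<bar> * \<bar>g t - (\<Sum>i\<le>n. a i * exp (- t) ^ i)\<bar>)"
      proof -
        have "exp (- t) * y \<le> 1 * \<bar>y\<bar>" for y
          using t by (intro order_trans[OF mult_left_mono[OF abs_ge_self] mult_right_mono]) auto
        then show ?thesis by (simp only: abs_mult[symmetric])
      qed
      also have "\<dots> \<le> 1 * ((B * exp (- t)) * e)"
        using qt[OF t] t B0 by (intro mult_left_mono mult_mono bound) auto
      finally show "exp (- t) * (g t)\<^sup>2 - exp (- t) * g t * (\<Sum>i\<le>n. a i * exp (- t) ^ i) \<le> e * (B * exp (- (1 * t)))"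
        by (simp add: mult_ac)
    qed
    also have "\<dots> = e * B"
      using set_integrable_exp_minus(2)[of 1 0] by simp
    finally show ?thesis .
  qed
  have "I \<le> 0"
  proof (rule field_le_epsilon)
    fix e :: real assume e: "0 < e"
    have "I \<le> e / (B + 1) * B" using small[of "e / (B + 1)"] e B0 by simp
    also have "\<dots> \<le> e" using e B0 by (simp add: field_simps)
    finally show "I \<le> 0 + e" by simp
  qed
  \<comment> \<open>The interval ends at t + 1 so that it does not degenerate for t = 0; on it a
    continuous nonnegative function with integral 0 vanishes.\<close>
  have int3: "set_integrable lborel {0..t + 1} (\<lambda>t. exp (- t) * (g t)\<^sup>2)"
    by (rule set_integrable_subset[OF int2]) auto
  have "(LBINT t:{0..t + 1}. exp (- t) * (g t)\<^sup>2) \<le> I"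
    unfolding I_def set_lebesgue_integral_def
    using int2 int3 by (intro integral_mono) (auto simp: set_integrable_def indicator_def)
  then have "integral {0..t + 1} (\<lambda>t. exp (- t) * (g t)\<^sup>2) \<le> 0"
    using \<open>I \<le> 0\<close> set_borel_integral_eq_integral(2)[OF int3] by simp
  moreover have "0 \<le> integral {0..t + 1} (\<lambda>t. exp (- t) * (g t)\<^sup>2)"
    by (rule integral_nonneg) (use set_borel_integral_eq_integral(1)[OF int3] in auto)
  ultimately have "((\<lambda>t. exp (- t) * (g t)\<^sup>2) has_integral 0) (cbox 0 (t + 1))"
    using set_borel_integral_eq_integral(1)[OF int3] by (auto simp: has_integral_iff)
  then have "exp (- t) * (g t)\<^sup>2 = 0"
    by (rule has_integral_0_cbox_imp_0[rotated 2])
       (use t in \<open>auto intro!: continuous_intros continuous_on_subset[OF cont]\<close>)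
  then show ?thesis by simp
qed

text \<open>Reduced to the real statement for Re H and Im H. A growth bound is all that is known of
  H in the application, so decay has to be produced by an additional weight.\<close>

lemma laplace_unique:
  fixes H :: "real \<Rightarrow> complex"
  assumes cont: "continuous_on {0..} H" and bound: "\<And>t. 0 \<le> t \<Longrightarrow> norm (H t) \<le> C * exp t"
    and zero: "\<And>p. 1 < p \<Longrightarrow> laplace H p = 0"
    and t: "0 \<le> t"
  shows "H t = 0"
proof -
  have C0: "0 \<le> C" using order_trans[OF norm_ge_zero bound[of 0]] by simp
  have li: "integrable lborel (\<lambda>t. indicator {0..} t *\<^sub>R (of_real (exp (- (p * t))) * H t))" if "1 < p" for p
  proof -
    have "set_integrable lborel {0..} (\<lambda>t. of_real (exp (- (p * t))) * H t)"
    proof (rule set_integrable_continuous_bound)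
      show "set_integrable lborel {0..} (\<lambda>t::real. C * exp (- ((p - 1) * t)))"
        using that by (intro set_integrable_mult_right set_integrable_exp_minus) auto
      fix t :: real assume t: "0 \<le> t"
      have "exp (- (p * t)) * norm (H t) \<le> exp (- (p * t)) * (C * exp t)"
        by (intro mult_left_mono bound t) auto
      also have "\<dots> = C * exp (- ((p - 1) * t))" by (simp add: algebra_simps flip: exp_add)
      finally show "norm (of_real (exp (- (p * t))) * H t) \<le> C * exp (- ((p - 1) * t))"
        by (simp add: norm_mult)
    qed (intro continuous_intros cont)
    then show ?thesis by (simp add: set_integrable_def)
  qed
  have key: "F (H t) = 0"
    if F: "bounded_linear F" "\<And>z. \<bar>F z\<bar> \<le> norm z" for F :: "complex \<Rightarrow> real"
  proof -
    interpret F: bounded_linear F by (rule F)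
    \<comment> \<open>The weight exp (- 2 t) turns growth exp t into decay exp (- t) and shifts the
      Laplace argument by 2, whence p = \<open>Suc n\<close> + 2 below.\<close>
    define g where "g t = exp (- (2 * t)) * F (H t)" for t
    have "g t = 0"
    proof (rule laplace_unique_real[OF _ _ _ t])
      show "continuous_on {0..} g" unfolding g_def by (intro continuous_intros F.continuous_on cont)
      show "\<bar>g s\<bar> \<le> C * exp (- s)" if "0 \<le> s" for s
      proof -
        have "\<bar>g s\<bar> \<le> exp (- (2 * s)) * (C * exp s)"
          unfolding g_def abs_mult using order_trans[OF F(2) bound[OF that]] by (simp add: mult_left_mono)
        also have "\<dots> = C * exp (- s)" by (simp flip: exp_add)
        finally show ?thesis .
      qed
      fix n :: nat
      define p where "p = real (Suc n) + 2"
      have "F (LBINT t. indicator {0..} t *\<^sub>R (of_real (exp (- (p * t))) * H t)) = 0"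
        using zero[of p] by (simp add: laplace_def set_lebesgue_integral_def p_def F.zero)
      moreover have "F (LBINT t. indicator {0..} t *\<^sub>R (of_real (exp (- (p * t))) * H t))
        = (LBINT t. F (indicator {0..} t *\<^sub>R (of_real (exp (- (p * t))) * H t)))"
        by (rule integral_bounded_linear[OF F(1) li, symmetric]) (simp add: p_def)
      moreover have "F (indicator {0..} t *\<^sub>R (of_real (exp (- (p * t))) * H t))
        = indicator {0..} t *\<^sub>R (exp (- (real (Suc n) * t)) * g t)" for t
      proof -
        have "F (of_real (exp (- (p * t))) * H t) = exp (- (p * t)) * F (H t)"
          using F.scaleR[of "exp (- (p * t))" "H t"] by (simp add: scaleR_conv_of_real)
        also have "\<dots> = exp (- (real (Suc n) * t)) * g t"
          by (simp add: g_def p_def algebra_simps flip: exp_add mult.assoc)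
        finally show ?thesis by (simp only: F.scaleR)
      qed
      ultimately show "(LBINT t:{0..}. exp (- (real (Suc n) * t)) * g t) = 0"
        by (simp add: set_lebesgue_integral_def)
    qed
    then show ?thesis by (simp add: g_def)
  qed
  have "Re (H t) = 0" "Im (H t) = 0"
    by (auto intro!: key bounded_linear_Re bounded_linear_Im abs_Re_le_cmod abs_Im_le_cmod)
  then show ?thesis by (simp add: complex_eq_iff)
qed

section \<open>Scalar Volterra equations\<close>

text \<open>The Laplace integral at p = 1 with exp (- s) >= exp (- t) for s <= t. This crude growth
  bound is of the kind that \<open>laplace_unique\<close> accepts.\<close>

lemma frac_kernel_integral_le:
  assumes "0 < a" "0 \<le> t"
  shows "(LBINT s:{0..t}. norm (complex_of_real (frac_kernel a s))) \<le> exp t"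
proof -
  have i1: "set_integrable lborel {0..} (\<lambda>s. exp t * (exp (- (1 * s)) * frac_kernel a s))"
    by (rule set_integrable_mult_right[OF frac_kernel_laplace(1)[OF assms(1)]]) simp
  have i2: "set_integrable lborel {0..t} (\<lambda>s. norm (complex_of_real (frac_kernel a s)))"
    using frac_kernel_locally_integrable[OF assms(1), where 'b=complex]
    by (intro set_integrable_norm) (auto simp: locally_integrable_def)
  have "(LBINT s:{0..t}. norm (complex_of_real (frac_kernel a s)))
      \<le> (LBINT s:{0..}. exp t * (exp (- (1 * s)) * frac_kernel a s))"
    unfolding set_lebesgue_integral_def
  proof (rule integral_mono)
    fix s
    have "1 * frac_kernel a s \<le> (exp t * exp (- s)) * frac_kernel a s" if "s \<le> t"
      using frac_kernel_nonneg[OF assms(1)] that by (intro mult_right_mono) (auto simp flip: exp_add)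
    then show "indicator {0..t} s *\<^sub>R norm (complex_of_real (frac_kernel a s))
        \<le> indicator {0..} s *\<^sub>R (exp t * (exp (- (1 * s)) * frac_kernel a s))"
      using frac_kernel_nonneg[OF assms(1), of s] by (auto simp: indicator_def)
  qed (use i1 i2 in \<open>simp_all add: set_integrable_def\<close>)
  also have "\<dots> = exp t" using frac_kernel_laplace(2)[OF assms(1), of 1] by simp
  finally show ?thesis .
qed

lemma laplace_one:
  assumes "0 < p"
  shows "laplace_integrable (\<lambda>_. 1) p" and "laplace (\<lambda>_. 1) p = 1 / of_real p"
proof -
  have eq: "complex_of_real (exp (- (p * t))) * 1 = exp (of_real t * of_real (- p))" for t
    by (simp add: mult.commute flip: exp_of_real)
  show "laplace_integrable (\<lambda>_. 1) p"
    unfolding laplace_integrable_def eq by (rule set_integral_exp_complex(1)) (use assms in simp)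
  show "laplace (\<lambda>_. 1) p = 1 / of_real p"
    unfolding laplace_def eq by (subst set_integral_exp_complex(2)) (use assms in auto)
qed

lemma laplace_frac_kernel:
  assumes "0 < a" "0 < p"
  shows "laplace_integrable (\<lambda>t. of_real (frac_kernel a t)) p"
    and "laplace (\<lambda>t. of_real (frac_kernel a t)) p = of_real (p powr (- a))"
proof -
  have "set_integrable lborel {0..} (\<lambda>t. complex_of_real (exp (- (p * t)) * frac_kernel a t))"
    using frac_kernel_laplace(1)[OF assms] complex_of_real_integrable_eq[of lborel "\<lambda>t. indicator {0..} t *\<^sub>R (exp (- (p * t)) * frac_kernel a t)"]
    by (simp add: set_integrable_def scaleR_conv_of_real)
  then show "laplace_integrable (\<lambda>t. of_real (frac_kernel a t)) p"
    by (simp add: laplace_integrable_def)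
  have "(LBINT t:{0..}. complex_of_real (exp (- (p * t)) * frac_kernel a t)) = of_real (p powr (- a))"
    using frac_kernel_laplace(2)[OF assms] set_integral_complex_of_real by metis
  then show "laplace (\<lambda>t. of_real (frac_kernel a t)) p = of_real (p powr (- a))"
    by (simp add: laplace_def)
qed

lemma set_integrable_laplace_integrable:
  assumes r: "set_integrable lborel {0..} r" and p: "0 \<le> p"
  shows "laplace_integrable r p"
  unfolding laplace_integrable_def
proof (rule set_integrable_bound[OF r])
  have "(\<lambda>x. complex_of_real (exp (- (p * x))) * (indicator {0..} x *\<^sub>R r x)) \<in> borel_measurable lborel"
    using r unfolding set_integrable_def by (intro borel_measurable_times[OF _ borel_measurable_integrable]) measurable
  then show "set_borel_measurable lborel {0..} (\<lambda>t. complex_of_real (exp (- (p * t))) * r t)"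
    by (simp add: set_borel_measurable_def)
  show "AE x in lborel. x \<in> {0..} \<longrightarrow> norm (complex_of_real (exp (- (p * x))) * r x) \<le> norm (r x)"
    using p by (intro AE_I2 impI) (auto simp: norm_mult intro!: mult_left_le_one_le)
qed

lemma laplace_linear:
  assumes "laplace_integrable a p" "laplace_integrable b p"
  shows "laplace_integrable (\<lambda>t. a t - b t) p" "laplace (\<lambda>t. a t - b t) p = laplace a p - laplace b p"
    "laplace_integrable (\<lambda>t. c * a t) p" "laplace (\<lambda>t. c * a t) p = c * laplace a p"
proof -
  show "laplace_integrable (\<lambda>t. a t - b t) p" "laplace (\<lambda>t. a t - b t) p = laplace a p - laplace b p"
    using assms unfolding laplace_integrable_def laplace_def right_diff_distrib by simp_all
  have eq: "of_real (exp (- (p * t))) * (c * a t) = c * (of_real (exp (- (p * t))) * a t)" for t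
    by (rule mult.left_commute)
  show "laplace_integrable (\<lambda>t. c * a t) p" "laplace (\<lambda>t. c * a t) p = c * laplace a p"
    using assms unfolding laplace_integrable_def laplace_def eq by auto
qed

lemma locally_integrable_of_integrable:
  "set_integrable lborel {0..} r \<Longrightarrow> locally_integrable r"
  unfolding locally_integrable_def by (auto intro: set_integrable_subset)

lemma truncated_norm_integral_le:
  fixes r :: "real \<Rightarrow> complex"
  assumes "set_integrable lborel {0..} r"
  shows "(LBINT s:{0..t}. norm (r s)) \<le> (LBINT s:{0..}. norm (r s))"
proof -
  have "set_integrable lborel {0..t} r" by (rule set_integrable_subset[OF assms]) auto
  then show ?thesis
    using set_integrable_norm[OF assms] set_integrable_norm[of lborel "{0..t}" r]
    unfolding set_lebesgue_integral_def set_integrable_def by (intro integral_mono) (auto simp: indicator_def)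
qed

text \<open>Undoes the convolution with 1 under which the identities below are derived.\<close>

lemma half_conv_one_eq_0D:
  assumes h: "continuous_on {0..} h" and z: "\<And>t. 0 \<le> t \<Longrightarrow> half_conv (\<lambda>_. 1) h t = 0" and t: "0 < t"
  shows "h t = 0"
proof -
  have "(half_conv (\<lambda>_. 1) h has_vector_derivative h t) (at t)"
    by (rule half_conv_one_has_derivative[OF h t])
  moreover have "((\<lambda>_. 0) has_vector_derivative h t) (at t) \<longleftrightarrow> (half_conv (\<lambda>_. 1) h has_vector_derivative h t) (at t)"
    by (rule has_vector_derivative_cong_ev)
       (use z t eventually_nhds_in_open[of "{0<..}" t] in \<open>auto elim!: eventually_mono\<close>)
  ultimately show ?thesis
    by (metis has_vector_derivative_const vector_derivative_unique_at)
qed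

lemma half_conv_diff:
  assumes "locally_integrable a" "continuous_on {0..} h" "continuous_on {0..} g"
  shows "half_conv a (\<lambda>s. h s - g s) t = half_conv a h t - half_conv a g t"
  unfolding half_conv_def right_diff_distrib using assms by (intro set_integral_diff half_conv_integrable)

text \<open>The resolvent equation is used in the integrated form \<open>R = 1 * k + \<lambda> (k * R)\<close> with \<open>R = 1 * r\<close>: all terms are
  continuous, so uniqueness of Laplace transforms yields it everywhere and not just almost everywhere.\<close>

theorem scalar_resolvent:
  fixes \<alpha> :: real and lam :: complex
  assumes \<alpha>: "0 < \<alpha>" "\<alpha> < 1" and arg: "\<alpha> * pi / 2 < \<bar>Arg lam\<bar>"
  defines "k \<equiv> \<lambda>t. complex_of_real (frac_kernel \<alpha> t)"
  obtains r :: "real \<Rightarrow> complex" where "set_integrable lborel {0..} r"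
    "((\<lambda>t. 1 + lam * half_conv (\<lambda>_. 1) r t) \<longlongrightarrow> 0) at_top"
    "\<And>w q c t. \<lbrakk>continuous_on {0..} w; continuous_on {0..} q; 0 \<le> t;
        \<And>t. 0 \<le> t \<Longrightarrow> w t = c + half_conv k (\<lambda>s. lam * w s + q s) t\<rbrakk>
        \<Longrightarrow> w t = c * (1 + lam * half_conv (\<lambda>_. 1) r t) + half_conv r q t"
proof -
  obtain r where r: "set_integrable lborel {0..} r"
    and Lr: "\<And>p. 0 < p \<Longrightarrow> laplace r p = 1 / (of_real (p powr \<alpha>) - lam)"
    using resolvent_kernel_exists[OF \<alpha> arg] unfolding laplace_def by blast
  have lam0: "lam \<noteq> 0" using arg \<alpha> by (auto simp: Arg_zero mult_less_0_iff)
  have ne: "of_real x - lam \<noteq> 0" if "0 < x" for x :: real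
    using arg \<alpha> that by (auto simp: Arg_of_real mult_less_0_iff)
  let ?one = "\<lambda>_::real. 1::complex"
  define R where "R = half_conv ?one r"
  define B where "B = (LBINT s:{0..}. norm (r s))"
  have li: "locally_integrable r" "locally_integrable k" "locally_integrable ?one"
    using locally_integrable_of_integrable[OF r] frac_kernel_locally_integrable[OF \<alpha>(1), where 'b=complex]
    by (auto simp: k_def intro: continuous_locally_integrable)
  have R': "R = half_conv r ?one" unfolding R_def by (rule ext) (rule half_conv_commute)
  have Rc: "continuous_on {0..} R" unfolding R' by (intro continuous_on_half_conv li continuous_intros)
  have Rb: "norm (R t) \<le> B" for t
    using half_conv_norm_le[OF li(1), of ?one t 1] truncated_norm_integral_le[OF r, of t]
    unfolding R' B_def by simp
  have B0: "0 \<le> B" using Rb norm_ge_zero order_trans by blast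
  have okc: "continuous_on {0..} (half_conv ?one k)"
    using continuous_on_half_conv[OF li(2), of ?one] by (simp add: half_conv_commute[of k, THEN ext[of "half_conv k ?one"]])
  have kRc: "continuous_on {0..} (half_conv k R)" by (intro continuous_on_half_conv li Rc)
  \<comment> \<open>The defect of the integrated resolvent equation. With P = p powr alpha its
    transform vanishes because 1 / (p (P - lam)) - 1 / (p P) = lam / (p P (P - lam)).\<close>
  define H where "H t = (R t - half_conv ?one k t) - lam * half_conv k R t" for t
  have H0: "H t = 0" if "0 \<le> t" for t
  proof (rule laplace_unique[OF _ _ _ that])
    show "continuous_on {0..} H" unfolding H_def by (intro continuous_intros Rc okc kRc)
    show "norm (H t) \<le> (B + 1 + norm lam * B) * exp t" if t: "0 \<le> t" for t
    proof -
      have K: "(LBINT s:{0..t}. norm (k s)) \<le> exp t"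
        unfolding k_def by (rule frac_kernel_integral_le[OF \<alpha>(1) t])
      have 1: "norm (half_conv ?one k t) \<le> 1 * exp t"
        using half_conv_norm_le[OF li(2), of ?one t 1] K by (simp add: half_conv_commute[of ?one])
      have 2: "norm (half_conv k R t) \<le> B * exp t"
        using half_conv_norm_le[OF li(2) Rc, of t B] Rb mult_left_mono[OF K B0] by simp
      have "norm (H t) \<le> norm (R t) + norm (half_conv ?one k t) + norm (lam * half_conv k R t)"
        unfolding H_def by (intro order_trans[OF norm_triangle_ineq4] add_mono order_trans[OF norm_triangle_ineq4]) auto
      also have "\<dots> \<le> B * exp t + 1 * exp t + norm lam * (B * exp t)"
        using t B0 by (intro add_mono 1 order_trans[OF Rb])
          (auto simp: norm_mult intro!: mult_left_mono 2 mult_left_mono[of 1 "exp t" B, simplified])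
      finally show ?thesis by (simp add: algebra_simps)
    qed
    fix p :: real assume "1 < p"
    then have p: "0 < p" by simp
    note L1 = laplace_one[OF p] and Lk = laplace_frac_kernel[OF \<alpha>(1) p, folded k_def]
    have Lri: "laplace_integrable r p" using set_integrable_laplace_integrable[OF r] p by simp
    note LR = laplace_half_conv[OF L1(1) Lri, folded R_def]
    note Lok = laplace_half_conv[OF L1(1) Lk(1)]
    note LkR = laplace_half_conv[OF Lk(1) LR(1)]
    have "laplace H p = laplace R p - laplace (half_conv ?one k) p - lam * laplace (half_conv k R) p"
      unfolding H_def
      using laplace_linear(1,2)[OF LR(1) Lok(1)] laplace_linear(3,4)[OF LkR(1) LkR(1), of lam]
      by (simp add: laplace_linear)
    also have "\<dots> = 1 / of_real p * (1 / (of_real (p powr \<alpha>) - lam)) - 1 / of_real p * of_real (p powr (- \<alpha>))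
        - lam * (of_real (p powr (- \<alpha>)) * (1 / of_real p * (1 / (of_real (p powr \<alpha>) - lam))))"
      using LR(2) Lok(2) LkR(2) L1(2) Lk(2) Lr[OF p] by simp
    also have "\<dots> = 0"
    proof -
      define P where "P = complex_of_real (p powr \<alpha>)"
      have P0: "P \<noteq> 0" "P - lam \<noteq> 0" using p ne[of "p powr \<alpha>"] by (auto simp: P_def)
      have Pm: "complex_of_real (p powr (- \<alpha>)) = 1 / P" by (simp add: P_def powr_minus_divide)
      show ?thesis unfolding Pm P_def[symmetric] using P0 p by (simp add: field_simps)
    qed
    finally show "laplace H p = 0" .
  qed
  then have Req: "lam * half_conv k R t = R t - half_conv ?one k t" if "0 \<le> t" for t
    using that by (simp add: H_def)
  have S0: "((\<lambda>t. 1 + lam * R t) \<longlongrightarrow> 0) at_top"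
  proof -
    define J where "J = (LBINT s:{0..}. r s)"
    have "((\<lambda>t. LBINT s:{0..t}. r s) \<longlongrightarrow> J) at_top"
      unfolding J_def by (rule tendsto_set_lebesgue_integral_at_top[OF _ r]) auto
    then have "(R \<longlongrightarrow> J) at_top"
      by (simp add: R_def half_conv_def[abs_def])
    then have "((\<lambda>t. 1 + lam * R t) \<longlongrightarrow> 1 + lam * J) at_top" by (intro tendsto_intros)
    \<comment> \<open>Both sides are the limit of the Laplace transform of \<open>r\<close> as p ->
      0: dominated convergence gives \<open>J\<close>, the explicit formula gives - 1 / lam. Hence 1
      + lam J = 0.\<close>
    moreover have "J = - 1 / lam"
    proof (rule LIMSEQ_unique)
      show "(\<lambda>n. laplace r (1 / real (Suc n))) \<longlonglongrightarrow> J"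
        unfolding laplace_def J_def set_lebesgue_integral_def
      proof (rule integral_dominated_convergence[where w="\<lambda>s. norm (indicator {0..} s *\<^sub>R r s)"])
        show "integrable lborel (\<lambda>s. norm (indicator {0..} s *\<^sub>R r s))"
          using r unfolding set_integrable_def by (rule integrable_norm)
        show "(\<lambda>s. indicator {0..} s *\<^sub>R r s) \<in> borel_measurable lborel"
          using r unfolding set_integrable_def by (rule borel_measurable_integrable)
        show "(\<lambda>s. indicator {0..} s *\<^sub>R (complex_of_real (exp (- (1 / real (Suc n) * s))) * r s)) \<in> borel_measurable lborel" for n
          using set_integrable_laplace_integrable[OF r, of "1 / real (Suc n)"]
          unfolding laplace_integrable_def set_integrable_def by (simp add: borel_measurable_integrable)
        show "AE s in lborel. norm (indicator {0..} s *\<^sub>R (complex_of_real (exp (- (1 / real (Suc n) * s))) * r s))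
            \<le> norm (indicator {0..} s *\<^sub>R r s)" for n
          by (intro AE_I2) (auto simp: norm_mult indicator_def intro!: mult_left_le_one_le)
        show "AE s in lborel. (\<lambda>n. indicator {0..} s *\<^sub>R (complex_of_real (exp (- (1 / real (Suc n) * s))) * r s))
            \<longlonglongrightarrow> indicator {0..} s *\<^sub>R r s"
        proof (intro AE_I2)
          fix s :: real
          have "(\<lambda>n. 1 / real (Suc n)) \<longlonglongrightarrow> 0" by real_asymp
          then have "(\<lambda>n. indicator {0..} s *\<^sub>R (complex_of_real (exp (- (1 / real (Suc n) * s))) * r s))
             \<longlonglongrightarrow> indicator {0..} s *\<^sub>R (complex_of_real (exp (- (0 * s))) * r s)"
            by (intro tendsto_intros)
          then show "(\<lambda>n. indicator {0..} s *\<^sub>R (complex_of_real (exp (- (1 / real (Suc n) * s))) * r s))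
            \<longlonglongrightarrow> indicator {0..} s *\<^sub>R r s" by simp
        qed
      qed
      have "(\<lambda>n. (1 / real (Suc n)) powr \<alpha>) \<longlonglongrightarrow> 0" using \<alpha> by real_asymp
      then have "(\<lambda>n. 1 / (of_real ((1 / real (Suc n)) powr \<alpha>) - lam)) \<longlonglongrightarrow> 1 / (of_real 0 - lam)"
        using lam0 by (intro tendsto_intros) auto
      then show "(\<lambda>n. laplace r (1 / real (Suc n))) \<longlonglongrightarrow> - 1 / lam"
        by (simp add: Lr)
    qed
    ultimately show ?thesis using lam0 by simp
  qed
  show thesis
  proof (rule that[OF r])
    show "((\<lambda>t. 1 + lam * half_conv (\<lambda>_. 1) r t) \<longlongrightarrow> 0) at_top" using S0 by (simp add: R_def)
    fix w q :: "real \<Rightarrow> complex" and c :: complex and t :: real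
    assume wc: "continuous_on {0..} w" and qc: "continuous_on {0..} q" and t: "0 \<le> t"
      and eq: "\<And>t. 0 \<le> t \<Longrightarrow> w t = c + half_conv k (\<lambda>s. lam * w s + q s) t"
    define h where "h s = lam * w s + q s" for s
    have hc: "continuous_on {0..} h" unfolding h_def by (intro continuous_intros wc qc)
    have khc: "continuous_on {0..} (half_conv k h)" by (intro continuous_on_half_conv li hc)
    have rqc: "continuous_on {0..} (half_conv r q)" by (intro continuous_on_half_conv li qc)
    note lc = continuous_locally_integrable
    have kh: "half_conv k h s = w s - c" if "0 \<le> s" for s
      using eq[OF that] by (simp add: h_def[abs_def])
    \<comment> \<open>The difference between w and the claimed formula, after subtracting c. It is
      continuous, so it suffices that its convolution with 1 vanishes.\<close>
    define e where "e s = (w s - c) - (lam * c * R s + half_conv r q s)" for s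
    have ec: "continuous_on {0..} e" unfolding e_def by (intro continuous_intros wc Rc rqc)
    have "half_conv ?one e s = 0" if s: "0 \<le> s" for s
    proof -
      \<comment> \<open>The resolvent equation convolved with \<open>h\<close>. Inserting w - c for
        the convolution of k and h, and lam w + q for h, cancels the terms lam (R convolved with w);
        what is left expresses the convolution of 1 with w - c through R, c and q.\<close>
      have A: "lam * half_conv R (half_conv k h) s = half_conv R h s - half_conv ?one (half_conv k h) s"
      proof -
        have "lam * half_conv R (half_conv k h) s = lam * half_conv (half_conv R k) h s"
          by (simp only: half_conv_assoc[OF lc[OF Rc] li(2) hc])
        also have "\<dots> = half_conv h (\<lambda>u. lam * half_conv k R u) s"
          by (simp add: half_conv_cmult half_conv_commute[of h] half_conv_commute[of R k, THEN ext[of "half_conv R k"]])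
        also have "\<dots> = half_conv h (\<lambda>u. R u - half_conv ?one k u) s"
          by (rule half_conv_cong) (simp add: Req)
        also have "\<dots> = half_conv h R s - half_conv h (half_conv ?one k) s"
          by (rule half_conv_diff[OF lc[OF hc] Rc okc])
        also have "half_conv h (half_conv ?one k) s = half_conv ?one (half_conv k h) s"
          by (simp only: half_conv_assoc[OF li(3,2) hc] half_conv_commute[of h])
        finally show ?thesis by (simp only: half_conv_commute[of h])
      qed
      have B: "half_conv R (half_conv k h) s = half_conv R w s - c * half_conv R ?one s"
      proof -
        have "half_conv R (half_conv k h) s = half_conv R (\<lambda>u. w u - c * 1) s"
          by (rule half_conv_cong) (simp add: kh)
        also have "\<dots> = half_conv R w s - half_conv R (\<lambda>u. c * 1) s"
          by (rule half_conv_diff[OF lc[OF Rc] wc]) (intro continuous_intros)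
        finally show ?thesis by (simp only: half_conv_cmult)
      qed
      have C: "half_conv R h s = lam * half_conv R w s + half_conv R q s"
        unfolding h_def by (subst half_conv_add[OF lc[OF Rc]]) (auto intro!: continuous_intros wc qc simp: half_conv_cmult)
      have D: "half_conv ?one (half_conv k h) s = half_conv ?one (\<lambda>u. w u - c) s"
        by (rule half_conv_cong) (simp add: kh)
      have E: "half_conv R q s = half_conv ?one (half_conv r q) s"
        unfolding R_def by (rule half_conv_assoc[OF li(3,1) qc, symmetric])
      have F: "half_conv R ?one s = half_conv ?one R s" by (rule half_conv_commute)
      have "half_conv ?one e s = half_conv ?one (\<lambda>u. w u - c) s
          - (lam * c * half_conv ?one R s + half_conv ?one (half_conv r q) s)"
        unfolding e_def
        by (subst half_conv_diff[OF li(3)] half_conv_add[OF li(3)];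
            (subst half_conv_add[OF li(3)])?; auto intro!: continuous_intros wc Rc rqc simp: half_conv_cmult)
      also have "\<dots> = 0" using A B C D E F by (simp add: algebra_simps)
      finally show ?thesis .
    qed
    then have "e t = 0" if "0 < t" using half_conv_one_eq_0D[OF ec _ that] by blast
    moreover have "e 0 = 0"
      using eq[of 0] by (simp add: e_def R_def half_conv_0)
    ultimately have "e t = 0" using t by (cases "t = 0") auto
    then show "w t = c * (1 + lam * half_conv (\<lambda>_. 1) r t) + half_conv r q t"
      by (simp add: e_def R_def algebra_simps)
  qed
qed

section \<open>Uniform and asymptotic bounds for scalar equations\<close>

text \<open>Fading memory. Arguments t - s beyond T see only values of q bounded by m. Earlier
  values are bounded by M and are multiplied by the part of |r| beyond t - T, whose integral tends
  to 0.\<close>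

lemma half_conv_eventually_le:
  fixes r q :: "real \<Rightarrow> complex"
  assumes r: "set_integrable lborel {0..} r" and q: "continuous_on {0..} q"
    and M: "\<And>t. 0 \<le> t \<Longrightarrow> norm (q t) \<le> M"
    and m: "\<forall>\<^sub>F t in at_top. norm (q t) \<le> m" and \<eta>: "0 < \<eta>"
  shows "\<forall>\<^sub>F t in at_top. norm (half_conv r q t) \<le> (LBINT s:{0..}. norm (r s)) * m + \<eta>"
proof -
  obtain T0 where T0: "\<And>t. T0 \<le> t \<Longrightarrow> norm (q t) \<le> m" using m by (auto simp: eventually_at_top_linorder)
  define T where "T = max 0 T0"
  have T: "0 \<le> T" "\<And>t. T \<le> t \<Longrightarrow> norm (q t) \<le> m" using T0 by (auto simp: T_def)
  have M0: "0 \<le> M" using M[of 0] norm_ge_zero[of "q 0"] by linarith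
  have m0: "0 \<le> m" using T(2)[of T] norm_ge_zero[of "q T"] by linarith
  define n where "n s = norm (r s)" for s
  have ni: "set_integrable lborel {0..} n" unfolding n_def by (rule set_integrable_norm[OF r])
  define J where "J = (LBINT s:{0..}. n s)"
  have ni': "set_integrable lborel {0..b} n" for b by (rule set_integrable_subset[OF ni]) auto
  have bound: "norm (half_conv r q t) \<le> J * m + M * (J - (LBINT s:{0..t - T}. n s))" for t
  proof -
    have li: "locally_integrable r" by (rule locally_integrable_of_integrable[OF r])
    have "half_conv r q t = (LBINT s. cutoff t r s * cutoff t q (t - s))"
      by (subst half_conv_commute, subst half_conv_cutoff[OF order_refl], rule Bochner_Integration.integral_cong[OF refl]) (rule mult.commute)
    then have "norm (half_conv r q t) \<le> (LBINT s. norm (cutoff t r s * cutoff t q (t - s)))"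
      by (simp add: integral_norm_bound)
    also have "\<dots> \<le> (LBINT s. m * (indicator {0..} s *\<^sub>R n s) + M * (indicator {0..} s *\<^sub>R n s - indicator {0..t - T} s *\<^sub>R n s))"
    proof (rule integral_mono)
      show "integrable lborel (\<lambda>s. norm (cutoff t r s * cutoff t q (t - s)))"
        using lborel_integrable_reflect[OF cutoff_product_integrable[OF li q, of t t t], of t]
        by (intro integrable_norm) simp
      show "integrable lborel (\<lambda>s. m * (indicator {0..} s *\<^sub>R n s) + M * (indicator {0..} s *\<^sub>R n s - indicator {0..t - T} s *\<^sub>R n s))"
        using ni ni' unfolding set_integrable_def
        by (intro Bochner_Integration.integrable_add integrable_mult_right Bochner_Integration.integrable_diff)
      fix s
      have n0: "0 \<le> n s" by (simp add: n_def)
      consider "s < 0 \<or> t < s" | "0 \<le> s" "s \<le> t - T" | "0 \<le> s" "t - T < s" "s \<le> t" by linarith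
      then show "norm (cutoff t r s * cutoff t q (t - s))
          \<le> m * (indicator {0..} s *\<^sub>R n s) + M * (indicator {0..} s *\<^sub>R n s - indicator {0..t - T} s *\<^sub>R n s)"
      proof cases
        case 1
        then show ?thesis using m0 M0 n0 T(1) by (auto simp: cutoff_def indicator_def)
      next
        case 2
        then have "norm (q (t - s)) * n s \<le> m * n s" using T n0 by (intro mult_right_mono) auto
        then show ?thesis using 2 T(1) by (simp add: cutoff_def norm_mult n_def mult.commute)
      next
        case 3
        then have "norm (q (t - s)) * n s \<le> M * n s" using M n0 by (intro mult_right_mono) auto
        moreover have "0 \<le> m * n s" using m0 n0 by simp
        ultimately show ?thesis using 3 by (simp add: cutoff_def norm_mult n_def mult.commute)
      qed
    qed
    also have "\<dots> = m * J + M * (J - (LBINT s:{0..t - T}. n s))"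
      using ni ni' unfolding set_integrable_def J_def set_lebesgue_integral_def by simp
    finally show ?thesis by (simp add: mult.commute)
  qed
  have "((\<lambda>b. LBINT s:{0..b}. n s) \<longlongrightarrow> J) at_top"
    unfolding J_def by (rule tendsto_set_lebesgue_integral_at_top[OF _ ni]) auto
  moreover have "filterlim (\<lambda>t. t - T) at_top at_top" by real_asymp
  ultimately have "((\<lambda>t. LBINT s:{0..t - T}. n s) \<longlongrightarrow> J) at_top"
    by (rule filterlim_compose)
  then have "((\<lambda>t. M * (J - (LBINT s:{0..t - T}. n s))) \<longlongrightarrow> M * (J - J)) at_top"
    by (intro tendsto_intros)
  then have "\<forall>\<^sub>F t in at_top. M * (J - (LBINT s:{0..t - T}. n s)) < \<eta>"
    using \<eta> by (intro order_tendstoD(2)) auto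
  then show ?thesis
    by eventually_elim (use bound in \<open>fastforce simp: J_def n_def[abs_def] intro: order_trans\<close>)
qed

text \<open>The integrated form of the Caputo equation of order alpha with right-hand side lam w + q
  and initial value c.\<close>

definition scalar_volterra :: "real \<Rightarrow> complex \<Rightarrow> (real \<Rightarrow> complex) \<Rightarrow> (real \<Rightarrow> complex) \<Rightarrow> complex \<Rightarrow> bool" where
  "scalar_volterra \<alpha> lam w q c \<longleftrightarrow> continuous_on {0..} w \<and> continuous_on {0..} q \<and>
     (\<forall>t\<ge>0. w t = c + half_conv (\<lambda>t. of_real (frac_kernel \<alpha> t)) (\<lambda>s. lam * w s + q s) t)"

text \<open>Read off from the resolvent formula. The first bound uses q on [0, T] only, because
  convolution is causal. In the second no c appears, because the coefficient 1 + lam R of c tends to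
  0.\<close>

theorem scalar_volterra_bounds:
  fixes \<alpha> :: real and lam :: complex
  assumes \<alpha>: "0 < \<alpha>" "\<alpha> < 1" and arg: "\<alpha> * pi / 2 < \<bar>Arg lam\<bar>"
  obtains C where "0 \<le> C"
    "\<And>w q c T M t. \<lbrakk>scalar_volterra \<alpha> lam w q c; 0 \<le> t; t \<le> T; \<And>s. 0 \<le> s \<Longrightarrow> s \<le> T \<Longrightarrow> norm (q s) \<le> M\<rbrakk>
        \<Longrightarrow> norm (w t) \<le> C * (norm c + M)"
    "\<And>w q c M m \<eta>. \<lbrakk>scalar_volterra \<alpha> lam w q c; \<And>s. 0 \<le> s \<Longrightarrow> norm (q s) \<le> M;
        \<forall>\<^sub>F t in at_top. norm (q t) \<le> m; 0 < \<eta>\<rbrakk> \<Longrightarrow> \<forall>\<^sub>F t in at_top. norm (w t) \<le> C * m + \<eta>"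
proof -
  obtain r where r: "set_integrable lborel {0..} r"
    and S: "((\<lambda>t. 1 + lam * half_conv (\<lambda>_. 1) r t) \<longlongrightarrow> 0) at_top"
    and W: "\<And>w q c t. \<lbrakk>continuous_on {0..} w; continuous_on {0..} q; 0 \<le> t;
        \<And>t. 0 \<le> t \<Longrightarrow> w t = c + half_conv (\<lambda>t. complex_of_real (frac_kernel \<alpha> t)) (\<lambda>s. lam * w s + q s) t\<rbrakk>
        \<Longrightarrow> w t = c * (1 + lam * half_conv (\<lambda>_. 1) r t) + half_conv r q t"
    using scalar_resolvent[OF assms] by blast
  have W: "w t = c * (1 + lam * half_conv (\<lambda>_. 1) r t) + half_conv r q t"
    if "scalar_volterra \<alpha> lam w q c" "0 \<le> t" for w q c t
    using that W[of w q t c] by (auto simp: scalar_volterra_def)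
  have li: "locally_integrable r" by (rule locally_integrable_of_integrable[OF r])
  define B where "B = (LBINT s:{0..}. norm (r s))"
  have Bt: "(LBINT s:{0..t}. norm (r s)) \<le> B" for t
    unfolding B_def by (rule truncated_norm_integral_le[OF r])
  have Rb: "norm (half_conv (\<lambda>_. 1) r t) \<le> B" for t
    using half_conv_norm_le[OF li, of "\<lambda>_. 1" t 1] Bt[of t] by (simp add: half_conv_commute[of "\<lambda>_. 1"])
  have B0: "0 \<le> B" using Rb norm_ge_zero order_trans by blast
  define C where "C = 1 + norm lam * B + B"
  have C0: "0 \<le> C" "B \<le> C" "1 + norm lam * B \<le> C" using B0 by (auto simp: C_def)
  show thesis
  proof (rule that[OF C0(1)])
    fix w q c T M t
    assume sv: "scalar_volterra \<alpha> lam w q c" and t: "0 \<le> t" "t \<le> T"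
      and M: "\<And>s. 0 \<le> s \<Longrightarrow> s \<le> T \<Longrightarrow> norm (q s) \<le> M"
    have M0: "0 \<le> M" using M[OF t] norm_ge_zero[of "q t"] by linarith
    have "norm (half_conv r q t) \<le> M * (LBINT s:{0..t}. norm (r s))"
      using sv t M by (intro half_conv_norm_le[OF li]) (auto simp: scalar_volterra_def)
    also have "\<dots> \<le> M * B" by (intro mult_left_mono Bt M0)
    also have "\<dots> \<le> C * M" using M0 C0(2) by (simp add: mult.commute mult_right_mono)
    finally have 1: "norm (half_conv r q t) \<le> C * M" .
    have "norm (1 + lam * half_conv (\<lambda>_. 1) r t) \<le> 1 + norm lam * B"
      by (rule order_trans[OF norm_triangle_ineq]) (simp add: norm_mult mult_left_mono Rb)
    then have "norm (c * (1 + lam * half_conv (\<lambda>_. 1) r t)) \<le> norm c * C"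
      unfolding norm_mult using C0(3) by (intro mult_left_mono) auto
    then show "norm (w t) \<le> C * (norm c + M)"
      unfolding W[OF sv t(1)] using 1 norm_triangle_le by (simp add: distrib_left mult.commute add_mono norm_triangle_le)
  next
    fix w q c M m and \<eta> :: real
    assume sv: "scalar_volterra \<alpha> lam w q c" and M: "\<And>s. 0 \<le> s \<Longrightarrow> norm (q s) \<le> M"
      and m: "\<forall>\<^sub>F t in at_top. norm (q t) \<le> m" and \<eta>: "0 < \<eta>"
    have qc: "continuous_on {0..} q" using sv by (simp add: scalar_volterra_def)
    obtain N where "\<forall>t\<ge>N. norm (q t) \<le> m" using m by (auto simp: eventually_at_top_linorder)
    then have m0: "0 \<le> m" using norm_ge_zero[of "q N"] by (meson order_refl order_trans)
    have "((\<lambda>t. norm (c * (1 + lam * half_conv (\<lambda>_. 1) r t))) \<longlongrightarrow> norm (c * 0)) at_top"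
      by (intro tendsto_intros S)
    then have e1: "\<forall>\<^sub>F t in at_top. norm (c * (1 + lam * half_conv (\<lambda>_. 1) r t)) < \<eta> / 2"
      using \<eta> by (intro order_tendstoD(2)) auto
    have e2: "\<forall>\<^sub>F t in at_top. norm (half_conv r q t) \<le> B * m + \<eta> / 2"
      unfolding B_def using \<eta> by (intro half_conv_eventually_le[OF r qc M m]) auto
    show "\<forall>\<^sub>F t in at_top. norm (w t) \<le> C * m + \<eta>"
      using e1 e2 eventually_ge_at_top[of 0]
    proof eventually_elim
      case (elim t)
      have "norm (w t) \<le> \<eta> / 2 + (B * m + \<eta> / 2)"
        unfolding W[OF sv elim(3)] using elim by (intro order_trans[OF norm_triangle_ineq] add_mono) auto
      also have "\<dots> \<le> C * m + \<eta>" using mult_right_mono[OF C0(2) m0] by simp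
      finally show ?case .
    qed
  qed
qed

section \<open>Annihilating products of a matrix\<close>

text \<open>This is p(A) v, computed by Horner's scheme on vectors.\<close>

definition poly_orbit :: "complex^'n^'n \<Rightarrow> complex^'n \<Rightarrow> complex poly \<Rightarrow> complex^'n" where
  "poly_orbit A v p = fold_coeffs (\<lambda>a w. a *s v + A *v w) p 0"

lemma poly_orbit_0 [simp]: "poly_orbit A v 0 = 0"
  by (simp add: poly_orbit_def)

lemma poly_orbit_pCons: "poly_orbit A v (pCons a p) = a *s v + A *v poly_orbit A v p"
  by (cases "pCons a p = 0") (auto simp: poly_orbit_def)

lemma poly_orbit_add: "poly_orbit A v (p + q) = poly_orbit A v p + poly_orbit A v q"
proof (induction p q rule: poly_induct2)
  case (pCons a p b q)
  then show ?case
    by (simp add: poly_orbit_pCons vector_sadd_rdistrib matrix_vector_right_distrib)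
qed simp

lemma poly_orbit_smult: "poly_orbit A v (smult c p) = c *s poly_orbit A v p"
proof (induction p)
  case (pCons a p)
  then show ?case
    by (simp add: poly_orbit_pCons vector_add_ldistrib vector_scalar_commute)
qed simp

lemma poly_orbit_monom: "poly_orbit A v (monom c i) = c *s (((*v) A) ^^ i) v"
  by (induction i) (simp_all add: monom_0 monom_Suc poly_orbit_pCons vector_scalar_commute)

lemma poly_orbit_sum: "poly_orbit A v (sum f S) = (\<Sum>i\<in>S. poly_orbit A v (f i))"
  by (induction S rule: infinite_finite_induct) (simp_all add: poly_orbit_add)

lemma poly_orbit_linear_factor:
  "poly_orbit A v ([:- l, 1:] * q) = A *v poly_orbit A v q - l *s poly_orbit A v q"
proof -
  have "[:- l, 1:] * q = pCons 0 q + smult (- l) q" by simp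
  then show ?thesis by (simp only: poly_orbit_add poly_orbit_smult poly_orbit_pCons) simp
qed

lemma poly_orbit_subspace:
  assumes "vec.subspace W" "\<And>w. w \<in> W \<Longrightarrow> A *v w \<in> W" "v \<in> W"
  shows "poly_orbit A v p \<in> W"
proof (induction p)
  case (pCons a p)
  then show ?case
    using assms by (auto simp: poly_orbit_pCons intro!: vec.subspace_add vec.subspace_scale)
qed (use assms in \<open>simp add: vec.subspace_0\<close>)

text \<open>The vectors v, A v, ..., A^n v number one more than the dimension. Linear dependence is
  a property of sets, so a repetition among them is treated first and gives a difference of two
  monomials.\<close>

lemma poly_orbit_annihilator:
  fixes A :: "complex^'n^'n"
  shows "\<exists>p. p \<noteq> 0 \<and> poly_orbit A v p = 0"
proof (cases "inj_on (\<lambda>i. (((*v) A) ^^ i) v) {..CARD('n)}")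
  case False
  then obtain i j where ij: "i \<noteq> j" "(((*v) A) ^^ i) v = (((*v) A) ^^ j) v" by (auto simp: inj_on_def)
  have "poly_orbit A v (monom 1 i + monom (-1) j) = 0"
    using ij by (simp add: poly_orbit_add poly_orbit_monom)
  moreover have "coeff (monom 1 i + monom (-1) j) i = (1::complex)" using ij by simp
  then have "monom 1 i + monom (-1::complex) j \<noteq> 0" by (metis coeff_0 zero_neq_one)
  ultimately show ?thesis by blast
next
  case True
  define f where "f i = (((*v) A) ^^ i) v" for i
  have "vec.dependent (f ` {..CARD('n)})"
  proof (rule vec.dependent_biggerset_general)
    have "vec.dim (f ` {..CARD('n)}) \<le> CARD('n)"
      using vec.dim_subset[of "f ` {..CARD('n)}" UNIV] by (simp only: vec_dim_card subset_UNIV)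
    moreover have "card (f ` {..CARD('n)}) = CARD('n) + 1"
      using True by (subst card_image) (auto simp: f_def[abs_def])
    ultimately show "vec.dim (f ` {..CARD('n)}) < card (f ` {..CARD('n)})" by simp
  qed
  then obtain S u where S: "finite S" "S \<subseteq> f ` {..CARD('n)}" "(\<Sum>w\<in>S. u w *s w) = 0" "\<exists>w\<in>S. u w \<noteq> 0"
    unfolding vec.dependent_explicit by blast
  define I where "I = {i\<in>{..CARD('n)}. f i \<in> S}"
  have inj: "inj_on f I" using True by (auto simp: I_def f_def[abs_def] intro: inj_on_subset)
  have fI: "f ` I = S" using S(2) by (auto simp: I_def)
  define p where "p = (\<Sum>i\<in>I. monom (u (f i)) i)"
  have "poly_orbit A v p = (\<Sum>i\<in>I. u (f i) *s f i)"
    by (simp add: p_def poly_orbit_sum poly_orbit_monom f_def)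
  also have "\<dots> = 0" using S(3) unfolding fI[symmetric] by (simp add: sum.reindex[OF inj])
  finally have "poly_orbit A v p = 0" .
  moreover obtain i where i: "i \<in> I" "u (f i) \<noteq> 0" using S(4) fI by blast
  have "coeff p i = u (f i)"
  proof -
    have "finite I" by (simp add: I_def)
    then show ?thesis using i by (simp add: p_def coeff_sum sum.delta)
  qed
  then have "p \<noteq> 0" using i by auto
  ultimately show ?thesis by blast
qed

text \<open>For an annihilating polynomial p of v of least degree and a root l of p, write p = (x -
  l) q. Minimality makes q(A) v nonzero, A - l kills it, and invariance keeps it in W.\<close>

lemma invariant_subspace_eigenvector:
  fixes A :: "complex^'n^'n"
  assumes W: "vec.subspace W" "\<And>w. w \<in> W \<Longrightarrow> A *v w \<in> W" and v: "v \<in> W" "v \<noteq> 0"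
  obtains l u where "u \<in> W" "u \<noteq> 0" "A *v u = l *s u"
proof -
  define P where "P n \<longleftrightarrow> (\<exists>p. p \<noteq> 0 \<and> poly_orbit A v p = 0 \<and> degree p = n)" for n
  have "\<exists>n. P n" using poly_orbit_annihilator[of A v] by (auto simp: P_def)
  then have "P (LEAST n. P n)" by (rule LeastI_ex)
  then obtain p where p: "p \<noteq> 0" "poly_orbit A v p = 0" "degree p = (LEAST n. P n)" by (auto simp: P_def)
  have "degree p \<noteq> 0"
  proof
    assume "degree p = 0"
    then obtain c where "p = [:c:]" by (rule degree_eq_zeroE)
    then show False using p v by (simp add: poly_orbit_pCons)
  qed
  then obtain l where "poly p l = 0"
    using fundamental_theorem_of_algebra[of p] by (auto simp: constant_degree)
  then obtain q where q: "p = [:- l, 1:] * q" by (auto simp: poly_eq_0_iff_dvd elim: dvdE)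
  have q0: "q \<noteq> 0" using p q by auto
  have "degree q < degree p" unfolding q using q0 by (subst degree_mult_eq) auto
  then have "poly_orbit A v q \<noteq> 0" using not_less_Least[of "degree q" P] p(3) q0 by (auto simp: P_def)
  moreover have "A *v poly_orbit A v q = l *s poly_orbit A v q"
    using p(2) unfolding q poly_orbit_linear_factor by simp
  ultimately show thesis using that poly_orbit_subspace[OF W v(1)] by blast
qed

lemma mat_vector_mult: "mat l *v x = l *s (x :: complex^'n)"
  by (simp add: vec_eq_iff matrix_vector_mult_def mat_def if_distrib if_distribR sum.delta cong: if_cong)

text \<open>Folding from the left places the factor of the last list entry rightmost, where it acts
  first on vectors. Appending an entry thus composes with A - l on the right, both here and in the
  descent along the product.\<close>

definition shift_product :: "complex^'n^'n \<Rightarrow> complex list \<Rightarrow> complex^'n^'n" where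
  "shift_product A ls = foldl (\<lambda>M l. M ** (A - mat l)) (mat 1) ls"

text \<open>For an eigenvector in the invariant subspace \<open>W\<close> with eigenvalue \<open>l\<close>, the subspace \<open>(A - l) W\<close> is again invariant
  and of smaller dimension.\<close>

lemma invariant_subspace_annihilated:
  fixes A :: "complex^'n^'n"
  assumes "vec.subspace W" "\<And>w. w \<in> W \<Longrightarrow> A *v w \<in> W"
  shows "\<exists>ls. (\<forall>l\<in>set ls. \<exists>u. u \<noteq> 0 \<and> A *v u = l *s u) \<and> (\<forall>w\<in>W. shift_product A ls *v w = 0)"
  using assms
proof (induction "vec.dim W" arbitrary: W rule: less_induct)
  case less
  show ?case
  proof (cases "W \<subseteq> {0}")
    case True
    then show ?thesis by (intro exI[of _ "[]"]) auto
  next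
    case False
    then obtain v where "v \<in> W" "v \<noteq> 0" by auto
    then obtain l u where u: "u \<in> W" "u \<noteq> 0" "A *v u = l *s u"
      using invariant_subspace_eigenvector[OF less.prems] by metis
    define L where "L = A - mat l"
    have L: "L *v w = A *v w - l *s w" for w
      by (simp add: L_def matrix_vector_mult_diff_rdistrib mat_vector_mult)
    define W' where "W' = (\<lambda>w. L *v w) ` W"
    have W'W: "W' \<subseteq> W"
      using less.prems by (auto simp: W'_def L intro!: vec.subspace_diff vec.subspace_scale)
    have W's: "vec.subspace W'" unfolding W'_def
      by (rule vec.subspace_image[OF less.prems(1)])
    \<comment> \<open>If L mapped W onto W, the image of a basis would span W with at most dim W
      elements and be a basis again; L would be injective on W, contradicting L u = 0 with u
      nonzero.\<close>
    have "W' \<noteq> W"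
    proof
      assume eq: "W' = W"
      obtain B where B: "B \<subseteq> W" "vec.independent B" "W \<subseteq> vec.span B" "card B = vec.dim W"
        using vec.basis_exists by blast
      have fB: "finite B" by (rule vec.finiteI_independent[OF B(2)])
      have spB: "vec.span B = W" using B less.prems(1) by (simp add: vec.span_minimal subset_antisym)
      have spI: "vec.span ((\<lambda>w. L *v w) ` B) = W"
        unfolding vec.span_image spB using eq by (simp add: W'_def)
      have "vec.independent ((\<lambda>w. L *v w) ` B) \<and> inj_on (\<lambda>w. L *v w) B"
      proof -
        have c: "vec.dim W \<le> card ((\<lambda>w. L *v w) ` B)"
          using vec.dim_le_card[of W "(\<lambda>w. L *v w) ` B"] fB spI by simp
        then have "card ((\<lambda>w. L *v w) ` B) = card B" using card_image_le[OF fB, of "\<lambda>w. L *v w"] B(4) by simp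
        then have "inj_on (\<lambda>w. L *v w) B" by (rule eq_card_imp_inj_on[OF fB])
        moreover have "vec.independent ((\<lambda>w. L *v w) ` B)"
          by (rule vec.card_le_dim_spanning[of _ W]) (use spI fB vec.span_superset[of "(\<lambda>w. L *v w) ` B"] card_image_le[OF fB] B(4) in auto)
        ultimately show ?thesis by simp
      qed
      then have "inj_on (\<lambda>w. L *v w) (vec.span B)"
        by (intro vec.inj_on_span_independent_image) auto
      then show False using u vec.subspace_0[OF less.prems(1)] unfolding spB by (auto simp: inj_on_def L)
    qed
    then have "vec.dim W' < vec.dim W"
      using W'W W's less.prems(1) by (intro vec.dim_psubset) (auto simp: vec.span_eq_iff[THEN iffD2])
    moreover have "A *v w \<in> W'" if w: "w \<in> W'" for w
    proof -
      obtain x where x: "x \<in> W" "w = L *v x" using w by (auto simp: W'_def)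
      have "A *v w = L *v (A *v x)"
        by (simp add: x L matrix_vector_mult_diff_distrib vector_scalar_commute)
      then show ?thesis using x less.prems(2) by (auto simp: W'_def)
    qed
    ultimately obtain ls where ls: "\<forall>l\<in>set ls. \<exists>u. u \<noteq> 0 \<and> A *v u = l *s u"
      "\<forall>w\<in>W'. shift_product A ls *v w = 0" using less.hyps[of W'] W's by blast
    show ?thesis
    proof (intro exI[of _ "ls @ [l]"] conjI ballI)
      show "\<exists>u. u \<noteq> 0 \<and> A *v u = x *s u" if "x \<in> set (ls @ [l])" for x using that ls(1) u by auto
      show "shift_product A (ls @ [l]) *v w = 0" if "w \<in> W" for w
        using that ls(2) by (simp add: shift_product_def W'_def L_def flip: matrix_vector_mul_assoc)
    qed
  qed
qed

corollary shift_product_annihilates: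
  fixes A :: "complex^'n^'n"
  obtains ls where "\<And>l. l \<in> set ls \<Longrightarrow> \<exists>u. u \<noteq> 0 \<and> A *v u = l *s u" "shift_product A ls = 0"
proof -
  obtain ls where ls: "\<forall>l\<in>set ls. \<exists>u. u \<noteq> 0 \<and> A *v u = l *s u" "\<forall>w. shift_product A ls *v w = 0"
    using invariant_subspace_annihilated[of UNIV A] by auto
  have "shift_product A ls = 0" using ls(2) by (simp add: matrix_eq)
  then show thesis using that ls(1) by blast
qed

section \<open>Linear systems\<close>

definition complexify :: "real^'n \<Rightarrow> complex^'n" where
  "complexify x = (\<chi> i. complex_of_real (x $ i))"

definition complexify_matrix :: "real^'n^'n \<Rightarrow> complex^'n^'n" where
  "complexify_matrix A = (\<chi> i j. complex_of_real (A $ i $ j))"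

lemma complexify_mult: "complexify (A *v x) = complexify_matrix A *v complexify x"
  by (simp add: complexify_def complexify_matrix_def matrix_vector_mult_def vec_eq_iff)

lemma complexify_add: "complexify (x + y) = complexify x + complexify y"
  by (simp add: complexify_def vec_eq_iff)

lemma norm_complexify: "norm (complexify x) = norm x"
  by (simp add: complexify_def norm_vec_def)

lemma norm_vec_le_sum: "norm x \<le> (\<Sum>i\<in>UNIV. norm (x $ i))"
  unfolding norm_vec_def by (rule L2_set_le_sum) auto

text \<open>Stated by components because \<open>half_conv\<close> takes values in a field. The
  forcing g is a free function, so that the linear estimates apply to f(v) and to the truncated
  nonlinearity alike.\<close>

definition volterra_solution :: "real \<Rightarrow> real^'n^'n \<Rightarrow> (real \<Rightarrow> real^'n) \<Rightarrow> real^'n \<Rightarrow> (real \<Rightarrow> real^'n) \<Rightarrow> bool" where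
  "volterra_solution \<alpha> A g x0 v \<longleftrightarrow> continuous_on {0..} v \<and> continuous_on {0..} g \<and>
     (\<forall>t\<ge>0. \<forall>i. v t $ i = x0 $ i + half_conv (frac_kernel \<alpha>) (\<lambda>s. (A *v v s + g s) $ i) t)"

lemma half_conv_sum:
  assumes "locally_integrable a" "\<And>j. j \<in> S \<Longrightarrow> continuous_on {0..} (f j)"
  shows "half_conv a (\<lambda>s. \<Sum>j\<in>S. f j s) t = (\<Sum>j\<in>S. half_conv a (f j) t)"
  using assms(2)
proof (induction S rule: infinite_finite_induct)
  case (insert x F)
  then show ?case
    by (simp add: half_conv_add[OF assms(1)] continuous_on_sum)
qed (simp_all add: half_conv_def)

lemma continuous_on_complexify_row:
  assumes "continuous_on S v"
  shows "continuous_on S (\<lambda>t. (B *v complexify (v t)) $ i)"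
  unfolding matrix_vector_mult_def complexify_def by (auto intro!: continuous_intros assms)

text \<open>A constant matrix commutes with convolution by the scalar kernel.\<close>

lemma volterra_solution_row:
  fixes B :: "complex^'n^'n"
  assumes \<alpha>: "0 < \<alpha>" and v: "volterra_solution \<alpha> A g x0 v" and t: "0 \<le> t"
  shows "(B *v complexify (v t)) $ i = (B *v complexify x0) $ i
    + half_conv (\<lambda>t. of_real (frac_kernel \<alpha> t)) (\<lambda>s. (B *v complexify (A *v v s + g s)) $ i) t"
proof -
  define h where "h j s = (A *v v s + g s) $ j" for j s
  have hc: "continuous_on {0..} (h j)" for j
    using v unfolding h_def volterra_solution_def
    by (auto intro!: continuous_intros simp: matrix_vector_mult_def)
  have vt: "v t $ j = x0 $ j + half_conv (frac_kernel \<alpha>) (h j) t" for j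
    using v t by (simp add: volterra_solution_def h_def[abs_def])
  have "(B *v complexify (v t)) $ i = (\<Sum>j\<in>UNIV. B $ i $ j * of_real (x0 $ j))
      + (\<Sum>j\<in>UNIV. B $ i $ j * of_real (half_conv (frac_kernel \<alpha>) (h j) t))"
    by (simp add: matrix_vector_mult_def complexify_def vt distrib_left sum.distrib)
  also have "(\<Sum>j\<in>UNIV. B $ i $ j * of_real (half_conv (frac_kernel \<alpha>) (h j) t))
      = (\<Sum>j\<in>UNIV. half_conv (\<lambda>t. complex_of_real (frac_kernel \<alpha> t)) (\<lambda>s. B $ i $ j * of_real (h j s)) t)"
    by (simp add: half_conv_cmult half_conv_of_real)
  also have "\<dots> = half_conv (\<lambda>t. of_real (frac_kernel \<alpha> t)) (\<lambda>s. \<Sum>j\<in>UNIV. B $ i $ j * of_real (h j s)) t"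
    by (rule half_conv_sum[symmetric]) (auto intro!: frac_kernel_locally_integrable \<alpha> continuous_intros hc)
  finally show ?thesis
    by (simp add: matrix_vector_mult_def complexify_def h_def)
qed

text \<open>The induction predicate, with B a partial product; C is fixed before g, x0 and v. The
  first clause needs g on [0, T] only, as a first-exit argument demands; the second has no x0 term,
  as repeated halving demands.\<close>

definition volterra_bounded :: "real \<Rightarrow> real^'n^'n \<Rightarrow> complex^'n^'n \<Rightarrow> bool" where
  "volterra_bounded \<alpha> A B \<longleftrightarrow> (\<exists>C\<ge>0. \<forall>g x0 v. volterra_solution \<alpha> A g x0 v \<longrightarrow>
     (\<forall>T M. (\<forall>s. 0 \<le> s \<and> s \<le> T \<longrightarrow> norm (g s) \<le> M) \<longrightarrow>
        (\<forall>t. 0 \<le> t \<and> t \<le> T \<longrightarrow> norm (B *v complexify (v t)) \<le> C * (norm x0 + M))) \<and>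
     (\<forall>M m \<eta>. (\<forall>s\<ge>0. norm (g s) \<le> M) \<and> (\<forall>\<^sub>F t in at_top. norm (g t) \<le> m) \<and> 0 < \<eta> \<longrightarrow>
        (\<forall>\<^sub>F t in at_top. norm (B *v complexify (v t)) \<le> C * m + \<eta>)))"

text \<open>Since B A v = lam B v + D v with D = B (A - lam), each component of B v solves a scalar
  equation with eigenvalue lam and forcing (D v + B g)$i. The hypothesis for D bounds this forcing,
  both uniformly and asymptotically.\<close>

lemma volterra_bounded_step:
  fixes A :: "real^'n^'n" and B :: "complex^'n^'n"
  assumes \<alpha>: "0 < \<alpha>" "\<alpha> < 1" and arg: "\<alpha> * pi / 2 < \<bar>Arg lam\<bar>"
    and IH: "volterra_bounded \<alpha> A (B ** (complexify_matrix A - mat lam))"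
  shows "volterra_bounded \<alpha> A B"
proof -
  define D where "D = B ** (complexify_matrix A - mat lam)"
  obtain C0 where C0: "0 \<le> C0"
    and S1: "\<And>w q c T M t. \<lbrakk>scalar_volterra \<alpha> lam w q c; 0 \<le> t; t \<le> T; \<And>s. 0 \<le> s \<Longrightarrow> s \<le> T \<Longrightarrow> norm (q s) \<le> M\<rbrakk>
        \<Longrightarrow> norm (w t) \<le> C0 * (norm c + M)"
    and S2: "\<And>w q c M m \<eta>. \<lbrakk>scalar_volterra \<alpha> lam w q c; \<And>s. 0 \<le> s \<Longrightarrow> norm (q s) \<le> M;
        \<forall>\<^sub>F t in at_top. norm (q t) \<le> m; 0 < \<eta>\<rbrakk> \<Longrightarrow> \<forall>\<^sub>F t in at_top. norm (w t) \<le> C0 * m + \<eta>"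
    using scalar_volterra_bounds[OF \<alpha> arg] by blast
  obtain C1 where C1: "0 \<le> C1"
    and D1: "\<And>g x0 v T M t. \<lbrakk>volterra_solution \<alpha> A g x0 v; \<And>s. 0 \<le> s \<Longrightarrow> s \<le> T \<Longrightarrow> norm (g s) \<le> M; 0 \<le> t; t \<le> T\<rbrakk>
       \<Longrightarrow> norm (D *v complexify (v t)) \<le> C1 * (norm x0 + M)"
    and D2: "\<And>g x0 v M m \<eta>. \<lbrakk>volterra_solution \<alpha> A g x0 v; \<And>s. 0 \<le> s \<Longrightarrow> norm (g s) \<le> M;
       \<forall>\<^sub>F t in at_top. norm (g t) \<le> m; 0 < \<eta>\<rbrakk> \<Longrightarrow> \<forall>\<^sub>F t in at_top. norm (D *v complexify (v t)) \<le> C1 * m + \<eta>"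
    using IH unfolding volterra_bounded_def D_def[symmetric] by metis
  have "bounded_linear ((*v) B)" by (rule matrix_vector_mul_bounded_linear)
  then obtain \<beta> where \<beta>: "0 < \<beta>" "\<And>x. norm (B *v x) \<le> norm x * \<beta>"
    using bounded_linear.pos_bounded by blast
  have B\<beta>: "norm (B *v complexify x) \<le> \<beta> * norm x" for x
    using \<beta>(2)[of "complexify x"] by (simp add: norm_complexify mult.commute)
  define N where "N = real CARD('n)"
  have N: "0 < N" by (simp add: N_def)
  define q where "q g v i s = (D *v complexify (v s)) $ i + (B *v complexify (g s)) $ i" for g v :: "real \<Rightarrow> real^'n" and i s
  have nq: "norm (q g v i s) \<le> norm (D *v complexify (v s)) + \<beta> * norm (g s)" for g v i s
    unfolding q_def
    by (intro order_trans[OF norm_triangle_ineq] add_mono order_trans[OF _ B\<beta>] Finite_Cartesian_Product.norm_nth_le)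
  have sv: "scalar_volterra \<alpha> lam (\<lambda>t. (B *v complexify (v t)) $ i) (q g v i) ((B *v complexify x0) $ i)"
    if v: "volterra_solution \<alpha> A g x0 v" for g x0 v i
    unfolding scalar_volterra_def
  proof (intro conjI allI impI)
    have vc: "continuous_on {0..} v" and gc: "continuous_on {0..} g" using v by (auto simp: volterra_solution_def)
    show "continuous_on {0..} (\<lambda>t. (B *v complexify (v t)) $ i)" by (rule continuous_on_complexify_row[OF vc])
    show "continuous_on {0..} (q g v i)"
      unfolding q_def by (intro continuous_intros continuous_on_complexify_row vc gc)
    fix t :: real assume t: "0 \<le> t"
    have "B *v complexify (A *v v s + g s) = lam *s (B *v complexify (v s)) + (D *v complexify (v s) + B *v complexify (g s))" for s
    proof -
      have "D *v complexify (v s) = B *v (complexify_matrix A *v complexify (v s) - lam *s complexify (v s))"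
        by (simp add: D_def matrix_vector_mult_diff_rdistrib mat_vector_mult flip: matrix_vector_mul_assoc)
      also have "\<dots> = B *v complexify (A *v v s) - lam *s (B *v complexify (v s))"
        by (simp add: complexify_mult matrix_vector_mult_diff_distrib vector_scalar_commute)
      finally show ?thesis by (simp add: complexify_add matrix_vector_right_distrib)
    qed
    then show "(B *v complexify (v t)) $ i = (B *v complexify x0) $ i +
      half_conv (\<lambda>t. of_real (frac_kernel \<alpha> t)) (\<lambda>s. lam * (B *v complexify (v s)) $ i + q g v i s) t"
      using volterra_solution_row[OF \<alpha>(1) v t, of B i] by (simp add: q_def)
  qed
  have comp: "norm (B *v complexify x) \<le> N * K" if "\<And>i. norm ((B *v complexify x) $ i) \<le> K" for x K
  proof -
    have "norm (B *v complexify x) \<le> (\<Sum>i\<in>UNIV. norm ((B *v complexify x) $ i))" by (rule norm_vec_le_sum)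
    also have "\<dots> \<le> (\<Sum>i\<in>(UNIV::'n set). K)" by (intro sum_mono that)
    finally show ?thesis by (simp add: N_def)
  qed
  define C where "C = N * (C0 * (\<beta> + C1))"
  show ?thesis unfolding volterra_bounded_def
  proof (intro exI[of _ C] conjI allI impI)
    show "0 \<le> C" using N C0 C1 \<beta> by (simp add: C_def)
    fix g x0 v assume v: "volterra_solution \<alpha> A g x0 v"
    have qb: "norm (q g v i s) \<le> C1 * (norm x0 + M) + \<beta> * M"
      if M: "\<And>s. 0 \<le> s \<Longrightarrow> s \<le> T \<Longrightarrow> norm (g s) \<le> M" and s: "0 \<le> s" "s \<le> T" for T M i s
      using D1[OF v M s] M[OF s] \<beta> by (intro order_trans[OF nq] add_mono mult_left_mono) auto
    {
      fix T M t assume M: "\<forall>s. 0 \<le> s \<and> s \<le> T \<longrightarrow> norm (g s) \<le> M" and t: "0 \<le> t \<and> t \<le> T"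
      have c: "norm ((B *v complexify x0) $ i) \<le> \<beta> * norm x0" for i
        using order_trans[OF Finite_Cartesian_Product.norm_nth_le B\<beta>] .
      have "norm ((B *v complexify (v t)) $ i) \<le> C0 * ((\<beta> + C1) * (norm x0 + M))" for i
      proof -
        have "norm ((B *v complexify (v t)) $ i) \<le> C0 * (norm ((B *v complexify x0) $ i) + (C1 * (norm x0 + M) + \<beta> * M))"
          using t M by (intro S1[OF sv[OF v], where T=T] qb) auto
        also have "\<dots> \<le> C0 * (\<beta> * norm x0 + (C1 * (norm x0 + M) + \<beta> * M))"
          by (intro mult_left_mono add_right_mono c C0)
        finally show ?thesis by (simp add: algebra_simps)
      qed
      then show "norm (B *v complexify (v t)) \<le> C * (norm x0 + M)"
        using comp by (simp add: C_def mult.assoc)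
    }
    fix M m and \<eta> :: real assume *: "(\<forall>s\<ge>0. norm (g s) \<le> M) \<and> (\<forall>\<^sub>F t in at_top. norm (g t) \<le> m) \<and> 0 < \<eta>"
    \<comment> \<open>The slack e is used twice, once in the bound for D v, where C0 amplifies it,
      and once in the scalar estimate; summed over N components it amounts to N (C0 + 1) e =
      eta.\<close>
    define e where "e = \<eta> / (N * (C0 + 1))"
    have e: "0 < e" using * N C0 by (simp add: e_def)
    have q1: "norm (q g v i s) \<le> C1 * (norm x0 + M) + \<beta> * M" if "0 \<le> s" for i s
      using * that by (intro qb[of s]) auto
    have "\<forall>\<^sub>F t in at_top. norm (D *v complexify (v t)) \<le> C1 * m + e"
      using * by (intro D2[OF v _ _ e]) auto
    then have q2: "\<forall>\<^sub>F t in at_top. norm (q g v i t) \<le> (C1 * m + e) + \<beta> * m" for i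
      using conjunct1[OF conjunct2[OF *]]
      by eventually_elim (intro order_trans[OF nq] add_mono mult_left_mono, use \<beta> in auto)
    have "\<forall>\<^sub>F t in at_top. norm ((B *v complexify (v t)) $ i) \<le> C0 * ((C1 * m + e) + \<beta> * m) + e" for i
      by (rule S2[OF sv[OF v] q1 q2 e])
    then have "\<forall>\<^sub>F t in at_top. \<forall>i\<in>UNIV. norm ((B *v complexify (v t)) $ i) \<le> C0 * ((C1 * m + e) + \<beta> * m) + e"
      by (intro eventually_ball_finite) auto
    then show "\<forall>\<^sub>F t in at_top. norm (B *v complexify (v t)) \<le> C * m + \<eta>"
    proof eventually_elim
      case (elim t)
      have "norm (B *v complexify (v t)) \<le> N * (C0 * ((C1 * m + e) + \<beta> * m) + e)"
        using elim by (intro comp) auto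
      also have "\<dots> = C * m + N * (C0 + 1) * e" by (simp add: C_def algebra_simps)
      also have "N * (C0 + 1) * e = \<eta>" using N C0 by (simp add: e_def)
      finally show ?case .
    qed
  qed
qed

lemma volterra_bounded_0: "volterra_bounded \<alpha> A 0"
  unfolding volterra_bounded_def
proof (intro exI[of _ 0] conjI allI impI)
  fix m \<eta> :: real and M g v assume "(\<forall>s\<ge>0. norm (g s) \<le> M) \<and> (\<forall>\<^sub>F t in at_top. norm (g t) \<le> m) \<and> 0 < \<eta>"
  then show "\<forall>\<^sub>F t in at_top. norm (0 *v complexify (v t)) \<le> 0 * m + \<eta>"
    by (intro always_eventually) auto
qed auto

theorem volterra_stability_bounds:
  fixes A :: "real^'n^'n"
  assumes \<alpha>: "0 < \<alpha>" "\<alpha> < 1" and spectrum: "\<forall>lam \<in> complex_spectrum A. \<bar>Arg lam\<bar> > \<alpha> * pi / 2"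
  obtains C where "0 < C"
    "\<And>g x0 v T M t. \<lbrakk>volterra_solution \<alpha> A g x0 v; \<And>s. 0 \<le> s \<Longrightarrow> s \<le> T \<Longrightarrow> norm (g s) \<le> M; 0 \<le> t; t \<le> T\<rbrakk>
       \<Longrightarrow> norm (v t) \<le> C * (norm x0 + M)"
    "\<And>g x0 v M m \<eta>. \<lbrakk>volterra_solution \<alpha> A g x0 v; \<And>s. 0 \<le> s \<Longrightarrow> norm (g s) \<le> M;
       \<forall>\<^sub>F t in at_top. norm (g t) \<le> m; 0 < \<eta>\<rbrakk> \<Longrightarrow> \<forall>\<^sub>F t in at_top. norm (v t) \<le> C * m + \<eta>"
proof -
  obtain ls where ls: "\<And>l. l \<in> set ls \<Longrightarrow> \<exists>u. u \<noteq> 0 \<and> complexify_matrix A *v u = l *s u"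
    and ann: "shift_product (complexify_matrix A) ls = 0"
    using shift_product_annihilates[of "complexify_matrix A"] by metis
  have arg: "\<alpha> * pi / 2 < \<bar>Arg l\<bar>" if "l \<in> set ls" for l
    using spectrum ls[OF that] by (auto simp: complex_spectrum_def complexify_matrix_def)
  have "volterra_bounded \<alpha> A (shift_product (complexify_matrix A) ls) \<Longrightarrow> volterra_bounded \<alpha> A (mat 1)"
    using arg
  proof (induction ls rule: rev_induct)
    case (snoc l ls)
    then show ?case
      using volterra_bounded_step[OF \<alpha>, of l A "shift_product (complexify_matrix A) ls"]
      by (simp add: shift_product_def)
  qed (simp add: shift_product_def)
  then have "volterra_bounded \<alpha> A (mat 1)" using volterra_bounded_0[of \<alpha> A] by (simp add: ann)
  then obtain C where C: "0 \<le> C" and all: "\<forall>g x0 v. volterra_solution \<alpha> A g x0 v \<longrightarrow>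
     (\<forall>T M. (\<forall>s. 0 \<le> s \<and> s \<le> T \<longrightarrow> norm (g s) \<le> M) \<longrightarrow>
        (\<forall>t. 0 \<le> t \<and> t \<le> T \<longrightarrow> norm (v t) \<le> C * (norm x0 + M))) \<and>
     (\<forall>M m \<eta>. (\<forall>s\<ge>0. norm (g s) \<le> M) \<and> (\<forall>\<^sub>F t in at_top. norm (g t) \<le> m) \<and> 0 < \<eta> \<longrightarrow>
        (\<forall>\<^sub>F t in at_top. norm (v t) \<le> C * m + \<eta>))"
    unfolding volterra_bounded_def matrix_vector_mul_lid norm_complexify by (elim exE conjE)
  have 1: "norm (v t) \<le> C * (norm x0 + M)"
    if "volterra_solution \<alpha> A g x0 v" "\<And>s. 0 \<le> s \<Longrightarrow> s \<le> T \<Longrightarrow> norm (g s) \<le> M" "0 \<le> t" "t \<le> T" for g x0 v T M t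
    by (rule all[THEN spec, THEN spec, THEN spec, THEN mp, OF that(1), THEN conjunct1, THEN spec, THEN spec, THEN mp,
          THEN spec, THEN mp, of T]) (use that(2-) in auto)
  have 2: "\<forall>\<^sub>F t in at_top. norm (v t) \<le> C * m + \<eta>"
    if "volterra_solution \<alpha> A g x0 v" "\<And>s. 0 \<le> s \<Longrightarrow> norm (g s) \<le> M"
       "\<forall>\<^sub>F t in at_top. norm (g t) \<le> m" "0 < \<eta>" for g x0 v M m \<eta>
    by (rule all[THEN spec, THEN spec, THEN spec, THEN mp, OF that(1), THEN conjunct2, THEN spec, THEN spec, THEN spec,
          THEN mp, of M]) (use that(2-) in auto)
  show thesis
  \<comment> \<open>The additional 1 makes the constant positive, since later constants are
    quotients by it. It is harmless because M and m bound norms and are therefore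
    nonnegative.\<close>
  proof (rule that[of "C + 1"])
    show "norm (v t) \<le> (C + 1) * (norm x0 + M)"
      if "volterra_solution \<alpha> A g x0 v" "\<And>s. 0 \<le> s \<Longrightarrow> s \<le> T \<Longrightarrow> norm (g s) \<le> M" "0 \<le> t" "t \<le> T" for g x0 v T M t
    proof -
      have "0 \<le> M" using that(2)[OF that(3,4)] norm_ge_zero[of "g t"] by linarith
      moreover have "norm (v t) \<le> C * (norm x0 + M)" by (rule 1[OF that(1) _ that(3,4)]) (rule that(2))
      ultimately show ?thesis unfolding distrib_right[of C 1] mult_1 using norm_ge_zero[of x0] by linarith
    qed
    show "\<forall>\<^sub>F t in at_top. norm (v t) \<le> (C + 1) * m + \<eta>"
      if "volterra_solution \<alpha> A g x0 v" "\<And>s. 0 \<le> s \<Longrightarrow> norm (g s) \<le> M"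
       "\<forall>\<^sub>F t in at_top. norm (g t) \<le> m" "0 < \<eta>" for g x0 v M m \<eta>
    proof -
      have "\<forall>\<^sub>F t in at_top. norm (v t) \<le> C * m + \<eta>"
        by (rule 2[OF that(1) _ that(3,4)]) (rule that(2))
      then show ?thesis using that(3)
      proof eventually_elim
        case (elim t)
        then have "0 \<le> m" using norm_ge_zero[of "g t"] by linarith
        then show ?case unfolding distrib_right[of C 1] mult_1 using elim by linarith
      qed
    qed
  qed (use C in simp)
qed

section \<open>Global existence for Lipschitz nonlinearities\<close>

text \<open>In the norm weighted by exp (- N t) the kernel is multiplied by exp (- N s), whose total
  integral is its Laplace transform N powr (- alpha). This factor becomes as small as desired for
  large N.\<close>

lemma half_conv_exp_bound:
  fixes h :: "real \<Rightarrow> real"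
  assumes \<alpha>: "0 < \<alpha>" and N: "0 < N" and h: "continuous_on {0..} h" and t: "0 \<le> t" and K: "0 \<le> K"
    and bound: "\<And>s. 0 \<le> s \<Longrightarrow> s \<le> t \<Longrightarrow> \<bar>h s\<bar> \<le> K * exp (N * s)"
  shows "\<bar>half_conv (frac_kernel \<alpha>) h t\<bar> \<le> K * N powr (- \<alpha>) * exp (N * t)"
proof -
  define a where "a s = exp (- (N * s)) * frac_kernel \<alpha> s" for s
  define b where "b s = exp (- (N * s)) * h s" for s
  have ai: "set_integrable lborel {0..} a" unfolding a_def by (rule frac_kernel_laplace(1)[OF \<alpha> N])
  have li: "locally_integrable a"
    unfolding locally_integrable_def by (auto intro: set_integrable_subset[OF ai])
  have bc: "continuous_on {0..} b" unfolding b_def by (intro continuous_intros h)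
  have eq: "half_conv (frac_kernel \<alpha>) h t = exp (N * t) * half_conv a b t"
  proof -
    have "exp (N * t) * (a (t - s) * b s) = frac_kernel \<alpha> (t - s) * h s" for s
    proof -
      have "exp (N * t) * (exp (- (N * (t - s))) * exp (- (N * s))) = 1"
        by (simp add: algebra_simps flip: exp_add)
      then show ?thesis unfolding a_def b_def
        by (metis (no_types, opaque_lifting) mult.assoc mult.left_commute mult_1)
    qed
    then have "half_conv (frac_kernel \<alpha>) h t = (LBINT s:{0..t}. exp (N * t) * (a (t - s) * b s))"
      by (simp add: half_conv_def)
    then show ?thesis by (simp add: half_conv_def)
  qed
  have "norm (half_conv a b t) \<le> K * (LBINT s:{0..t}. norm (a s))"
  proof (rule half_conv_norm_le[OF li bc])
    fix s assume s: "0 \<le> s" "s \<le> t"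
    have "exp (- (N * s)) * \<bar>h s\<bar> \<le> exp (- (N * s)) * (K * exp (N * s))"
      by (intro mult_left_mono bound s) auto
    also have "\<dots> = K" by (simp add: exp_minus)
    finally show "norm (b s) \<le> K" by (simp add: b_def abs_mult)
  qed
  also have "\<dots> \<le> K * N powr (- \<alpha>)"
  proof (rule mult_left_mono[OF _ K])
    have "(LBINT s:{0..t}. norm (a s)) \<le> (LBINT s:{0..}. a s)"
    proof -
      have "0 \<le> a s" for s using frac_kernel_nonneg[OF \<alpha>] by (simp add: a_def)
      then show ?thesis
        using ai li unfolding locally_integrable_def set_lebesgue_integral_def set_integrable_def
        by (intro integral_mono) (auto simp: indicator_def)
    qed
    then show "(LBINT s:{0..t}. norm (a s)) \<le> N powr (- \<alpha>)"
      using frac_kernel_laplace(2)[OF \<alpha> N] by (simp add: a_def[abs_def])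
  qed
  finally show ?thesis unfolding eq by (simp add: abs_mult mult.commute)
qed

lemma norm_le_card_component:
  fixes x :: "real^'n"
  assumes "\<And>i. \<bar>x $ i\<bar> \<le> K"
  shows "norm x \<le> real CARD('n) * K"
proof -
  have "norm x \<le> (\<Sum>i\<in>UNIV. \<bar>x $ i\<bar>)" by (rule norm_le_l1_cart)
  also have "\<dots> \<le> (\<Sum>i\<in>(UNIV::'n set). K)" by (intro sum_mono assms)
  finally show ?thesis by simp
qed

text \<open>Banach's fixed point theorem for the weighted unknown \<open>exp (- N t) v(t)\<close>, with \<open>N\<close> so large that the
  Volterra operator becomes a contraction (Bielecki's norm).\<close>

theorem volterra_global_existence:
  fixes F :: "real^'n \<Rightarrow> real^'n" and x0 :: "real^'n"
  assumes \<alpha>: "0 < \<alpha>" and L: "\<And>x y. norm (F x - F y) \<le> L * norm (x - y)"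
  obtains v where "continuous_on {0..} v"
    "\<And>t i. 0 \<le> t \<Longrightarrow> v t $ i = x0 $ i + half_conv (frac_kernel \<alpha>) (\<lambda>s. F (v s) $ i) t"
proof -
  let ?V = "half_conv (frac_kernel \<alpha>)"
  define n where "n = real CARD('n)"
  have n: "0 < n" by (simp add: n_def)
  have L0: "0 \<le> L"
  proof -
    have "0 \<le> L * norm (1 - 0 :: real^'n)" by (rule order_trans[OF norm_ge_zero L])
    then have "0 \<le> L * norm (1 :: real^'n)" by simp
    moreover have "0 < norm (1 :: real^'n)" by simp
    ultimately show ?thesis by (simp add: zero_le_mult_iff)
  qed
  \<comment> \<open>Makes N powr (- alpha) equal to 1 / (2 n (L + 1)); together with the factor n
    lost in passing from components to the norm, the contraction constant is at most 1 / 2. Using L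
    + 1 also covers L = 0.\<close>
  define N where "N = (2 * n * (L + 1)) powr (1 / \<alpha>)"
  have N: "0 < N" using n L0 by (simp add: N_def)
  have NL: "n * (L * N powr (- \<alpha>)) \<le> 1 / 2"
  proof -
    have "N powr (- \<alpha>) = 1 / (2 * n * (L + 1))"
      using \<alpha> n L0 by (simp add: N_def powr_powr powr_minus_divide)
    then have "n * (L * N powr (- \<alpha>)) = L / (L + 1) * (1 / 2)" using n by simp
    also have "\<dots> \<le> 1 * (1 / 2)" using L0 by (intro mult_right_mono) auto
    finally show ?thesis by simp
  qed
  have Fc: "continuous_on UNIV F"
    using L L0 by (intro lipschitz_on_continuous_on[of L] lipschitz_onI) (auto simp: dist_norm)
  define h where "h w s = F (exp (N * s) *\<^sub>R apply_bcontfun w s)" for w :: "real \<Rightarrow>\<^sub>C (real^'n)" and s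
  have hc: "continuous_on {0..} (\<lambda>s. h w s $ i)" for w i
    unfolding h_def by (intro continuous_intros continuous_on_compose2[OF Fc]) auto
  \<comment> \<open>Bounded continuous functions live on the whole line here, so the image is
    extended to t < 0 by its value at 0.\<close>
  define \<Phi> where "\<Phi> w t = exp (- (N * max 0 t)) *\<^sub>R (\<chi> i. x0 $ i + ?V (\<lambda>s. h w s $ i) (max 0 t))" for w t
  have li: "locally_integrable (frac_kernel \<alpha>)"
    using frac_kernel_locally_integrable[OF \<alpha>, where 'b=real] by simp
  have \<Phi>c: "continuous_on UNIV (\<Phi> w)" for w
    unfolding \<Phi>_def
    by (intro continuous_intros continuous_on_vec_lambda
        continuous_on_compose2[OF continuous_on_half_conv[OF li hc]]) auto
  have \<Phi>b: "norm (\<Phi> w t) \<le> n * (norm x0 + (norm (F 0) + L * norm w) * N powr (- \<alpha>))" for w t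
    unfolding n_def
  proof (rule norm_le_card_component)
    fix i
    define \<tau> where "\<tau> = max 0 t"
    have \<tau>: "0 \<le> \<tau>" by (simp add: \<tau>_def)
    define K where "K = norm (F 0) + L * norm w"
    have K: "0 \<le> K" using L0 by (simp add: K_def)
    have "\<bar>?V (\<lambda>s. h w s $ i) \<tau>\<bar> \<le> K * N powr (- \<alpha>) * exp (N * \<tau>)"
    proof (rule half_conv_exp_bound[OF \<alpha> N hc \<tau> K])
      fix s :: real assume s: "0 \<le> s"
      have "\<bar>h w s $ i\<bar> \<le> norm (h w s)" by (rule component_le_norm_cart)
      also have "\<dots> \<le> norm (F 0) + norm (h w s - F 0)" by (rule norm_triangle_sub)
      also have "norm (h w s - F 0) \<le> L * norm (exp (N * s) *\<^sub>R apply_bcontfun w s)"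
        unfolding h_def using L[of "exp (N * s) *\<^sub>R apply_bcontfun w s" 0] by (simp only: diff_zero)
      also have "\<dots> \<le> L * (exp (N * s) * norm w)"
        using L0 norm_bounded[of w s] by (intro mult_left_mono) auto
      also have "norm (F 0) + L * (exp (N * s) * norm w) \<le> K * exp (N * s)"
        using mult_left_mono[of 1 "exp (N * s)" "norm (F 0)"] s N by (simp add: K_def algebra_simps)
      finally show "\<bar>h w s $ i\<bar> \<le> K * exp (N * s)" by simp
    qed
    then have "exp (- (N * \<tau>)) * \<bar>?V (\<lambda>s. h w s $ i) \<tau>\<bar> \<le> exp (- (N * \<tau>)) * (K * N powr (- \<alpha>) * exp (N * \<tau>))"
      by (intro mult_left_mono) auto
    also have "\<dots> = K * N powr (- \<alpha>)" by (simp add: exp_minus)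
    finally have 1: "exp (- (N * \<tau>)) * \<bar>?V (\<lambda>s. h w s $ i) \<tau>\<bar> \<le> K * N powr (- \<alpha>)" .
    have 2: "exp (- (N * \<tau>)) * \<bar>x0 $ i\<bar> \<le> 1 * norm x0"
      using N \<tau> by (intro mult_mono component_le_norm_cart) auto
    have "\<bar>\<Phi> w t $ i\<bar> \<le> exp (- (N * \<tau>)) * (\<bar>x0 $ i\<bar> + \<bar>?V (\<lambda>s. h w s $ i) \<tau>\<bar>)"
      by (simp add: \<Phi>_def \<tau>_def abs_mult mult_left_mono)
    then show "\<bar>\<Phi> w t $ i\<bar> \<le> norm x0 + (norm (F 0) + L * norm w) * N powr (- \<alpha>)"
      using 1 2 by (simp add: distrib_left K_def)
  qed
  have \<Phi>in: "\<Phi> w \<in> bcontfun" for w by (rule bcontfun_normI[OF \<Phi>c \<Phi>b])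
  define T where "T w = Bcontfun (\<Phi> w)" for w
  have T: "apply_bcontfun (T w) = \<Phi> w" for w
    unfolding T_def by (rule Bcontfun_inverse[OF \<Phi>in])
  have contr: "dist (T w) (T z) \<le> 1 / 2 * dist w z" for w z
  proof (rule dist_bound)
    fix t :: real
    define \<tau> where "\<tau> = max 0 t"
    have \<tau>: "0 \<le> \<tau>" by (simp add: \<tau>_def)
    have "norm (\<Phi> w t - \<Phi> z t) \<le> n * (L * dist w z * N powr (- \<alpha>))"
      unfolding n_def
    proof (rule norm_le_card_component)
      fix i
      have "?V (\<lambda>s. h w s $ i) \<tau> - ?V (\<lambda>s. h z s $ i) \<tau>
          = ?V (\<lambda>s. h w s $ i - h z s $ i) \<tau>"
        by (rule half_conv_diff[OF li hc hc, symmetric])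
      moreover have "\<bar>?V (\<lambda>s. h w s $ i - h z s $ i) \<tau>\<bar> \<le> (L * dist w z) * N powr (- \<alpha>) * exp (N * \<tau>)"
      proof (rule half_conv_exp_bound[OF \<alpha> N _ \<tau>])
        show "continuous_on {0..} (\<lambda>s. h w s $ i - h z s $ i)" by (intro continuous_intros hc)
        show "0 \<le> L * dist w z" using L0 by simp
        fix s
        have "\<bar>h w s $ i - h z s $ i\<bar> \<le> norm (h w s - h z s)"
          using component_le_norm_cart[of "h w s - h z s" i] by simp
        also have "\<dots> \<le> L * norm (exp (N * s) *\<^sub>R apply_bcontfun w s - exp (N * s) *\<^sub>R apply_bcontfun z s)"
          unfolding h_def by (rule L)
        also have "\<dots> = L * (exp (N * s) * dist (apply_bcontfun w s) (apply_bcontfun z s))"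
          by (simp add: dist_norm flip: scaleR_diff_right)
        also have "\<dots> \<le> L * (exp (N * s) * dist w z)"
          using L0 dist_bounded[of w s z] by (intro mult_left_mono) auto
        finally show "\<bar>h w s $ i - h z s $ i\<bar> \<le> L * dist w z * exp (N * s)" by (simp add: mult_ac)
      qed
      moreover have "(\<Phi> w t - \<Phi> z t) $ i = exp (- (N * \<tau>)) *
          (?V (\<lambda>s. h w s $ i) \<tau> - ?V (\<lambda>s. h z s $ i) \<tau>)"
        by (simp add: \<Phi>_def \<tau>_def algebra_simps)
      ultimately have "\<bar>(\<Phi> w t - \<Phi> z t) $ i\<bar> \<le> exp (- (N * \<tau>)) * ((L * dist w z) * N powr (- \<alpha>) * exp (N * \<tau>))"
        by (simp add: abs_mult mult_left_mono)
      also have "\<dots> = L * dist w z * N powr (- \<alpha>)" by (simp add: exp_minus)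
      finally show "\<bar>(\<Phi> w t - \<Phi> z t) $ i\<bar> \<le> L * dist w z * N powr (- \<alpha>)" .
    qed
    also have "\<dots> = (n * (L * N powr (- \<alpha>))) * dist w z" by simp
    also have "\<dots> \<le> 1 / 2 * dist w z" by (rule mult_right_mono[OF NL]) simp
    finally show "dist (apply_bcontfun (T w) t) (apply_bcontfun (T z) t) \<le> 1 / 2 * dist w z"
      by (simp add: T dist_norm)
  qed
  obtain w where w: "T w = w"
    using banach_fix_type[of "1 / 2" T] contr by auto
  define v where "v s = exp (N * s) *\<^sub>R apply_bcontfun w s" for s
  show thesis
  proof
    show "continuous_on {0..} v" unfolding v_def by (intro continuous_intros) auto
    fix t :: real and i assume t: "0 \<le> t"
    have "apply_bcontfun w t = \<Phi> w t" using T[of w] w by simp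
    then have "v t = (\<chi> i. x0 $ i + ?V (\<lambda>s. h w s $ i) t)"
      using t by (simp add: v_def \<Phi>_def flip: exp_add)
    then show "v t $ i = x0 $ i + ?V (\<lambda>s. F (v s) $ i) t"
      by (simp add: h_def v_def)
  qed
qed

section \<open>Caputo--Katugampola solutions and Volterra equations\<close>

text \<open>With k and l the kernels of order alpha and 1 - alpha, continuity of the convolution l *
  y at 0 integrates the hypothesis to l * y = 1 * h. Convolving with k and using k * l = 1 gives 1 *
  y = 1 * (k * h), and the outer 1 is removed by differentiation.\<close>

lemma caputo_imp_volterra:
  fixes y h :: "real \<Rightarrow> real"
  assumes \<alpha>: "0 < \<alpha>" "\<alpha> < 1" and y: "continuous_on {0..} y" "y 0 = 0" and h: "continuous_on {0..} h"
    and der: "\<And>\<sigma>. 0 < \<sigma> \<Longrightarrow> (half_conv (frac_kernel (1 - \<alpha>)) y has_real_derivative h \<sigma>) (at \<sigma>)"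
    and \<sigma>: "0 \<le> \<sigma>"
  shows "y \<sigma> = half_conv (frac_kernel \<alpha>) h \<sigma>"
proof -
  let ?k = "frac_kernel \<alpha>"
  let ?l = "frac_kernel (1 - \<alpha>)"
  let ?one = "\<lambda>_::real. 1::real"
  have li: "locally_integrable ?k" "locally_integrable ?l"
    using frac_kernel_locally_integrable[of \<alpha>, where 'b=real] frac_kernel_locally_integrable[of "1 - \<alpha>", where 'b=real] \<alpha> by auto
  have l1: "locally_integrable ?one" by (intro continuous_locally_integrable continuous_intros)
  have J: "half_conv ?l y s = half_conv ?one h s" if s: "0 \<le> s" for s
  proof -
    have "(h has_integral half_conv ?l y s - half_conv ?l y 0) {0..s}"
    proof (rule fundamental_theorem_of_calculus_interior[OF s])
      show "continuous_on {0..s} (half_conv ?l y)"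
        by (rule continuous_on_subset[OF continuous_on_half_conv[OF li(2) y(1)]]) auto
      show "(half_conv ?l y has_vector_derivative h x) (at x)" if "x \<in> {0<..<s}" for x
        using der[of x] that by (simp add: has_real_derivative_iff_has_vector_derivative)
    qed
    then show ?thesis
      using half_conv_one[OF continuous_locally_integrable[OF h], of s] by (simp add: half_conv_0 integral_unique)
  qed
  define e where "e s = y s - half_conv ?k h s" for s
  have khc: "continuous_on {0..} (half_conv ?k h)" by (rule continuous_on_half_conv[OF li(1) h])
  have ec: "continuous_on {0..} e" unfolding e_def by (intro continuous_intros y khc)
  have "half_conv ?one e s = 0" for s
  proof -
    have "half_conv ?one y s = half_conv (half_conv ?k ?l) y s"
      by (rule half_conv_cong_left) (use frac_kernel_conv[OF \<alpha>, where 'b=real] in simp)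
    also have "\<dots> = half_conv ?k (half_conv ?l y) s"
      by (rule half_conv_assoc[OF li y(1), symmetric])
    also have "\<dots> = half_conv ?k (half_conv ?one h) s"
      by (rule half_conv_cong) (rule J)
    also have "\<dots> = half_conv (half_conv ?k ?one) h s"
      by (rule half_conv_assoc[OF li(1) l1 h])
    also have "half_conv ?k ?one = half_conv ?one ?k"
      by (rule ext) (rule half_conv_commute)
    also have "half_conv (half_conv ?one ?k) h s = half_conv ?one (half_conv ?k h) s"
      by (rule half_conv_assoc[OF l1 li(1) h, symmetric])
    finally show ?thesis
      unfolding e_def by (subst half_conv_diff[OF l1 y(1) khc]) simp
  qed
  then have "e \<sigma> = 0" if "0 < \<sigma>" using half_conv_one_eq_0D[OF ec _ that] by blast
  moreover have "e 0 = 0" by (simp add: e_def y half_conv_0)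
  ultimately have "e \<sigma> = 0" using \<sigma> by (cases "\<sigma> = 0") auto
  then show ?thesis by (simp add: e_def)
qed

text \<open>Convolving y = k * h with the kernel l of order 1 - alpha gives 1 * h, whose derivative
  is h.\<close>

lemma volterra_imp_caputo:
  fixes y h :: "real \<Rightarrow> real"
  assumes \<alpha>: "0 < \<alpha>" "\<alpha> < 1" and h: "continuous_on {0..} h"
    and eq: "\<And>s. 0 \<le> s \<Longrightarrow> y s = half_conv (frac_kernel \<alpha>) h s" and \<sigma>: "0 < \<sigma>"
  shows "(half_conv (frac_kernel (1 - \<alpha>)) y has_real_derivative h \<sigma>) (at \<sigma>)"
proof -
  let ?k = "frac_kernel \<alpha>"
  let ?l = "frac_kernel (1 - \<alpha>)"
  let ?one = "\<lambda>_::real. 1::real"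
  have li: "locally_integrable ?k" "locally_integrable ?l"
    using frac_kernel_locally_integrable[of \<alpha>, where 'b=real] frac_kernel_locally_integrable[of "1 - \<alpha>", where 'b=real] \<alpha> by auto
  have "half_conv ?l y s = half_conv ?one h s" for s
  proof -
    have "half_conv ?l y s = half_conv ?l (half_conv ?k h) s"
      by (rule half_conv_cong) (rule eq)
    also have "\<dots> = half_conv (half_conv ?l ?k) h s"
      by (rule half_conv_assoc[OF li(2,1) h])
    also have "\<dots> = half_conv ?one h s"
      by (rule half_conv_cong_left) (use frac_kernel_conv[of "1 - \<alpha>", where 'b=real] \<alpha> in simp)
    finally show ?thesis .
  qed
  then have "half_conv ?l y = half_conv ?one h" by (rule ext)
  then show ?thesis
    using half_conv_one_has_derivative[OF h \<sigma>] by (simp add: has_real_derivative_iff_has_vector_derivative)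
qed

section \<open>The time substitution\<close>

text \<open>Normalised so that its derivative is exactly t powr (rho - 1), the weight in the
  Caputo-Katugampola integral.\<close>

definition CK_time :: "real \<Rightarrow> real \<Rightarrow> real \<Rightarrow> real" where
  "CK_time \<rho> t0 t = (t powr \<rho> - t0 powr \<rho>) / \<rho>"

definition CK_time_inv :: "real \<Rightarrow> real \<Rightarrow> real \<Rightarrow> real" where
  "CK_time_inv \<rho> t0 \<sigma> = (\<rho> * \<sigma> + t0 powr \<rho>) powr (1 / \<rho>)"

context
  fixes \<rho> t0 :: real
  assumes \<rho>: "0 < \<rho>" and t0: "0 < t0"
begin

lemma CK_time_t0: "CK_time \<rho> t0 t0 = 0"
  by (simp add: CK_time_def)

lemma CK_time_pos: "t0 < t \<Longrightarrow> 0 < CK_time \<rho> t0 t"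
  using \<rho> t0 by (simp add: CK_time_def powr_less_mono2)

lemma CK_time_nonneg: "t0 \<le> t \<Longrightarrow> 0 \<le> CK_time \<rho> t0 t"
  using CK_time_pos CK_time_t0 by (cases "t = t0") (auto simp: less_imp_le)

lemma CK_time_inv_CK_time: "t0 \<le> t \<Longrightarrow> CK_time_inv \<rho> t0 (CK_time \<rho> t0 t) = t"
  using \<rho> t0 by (simp add: CK_time_def CK_time_inv_def powr_powr)

lemma CK_time_inv_base: "0 \<le> \<sigma> \<Longrightarrow> 0 < \<rho> * \<sigma> + t0 powr \<rho>"
  using \<rho> t0 by (intro add_nonneg_pos) auto

lemma CK_time_CK_time_inv: "0 \<le> \<sigma> \<Longrightarrow> CK_time \<rho> t0 (CK_time_inv \<rho> t0 \<sigma>) = \<sigma>"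
  using \<rho> CK_time_inv_base[of \<sigma>] by (simp add: CK_time_def CK_time_inv_def powr_powr)

lemma CK_time_inv_0: "CK_time_inv \<rho> t0 0 = t0"
  using \<rho> t0 by (simp add: CK_time_inv_def powr_powr)

lemma CK_time_inv_gt: "0 < \<sigma> \<Longrightarrow> t0 < CK_time_inv \<rho> t0 \<sigma>"
proof -
  assume "0 < \<sigma>"
  then have "(t0 powr \<rho>) powr (1 / \<rho>) < (\<rho> * \<sigma> + t0 powr \<rho>) powr (1 / \<rho>)"
    using \<rho> by (intro powr_less_mono2) auto
  then show ?thesis using \<rho> t0 by (simp add: CK_time_inv_def powr_powr)
qed

lemma CK_time_inv_ge: "0 \<le> \<sigma> \<Longrightarrow> t0 \<le> CK_time_inv \<rho> t0 \<sigma>"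
  using CK_time_inv_gt CK_time_inv_0 by (cases "\<sigma> = 0") (auto simp: less_imp_le)

lemma CK_time_deriv: "0 < t \<Longrightarrow> (CK_time \<rho> t0 has_real_derivative t powr (\<rho> - 1)) (at t)"
  unfolding CK_time_def using \<rho> by (auto intro!: derivative_eq_intros simp: powr_diff field_simps)

lemma CK_time_inv_deriv:
  assumes "0 \<le> \<sigma>"
  shows "(CK_time_inv \<rho> t0 has_real_derivative CK_time_inv \<rho> t0 \<sigma> powr (1 - \<rho>)) (at \<sigma>)"
proof -
  have "((\<lambda>\<sigma>. (\<rho> * \<sigma> + t0 powr \<rho>) powr (1 / \<rho>)) has_real_derivative
      (1 / \<rho>) * (\<rho> * \<sigma> + t0 powr \<rho>) powr (1 / \<rho> - 1) * \<rho>) (at \<sigma>)"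
    using CK_time_inv_base[OF assms] by (auto intro!: derivative_eq_intros)
  moreover have "1 / \<rho> * (1 - \<rho>) = 1 / \<rho> - 1" using \<rho> by (simp add: field_simps)
  then have "CK_time_inv \<rho> t0 \<sigma> powr (1 - \<rho>) = (\<rho> * \<sigma> + t0 powr \<rho>) powr (1 / \<rho> - 1)"
    by (simp add: CK_time_inv_def powr_powr)
  ultimately show ?thesis using \<rho> by (simp add: CK_time_inv_def[abs_def])
qed

lemma continuous_on_CK_time: "continuous_on {t0..} (CK_time \<rho> t0)"
  using t0 by (intro DERIV_continuous_on[where D="\<lambda>t. t powr (\<rho> - 1)"])
    (auto intro!: has_field_derivative_at_within CK_time_deriv)

lemma continuous_on_CK_time_inv: "continuous_on {0..} (CK_time_inv \<rho> t0)"
  by (intro DERIV_continuous_on[where D="\<lambda>\<sigma>. CK_time_inv \<rho> t0 \<sigma> powr (1 - \<rho>)"])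
    (auto intro!: has_field_derivative_at_within CK_time_inv_deriv)

lemma CK_time_at_top: "filterlim (CK_time \<rho> t0) at_top at_top"
  unfolding CK_time_def using \<rho> by real_asymp

text \<open>The difference t powr rho - s powr rho is rho times the difference of the new times, and
  s powr (rho - 1) ds is the new time element. The singular factor becomes the kernel of order 1 -
  alpha up to Gamma (1 - alpha) / rho powr alpha.\<close>

lemma CK_int_half_conv:
  fixes u :: "real \<Rightarrow> real^'n"
  assumes \<alpha>: "0 < \<alpha>" "\<alpha> < 1" and u: "continuous_on {t0..} u" and t: "t0 \<le> t"
  defines "v \<equiv> \<lambda>\<sigma>. u (CK_time_inv \<rho> t0 \<sigma>)"
  shows "CK_kernel \<alpha> \<rho> t0 u t integrable_on {t0..t}"
    and "CK_int \<alpha> \<rho> t0 u t $ i = Gamma (1 - \<alpha>) / \<rho> powr \<alpha> *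
      half_conv (frac_kernel (1 - \<alpha>)) (\<lambda>\<sigma>. v \<sigma> $ i - v 0 $ i) (CK_time \<rho> t0 t)"
proof -
  let ?T = "CK_time \<rho> t0" and ?q = "CK_time_inv \<rho> t0"
  let ?l = "frac_kernel (1 - \<alpha>)"
  have vc: "continuous_on {0..} v"
    unfolding v_def by (rule continuous_on_compose2[OF u continuous_on_CK_time_inv]) (auto intro: CK_time_inv_ge)
  have G: "0 < Gamma (1 - \<alpha>)" using \<alpha> by (intro Gamma_real_pos) simp
  define c where "c = Gamma (1 - \<alpha>) / \<rho> powr \<alpha>"
  define f where "f i \<sigma> = ?l (?T t - \<sigma>) * (v \<sigma> $ i - v 0 $ i)" for i \<sigma>
  have li: "locally_integrable ?l"
    using frac_kernel_locally_integrable[of "1 - \<alpha>", where 'b=real] \<alpha> by simp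
  have fi: "set_integrable lborel {?T t0..?T t} (f i)" for i
    unfolding f_def CK_time_t0 by (intro half_conv_integrable li continuous_intros vc)
  \<comment> \<open>This includes the singular point s = t, where both sides are 0 by the
    conventions 0 powr a = 0 and x / 0 = 0.\<close>
  have kernel: "CK_kernel \<alpha> \<rho> t0 u t s $ i = c * (f i (?T s) * s powr (\<rho> - 1))" if s: "s \<in> {t0..t}" for s i
  proof -
    have v: "v (?T s) = u s" "v 0 = u t0"
      using s CK_time_inv_CK_time[of s] by (auto simp: v_def CK_time_inv_0)
    have le: "0 \<le> t powr \<rho> - s powr \<rho>" using s t0 \<rho> by (simp add: powr_mono2)
    have "?T t - ?T s = (t powr \<rho> - s powr \<rho>) / \<rho>"
      by (simp add: CK_time_def diff_divide_distrib)
    then have "?l (?T t - ?T s)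
        = \<rho> powr \<alpha> / Gamma (1 - \<alpha>) * (1 / (t powr \<rho> - s powr \<rho>) powr \<alpha>)"
      using le \<rho> by (simp add: frac_kernel_def powr_divide powr_minus_divide)
    then show ?thesis
      using G \<rho> by (simp add: f_def v c_def CK_kernel_def)
  qed
  have der: "(?T has_real_derivative s powr (\<rho> - 1)) (at s)" if "s \<in> {t0..t}" for s
    using that t0 by (intro CK_time_deriv) auto
  have cont: "continuous_on {t0..t} (\<lambda>s. s powr (\<rho> - 1))" using t0 by (intro continuous_intros) auto
  note S = integral_substitution[OF fi der cont _ t]
  have SI: "set_integrable lborel {t0..t} (\<lambda>s. CK_kernel \<alpha> \<rho> t0 u t s $ i)" for i
  proof -
    have "set_integrable lborel {t0..t} (\<lambda>s. c * (f i (?T s) * s powr (\<rho> - 1)))"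
      using S(1)[of i] by (intro set_integrable_mult_right) auto
    then show ?thesis by (rule set_integrable_cong[OF refl refl, THEN iffD1, rotated]) (simp add: kernel)
  qed
  have comp: "(\<lambda>s. CK_kernel \<alpha> \<rho> t0 u t s $ i) integrable_on {t0..t}" for i
    by (rule set_borel_integral_eq_integral(1)[OF SI])
  show int: "CK_kernel \<alpha> \<rho> t0 u t integrable_on {t0..t}"
    by (subst integrable_componentwise_iff) (auto simp: Basis_vec_def inner_axis comp)
  have "CK_int \<alpha> \<rho> t0 u t $ i = integral {t0..t} (\<lambda>s. CK_kernel \<alpha> \<rho> t0 u t s $ i)"
    unfolding CK_int_def using int by (simp add: integral_component_eq_cart)
  also have "\<dots> = (LBINT s:{t0..t}. CK_kernel \<alpha> \<rho> t0 u t s $ i)"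
    using set_borel_integral_eq_integral(2)[OF SI] by simp
  also have "\<dots> = (LBINT s:{t0..t}. c * (f i (?T s) * s powr (\<rho> - 1)))"
    by (rule set_lebesgue_integral_cong) (auto simp: kernel)
  also have "\<dots> = c * (LBINT s:{t0..t}. f i (?T s) * s powr (\<rho> - 1))" by simp
  also have "(LBINT s:{t0..t}. f i (?T s) * s powr (\<rho> - 1))
      = (LINT \<sigma>:{?T t0..?T t}|lborel. f i \<sigma>)"
    using S(2)[of i] by (simp add: set_lebesgue_integral_def mult.commute)
  also have "\<dots> = half_conv ?l (\<lambda>\<sigma>. v \<sigma> $ i - v 0 $ i) (?T t)"
    by (simp add: half_conv_def f_def CK_time_t0)
  finally show "CK_int \<alpha> \<rho> t0 u t $ i = Gamma (1 - \<alpha>) / \<rho> powr \<alpha> *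
      half_conv ?l (\<lambda>\<sigma>. v \<sigma> $ i - v 0 $ i) (?T t)" by (simp add: c_def)
qed

text \<open>The inverse substitution has derivative t powr (1 - rho), so t powr (1 - rho) d/dt is
  the derivative in the new time. The prefactor of the Caputo-Katugampola derivative cancels that of
  \<open>CK_int_half_conv\<close>, and the Caputo equation remains.\<close>

lemma CK_solution_imp_volterra:
  fixes x :: "real \<Rightarrow> real^'n"
  assumes \<alpha>: "0 < \<alpha>" "\<alpha> < 1" and f: "continuous_on UNIV f" and x: "CK_solution \<alpha> \<rho> t0 A f x0 {t0..} x"
  defines "v \<equiv> \<lambda>\<sigma>. x (CK_time_inv \<rho> t0 \<sigma>)"
  shows "volterra_solution \<alpha> A (\<lambda>\<sigma>. f (v \<sigma>)) x0 v"
  unfolding volterra_solution_def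
proof (intro conjI allI impI)
  let ?T = "CK_time \<rho> t0" and ?q = "CK_time_inv \<rho> t0"
  let ?k = "frac_kernel \<alpha>"
  let ?l = "frac_kernel (1 - \<alpha>)"
  have xc: "continuous_on {t0..} x" and x0: "x t0 = x0"
    and D: "\<And>t. t0 < t \<Longrightarrow> has_CK_derivative \<alpha> \<rho> t0 x (A *v x t + f (x t)) t"
    using x by (auto simp: CK_solution_def)
  show vc: "continuous_on {0..} v"
    unfolding v_def by (rule continuous_on_compose2[OF xc continuous_on_CK_time_inv]) (auto intro: CK_time_inv_ge)
  show fc: "continuous_on {0..} (\<lambda>\<sigma>. f (v \<sigma>))" by (rule continuous_on_compose2[OF f vc]) auto
  fix \<sigma> :: real and i assume \<sigma>: "0 \<le> \<sigma>"
  have v0: "v 0 = x0" by (simp add: v_def CK_time_inv_0 x0)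
  have G: "0 < Gamma (1 - \<alpha>)" using \<alpha> by (intro Gamma_real_pos) simp
  define y where "y \<sigma> = v \<sigma> $ i - v 0 $ i" for \<sigma>
  define h where "h \<sigma> = (A *v v \<sigma> + f (v \<sigma>)) $ i" for \<sigma>
  have hc: "continuous_on {0..} h"
    unfolding h_def by (auto intro!: continuous_intros vc fc simp: matrix_vector_mult_def)
  have "y \<sigma> = half_conv ?k h \<sigma>"
  proof (rule caputo_imp_volterra[OF \<alpha> _ _ hc _ \<sigma>])
    show "continuous_on {0..} y" unfolding y_def by (intro continuous_intros vc)
    show "y 0 = 0" by (simp add: y_def)
    fix s :: real assume s: "0 < s"
    define t where "t = ?q s"
    have t: "t0 < t" unfolding t_def by (rule CK_time_inv_gt[OF s])
    obtain I' where I: "(CK_int \<alpha> \<rho> t0 x has_vector_derivative I') (at t)"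
      and DI: "A *v x t + f (x t) = (\<rho> powr \<alpha> / Gamma (1 - \<alpha>) * t powr (1 - \<rho>)) *\<^sub>R I'"
      using D[OF t] unfolding has_CK_derivative_def by blast
    have "((\<lambda>t. CK_int \<alpha> \<rho> t0 x t $ i) has_real_derivative I' $ i) (at t)"
      unfolding has_real_derivative_iff_has_vector_derivative
      using bounded_linear.has_vector_derivative[OF bounded_linear_vec_nth I] .
    then have "((\<lambda>s. CK_int \<alpha> \<rho> t0 x (?q s) $ i) has_real_derivative I' $ i * t powr (1 - \<rho>)) (at s)"
      using DERIV_chain2[of "\<lambda>t. CK_int \<alpha> \<rho> t0 x t $ i" _ "?q" s] CK_time_inv_deriv[of s] s
      by (simp add: t_def)
    then have "((\<lambda>s. \<rho> powr \<alpha> / Gamma (1 - \<alpha>) * CK_int \<alpha> \<rho> t0 x (?q s) $ i) has_real_derivative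
        \<rho> powr \<alpha> / Gamma (1 - \<alpha>) * (I' $ i * t powr (1 - \<rho>))) (at s)"
      by (rule DERIV_cmult)
    moreover have "\<rho> powr \<alpha> / Gamma (1 - \<alpha>) * (I' $ i * t powr (1 - \<rho>)) = h s"
      using arg_cong[OF DI, of "\<lambda>z. z $ i"] by (simp add: h_def v_def t_def)
    moreover have "\<forall>\<^sub>F s in nhds s. \<rho> powr \<alpha> / Gamma (1 - \<alpha>) * CK_int \<alpha> \<rho> t0 x (?q s) $ i
        = half_conv ?l y s"
    proof -
      have "\<forall>\<^sub>F s in nhds s. s \<in> {0<..}" using s by (intro eventually_nhds_in_open) auto
      then show ?thesis
      proof eventually_elim
        case (elim s)
        then show ?case
          using CK_int_half_conv(2)[OF \<alpha> xc CK_time_inv_ge, of s i] G \<rho>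
          by (simp add: CK_time_CK_time_inv y_def[abs_def] v_def)
      qed
    qed
    ultimately show "(half_conv ?l y has_real_derivative h s) (at s)"
      using DERIV_cong_ev[OF refl, THEN iffD1, rotated 2] by blast
  qed
  then show "v \<sigma> $ i = x0 $ i + half_conv ?k (\<lambda>s. (A *v v s + f (v s)) $ i) \<sigma>"
    by (simp add: y_def v0 h_def[abs_def])
qed

lemma volterra_imp_CK_solution:
  fixes v :: "real \<Rightarrow> real^'n"
  assumes \<alpha>: "0 < \<alpha>" "\<alpha> < 1" and v: "volterra_solution \<alpha> A (\<lambda>\<sigma>. f (v \<sigma>)) x0 v"
  shows "CK_solution \<alpha> \<rho> t0 A f x0 {t0..} (\<lambda>t. v (CK_time \<rho> t0 t))"
  unfolding CK_solution_def
proof (intro conjI ballI impI)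
  let ?T = "CK_time \<rho> t0" and ?q = "CK_time_inv \<rho> t0"
  let ?k = "frac_kernel \<alpha>"
  let ?l = "frac_kernel (1 - \<alpha>)"
  define x where "x t = v (?T t)" for t
  have vc: "continuous_on {0..} v" and fc: "continuous_on {0..} (\<lambda>\<sigma>. f (v \<sigma>))"
    and eq: "\<And>t i. 0 \<le> t \<Longrightarrow> v t $ i = x0 $ i + half_conv ?k (\<lambda>s. (A *v v s + f (v s)) $ i) t"
    using v by (auto simp: volterra_solution_def)
  have v0: "v 0 = x0" using eq[of 0] by (simp add: vec_eq_iff half_conv_0)
  show "v (?T t0) = x0" by (simp add: CK_time_t0 v0)
  have xc: "continuous_on {t0..} x"
    unfolding x_def by (rule continuous_on_compose2[OF vc continuous_on_CK_time]) (auto intro: CK_time_nonneg)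
  then show "continuous_on {t0..} (\<lambda>t. v (?T t))" by (simp add: x_def[abs_def])
  have G: "0 < Gamma (1 - \<alpha>)" using \<alpha> by (intro Gamma_real_pos) simp
  fix t assume t: "t0 < t"
  define c where "c = Gamma (1 - \<alpha>) / \<rho> powr \<alpha>"
  define D where "D = A *v x t + f (x t)"
  \<comment> \<open>The only value compatible with \<open>has_CK_derivative\<close>: its prefactor,
    inverted, times the right-hand side of the equation.\<close>
  define I' where "I' = (c * t powr (\<rho> - 1)) *\<^sub>R D"
  have comp: "((\<lambda>t. CK_int \<alpha> \<rho> t0 x t $ i) has_real_derivative I' $ i) (at t)" for i
  proof -
    define y where "y \<sigma> = v \<sigma> $ i - v 0 $ i" for \<sigma>
    define h where "h \<sigma> = (A *v v \<sigma> + f (v \<sigma>)) $ i" for \<sigma>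
    have hc: "continuous_on {0..} h"
      unfolding h_def by (auto intro!: continuous_intros vc fc simp: matrix_vector_mult_def)
    have "(half_conv ?l y has_real_derivative h (?T t)) (at (?T t))"
      by (rule volterra_imp_caputo[OF \<alpha> hc _ CK_time_pos[OF t]]) (simp add: y_def eq v0 h_def[abs_def])
    then have "((\<lambda>t. half_conv ?l y (?T t)) has_real_derivative
        h (?T t) * t powr (\<rho> - 1)) (at t)"
      using t t0 by (intro DERIV_chain2[OF _ CK_time_deriv]) auto
    then have d1: "((\<lambda>t. c * half_conv ?l y (?T t)) has_real_derivative
        c * (h (?T t) * t powr (\<rho> - 1))) (at t)"
      by (rule DERIV_cmult)
    have d2: "c * (h (?T t) * t powr (\<rho> - 1)) = I' $ i"
      by (simp add: I'_def D_def h_def x_def)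
    have d3: "\<forall>\<^sub>F t in nhds t. c * half_conv ?l y (?T t) = CK_int \<alpha> \<rho> t0 x t $ i"
    proof -
      have "\<forall>\<^sub>F t in nhds t. t \<in> {t0<..}" using t by (intro eventually_nhds_in_open) auto
      then show ?thesis
      proof eventually_elim
        case (elim t)
        have "half_conv ?l y (?T t) = half_conv ?l
           (\<lambda>\<sigma>. x (?q \<sigma>) $ i - x (?q 0) $ i) (?T t)"
          by (rule half_conv_cong) (simp add: y_def x_def CK_time_CK_time_inv)
        then show ?case using CK_int_half_conv(2)[OF \<alpha> xc, of t i] elim by (simp add: c_def)
      qed
    qed
    show ?thesis by (rule DERIV_cong_ev[OF refl d3 d2, THEN iffD1, OF d1])
  qed
  have "(CK_int \<alpha> \<rho> t0 x has_vector_derivative I') (at t)"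
    unfolding has_vector_derivative_def
  proof (subst has_derivative_componentwise_within, intro ballI)
    fix b :: "real^'n" assume "b \<in> Basis"
    then show "((\<lambda>t. CK_int \<alpha> \<rho> t0 x t \<bullet> b) has_derivative (\<lambda>h. (h *\<^sub>R I') \<bullet> b)) (at t)"
      using comp by (auto simp: Basis_vec_def inner_axis has_field_derivative_def mult.commute[of _ "I' $ _"])
  qed
  moreover have "D = (\<rho> powr \<alpha> / Gamma (1 - \<alpha>) * t powr (1 - \<rho>)) *\<^sub>R I'"
  proof -
    have "t powr (1 - \<rho>) * t powr (\<rho> - 1) = 1" using t t0 by (simp flip: powr_add)
    then have "\<rho> powr \<alpha> / Gamma (1 - \<alpha>) * t powr (1 - \<rho>) * (c * t powr (\<rho> - 1)) = 1"
      using G \<rho> by (simp add: c_def)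
    then show ?thesis unfolding I'_def scaleR_scaleR by (simp only: scaleR_one)
  qed
  moreover have "\<exists>e>0. \<forall>\<tau>. t0 < \<tau> \<and> \<bar>\<tau> - t\<bar> < e \<longrightarrow> CK_kernel \<alpha> \<rho> t0 x \<tau> integrable_on {t0..\<tau>}"
    using CK_int_half_conv(1)[OF \<alpha> xc] by (intro exI[of _ 1]) auto
  ultimately have "has_CK_derivative \<alpha> \<rho> t0 x D t" unfolding has_CK_derivative_def by blast
  then show "has_CK_derivative \<alpha> \<rho> t0 (\<lambda>t. v (?T t)) (A *v v (?T t) + f (v (?T t))) t"
    by (simp add: x_def[abs_def] D_def)
qed

end

section \<open>Asymptotic stability\<close>

lemma locally_lipschitz_continuous:
  assumes "locally_lipschitz f"
  shows "continuous_on UNIV f"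
proof (rule continuous_at_imp_continuous_on, intro ballI)
  fix x
  obtain U L where U: "open U" "x \<in> U" "L-lipschitz_on U f" using assms unfolding locally_lipschitz_def by blast
  then show "isCont f x"
    using lipschitz_on_continuous_on continuous_on_eq_continuous_at by blast
qed

text \<open>A real \<open>Sup\<close> bounds the quotients only if they are bounded above, which
  local Lipschitz continuity at 0 secures on balls inside U. The radius has to respect both this and
  the smallness of \<open>lip_const\<close>.\<close>

lemma small_lipschitz_ball:
  fixes f :: "real^'n \<Rightarrow> real^'n"
  assumes f: "locally_lipschitz f" and lim: "(lip_const f \<longlongrightarrow> 0) (at_right 0)" and \<eta>: "0 < \<eta>"
  obtains r where "0 < r" "\<And>x y. norm x < r \<Longrightarrow> norm y < r \<Longrightarrow> norm (f x - f y) \<le> \<eta> * norm (x - y)"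
proof -
  obtain U L where U: "open U" "0 \<in> U" "L-lipschitz_on U f" using f unfolding locally_lipschitz_def by blast
  then obtain r0 where r0: "0 < r0" "ball 0 r0 \<subseteq> U" using openE by blast
  have "\<forall>\<^sub>F r in at_right 0. lip_const f r < \<eta>" using lim \<eta> by (rule order_tendstoD(2))
  then obtain b where b: "0 < b" "\<And>r. 0 < r \<Longrightarrow> r < b \<Longrightarrow> lip_const f r < \<eta>"
    unfolding eventually_at_right_field by blast
  define r where "r = min r0 b / 2"
  have r: "0 < r" "r < r0" "r < b" using r0 b by (auto simp: r_def)
  show thesis
  proof
    show "0 < r" by (rule r)
    fix x y :: "real^'n" assume xy: "norm x < r" "norm y < r"
    show "norm (f x - f y) \<le> \<eta> * norm (x - y)"
    proof (cases "x = y")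
      case False
      define S where "S = {norm (f x - f y) / norm (x - y) | x y. x \<in> ball 0 r \<and> y \<in> ball 0 r \<and> x \<noteq> y}"
      have "bdd_above S"
      proof (rule bdd_aboveI[of _ L])
        fix q assume "q \<in> S"
        then obtain u w where uw: "q = norm (f u - f w) / norm (u - w)" "u \<in> ball 0 r" "w \<in> ball 0 r" "u \<noteq> w"
          by (auto simp: S_def)
        have "u \<in> U" "w \<in> U" using uw r r0 by auto
        then have "norm (f u - f w) \<le> L * norm (u - w)"
          using lipschitz_onD[OF U(3)] by (simp add: dist_norm)
        then show "q \<le> L" using uw by (simp add: divide_le_eq)
      qed
      moreover have "norm (f x - f y) / norm (x - y) \<in> S" using xy False by (auto simp: S_def)
      ultimately have "norm (f x - f y) / norm (x - y) \<le> lip_const f r"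
        unfolding lip_const_def S_def[symmetric] by (rule cSup_upper[rotated])
      also have "\<dots> < \<eta>" using b r by simp
      finally show ?thesis using False by (simp add: divide_less_eq)
    qed simp
  qed
qed

text \<open>T is the least point of the compact set where phi >= e; a value above e at T would, by
  the intermediate value theorem, put an earlier point into that set.\<close>

lemma first_time_reaching:
  fixes \<phi> :: "real \<Rightarrow> real"
  assumes c: "continuous_on {0..} \<phi>" and 0: "\<phi> 0 < e" and s: "0 \<le> s" "e < \<phi> s"
  obtains T where "0 \<le> T" "\<phi> T = e" "\<And>s. 0 \<le> s \<Longrightarrow> s \<le> T \<Longrightarrow> \<phi> s \<le> e"
proof -
  define S where "S = {0..s} \<inter> \<phi> -` {e..}"
  have cs: "continuous_on {0..s} \<phi>" by (rule continuous_on_subset[OF c]) auto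
  have "closed S" unfolding S_def by (rule continuous_closed_preimage[OF cs]) auto
  then have "compact S" unfolding compact_eq_bounded_closed
    by (auto simp: S_def intro: bounded_subset[of "{0..s}"])
  moreover have "s \<in> S" using s by (simp add: S_def)
  ultimately obtain T where T: "T \<in> S" "\<And>t. t \<in> S \<Longrightarrow> T \<le> t" using compact_attains_inf[of S] by auto
  have T0: "0 \<le> T" "T \<le> s" "e \<le> \<phi> T" using T(1) by (auto simp: S_def)
  have "continuous_on {0..T} \<phi>" by (rule continuous_on_subset[OF c]) auto
  then obtain T' where T': "0 \<le> T'" "T' \<le> T" "\<phi> T' = e" using IVT'[of \<phi> 0 e T] 0 T0 by auto
  then have "T' \<in> S" using T0 by (simp add: S_def)
  then have "T' = T" using T(2)[of T'] T' by simp
  have "\<phi> s' \<le> e" if "0 \<le> s'" "s' \<le> T" for s'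
  proof (rule ccontr)
    assume "\<not> \<phi> s' \<le> e"
    then have "s' \<in> S" using that T0 by (simp add: S_def)
    then have "s' = T" using T(2)[of s'] that by simp
    then show False using \<open>\<not> \<phi> s' \<le> e\<close> T' \<open>T' = T\<close> by simp
  qed
  then show thesis using that[of T] T0 T' \<open>T' = T\<close> by simp
qed

lemma volterra_solution_cong:
  assumes "volterra_solution \<alpha> A g x0 v" "\<And>s. 0 \<le> s \<Longrightarrow> g s = g' s"
  shows "volterra_solution \<alpha> A g' x0 v"
  unfolding volterra_solution_def
proof (intro conjI allI impI)
  show "continuous_on {0..} v" using assms by (simp add: volterra_solution_def)
  show "continuous_on {0..} g'"
    using assms continuous_on_cong[of "{0..}" "{0..}" g g'] by (simp add: volterra_solution_def)
  fix t :: real and i assume "0 \<le> t"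
  then have "v t $ i = x0 $ i + half_conv (frac_kernel \<alpha>) (\<lambda>s. (A *v v s + g s) $ i) t"
    using assms(1) by (simp add: volterra_solution_def)
  also have "half_conv (frac_kernel \<alpha>) (\<lambda>s. (A *v v s + g s) $ i) t = half_conv (frac_kernel \<alpha>) (\<lambda>s. (A *v v s + g' s) $ i) t"
    by (rule half_conv_cong) (simp add: assms(2))
  finally show "v t $ i = x0 $ i + half_conv (frac_kernel \<alpha>) (\<lambda>s. (A *v v s + g' s) $ i) t" .
qed

text \<open>One delta serves existence, the uniform bound and attraction. The exponent of the
  argument is C * eta < 1: the feedback of the nonlinearity through the linear bound is a
  contraction.\<close>

theorem volterra_asymptotic_stability:
  fixes A :: "real^'n^'n" and f :: "real^'n \<Rightarrow> real^'n"
  assumes \<alpha>: "0 < \<alpha>" "\<alpha> < 1" and spectrum: "\<forall>lam \<in> complex_spectrum A. \<bar>Arg lam\<bar> > \<alpha> * pi / 2"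
    and f: "locally_lipschitz f" "f 0 = 0" and lim: "(lip_const f \<longlongrightarrow> 0) (at_right 0)" and \<epsilon>: "0 < \<epsilon>"
  obtains \<delta> where "0 < \<delta>"
    "\<And>x0. norm x0 \<le> \<delta> \<Longrightarrow> \<exists>v. volterra_solution \<alpha> A (\<lambda>\<sigma>. f (v \<sigma>)) x0 v"
    "\<And>x0 v \<sigma>. norm x0 \<le> \<delta> \<Longrightarrow> volterra_solution \<alpha> A (\<lambda>\<sigma>. f (v \<sigma>)) x0 v \<Longrightarrow> 0 \<le> \<sigma> \<Longrightarrow> norm (v \<sigma>) \<le> \<epsilon>"
    "\<And>x0 v. norm x0 \<le> \<delta> \<Longrightarrow> volterra_solution \<alpha> A (\<lambda>\<sigma>. f (v \<sigma>)) x0 v \<Longrightarrow> (v \<longlongrightarrow> 0) at_top"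
proof -
  obtain C where C: "0 < C"
    and b1: "\<And>g x0 v T M t. \<lbrakk>volterra_solution \<alpha> A g x0 v; \<And>s. 0 \<le> s \<Longrightarrow> s \<le> T \<Longrightarrow> norm (g s) \<le> M; 0 \<le> t; t \<le> T\<rbrakk>
       \<Longrightarrow> norm (v t) \<le> C * (norm x0 + M)"
    and b2: "\<And>g x0 v M m \<eta>. \<lbrakk>volterra_solution \<alpha> A g x0 v; \<And>s. 0 \<le> s \<Longrightarrow> norm (g s) \<le> M;
       \<forall>\<^sub>F t in at_top. norm (g t) \<le> m; 0 < \<eta>\<rbrakk> \<Longrightarrow> \<forall>\<^sub>F t in at_top. norm (v t) \<le> C * m + \<eta>"
    by (rule volterra_stability_bounds[OF \<alpha> spectrum]) blast
  \<comment> \<open>With C * eta = 1 / 4 the nonlinearity contributes at most a quarter of the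
    current bound on v.\<close>
  define \<eta> where "\<eta> = 1 / (4 * C)"
  have \<eta>: "0 < \<eta>" "C * \<eta> = 1 / 4" using C by (auto simp: \<eta>_def)
  obtain r where r: "0 < r" and lip: "\<And>x y. norm x < r \<Longrightarrow> norm y < r \<Longrightarrow> norm (f x - f y) \<le> \<eta> * norm (x - y)"
    using small_lipschitz_ball[OF f(1) lim \<eta>(1)] by blast
  define e where "e = min \<epsilon> (r / 2)"
  have e: "0 < e" "e < r" "e \<le> \<epsilon>" using r \<epsilon> by (auto simp: e_def)
  have fb: "norm (f x) \<le> \<eta> * norm x" if "norm x \<le> e" for x
    using lip[of x 0] that e f(2) r by simp
  have fe: "norm (f x) \<le> \<eta> * e" if "norm x \<le> e" for x
    using order_trans[OF fb[OF that] mult_left_mono[OF that]] \<eta> by simp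
  \<comment> \<open>From 4 (C + 1) delta = e follow delta < e, so v starts inside the ball, and C
    delta <= e / 4. With the quarter from the nonlinearity the a priori bound is e / 2, strictly
    below the exit level e.\<close>
  define \<delta> where "\<delta> = e / (4 * (C + 1))"
  have "0 < \<delta>" using e C by (simp add: \<delta>_def)
  have "4 * (C + 1) * \<delta> = e" using C by (simp add: \<delta>_def)
  then have "4 * (C * \<delta>) + 4 * \<delta> = e" by (simp add: algebra_simps)
  then have \<delta>: "0 < \<delta>" "\<delta> < e" "C * \<delta> \<le> e / 4"
    using \<open>0 < \<delta>\<close> mult_pos_pos[OF C \<open>0 < \<delta>\<close>] by linarith+
  have half: "C * (norm x0 + \<eta> * e) \<le> e / 2" if "norm x0 \<le> \<delta>" for x0 :: "real^'n"
  proof -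
    have "C * norm x0 \<le> C * \<delta>" using that C by simp
    moreover have "C * (\<eta> * e) = e / 4" using \<eta>(2) by (simp flip: mult.assoc)
    ultimately show ?thesis unfolding distrib_left using \<delta>(3) by linarith
  qed
  have small: "norm (v \<sigma>) \<le> e"
    if x0: "norm x0 \<le> \<delta>" and v: "volterra_solution \<alpha> A (\<lambda>\<sigma>. f (v \<sigma>)) x0 v" and \<sigma>: "0 \<le> \<sigma>" for x0 v \<sigma>
  proof (rule ccontr)
    assume "\<not> norm (v \<sigma>) \<le> e"
    have vc: "continuous_on {0..} v" using v by (simp add: volterra_solution_def)
    have "v 0 = x0" using v by (simp add: volterra_solution_def vec_eq_iff half_conv_0)
    then obtain T where T: "0 \<le> T" "norm (v T) = e" "\<And>s. 0 \<le> s \<Longrightarrow> s \<le> T \<Longrightarrow> norm (v s) \<le> e"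
      using first_time_reaching[of "\<lambda>s. norm (v s)" e \<sigma>] \<open>\<not> norm (v \<sigma>) \<le> e\<close> x0 \<delta> \<sigma> continuous_on_norm[OF vc] by auto
    have "norm (v T) \<le> C * (norm x0 + \<eta> * e)"
      by (rule b1[OF v _ T(1) order_refl]) (intro fe T(3))
    then show False using half[OF x0] T(2) e(1) by linarith
  qed
  show thesis
  proof (rule that[OF \<delta>(1)])
    fix x0 :: "real^'n" assume x0: "norm x0 \<le> \<delta>"
    \<comment> \<open>The nearest-point projection does not increase distances and takes values in
      the ball where f has Lipschitz constant eta, so f composed with it is globally
      Lipschitz.\<close>
    define P where "P x = closest_point (cball 0 e) x" for x :: "real^'n"
    have ne: "cball 0 e \<noteq> ({} :: (real^'n) set)" using e by simp
    have Pe: "norm (P x) \<le> e" for x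
      using closest_point_in_set[OF closed_cball ne, of x] by (simp add: P_def)
    have Plip: "norm (P x - P y) \<le> norm (x - y)" for x y
      using closest_point_lipschitz[OF convex_cball closed_cball ne, of x y] by (simp add: P_def dist_norm)
    have "bounded_linear ((*v) A)" by (rule matrix_vector_mul_bounded_linear)
    then obtain B where B: "\<And>x. norm (A *v x) \<le> norm x * B" using bounded_linear.pos_bounded by blast
    have FL: "norm ((A *v x + f (P x)) - (A *v y + f (P y))) \<le> (B + \<eta>) * norm (x - y)" for x y
    proof -
      have "norm ((A *v x + f (P x)) - (A *v y + f (P y))) = norm (A *v (x - y) + (f (P x) - f (P y)))"
        by (simp add: matrix_vector_mult_diff_distrib algebra_simps)
      also have "\<dots> \<le> norm (x - y) * B + \<eta> * norm (P x - P y)"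
        using Pe e by (intro order_trans[OF norm_triangle_ineq] add_mono B lip) (auto intro: order_le_less_trans)
      also have "\<dots> \<le> norm (x - y) * B + \<eta> * norm (x - y)" using \<eta> Plip by simp
      finally show ?thesis by (simp add: algebra_simps)
    qed
    obtain v where vc: "continuous_on {0..} v"
      and veq: "\<And>t i. 0 \<le> t \<Longrightarrow> v t $ i = x0 $ i + half_conv (frac_kernel \<alpha>) (\<lambda>s. (A *v v s + f (P (v s))) $ i) t"
      using volterra_global_existence[OF \<alpha>(1) FL] by blast
    have Pc: "continuous_on UNIV P"
      by (intro lipschitz_on_continuous_on[of 1] lipschitz_onI) (simp_all add: dist_norm Plip)
    have "continuous_on {0..} (\<lambda>s. f (P (v s)))"
      by (intro continuous_on_compose2[OF locally_lipschitz_continuous[OF f(1)]] continuous_on_compose2[OF Pc] vc) auto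
    then have v: "volterra_solution \<alpha> A (\<lambda>s. f (P (v s))) x0 v"
      using vc veq by (simp add: volterra_solution_def)
    \<comment> \<open>The truncated forcing is bounded by eta * e at all times, so the linear bound
      holds without a first-exit argument and keeps v in the ball, where the projection is the
      identity.\<close>
    have "P (v s) = v s" if "0 \<le> s" for s
    proof -
      have "norm (v s) \<le> C * (norm x0 + \<eta> * e)"
        by (rule b1[OF v _ that order_refl]) (intro fe Pe)
      then have "v s \<in> cball 0 e" using half[OF x0] e(1) by simp
      then show ?thesis unfolding P_def by (rule closest_point_self)
    qed
    then have "volterra_solution \<alpha> A (\<lambda>s. f (v s)) x0 v"
      by (intro volterra_solution_cong[OF v]) simp
    then show "\<exists>v. volterra_solution \<alpha> A (\<lambda>\<sigma>. f (v \<sigma>)) x0 v" by blast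
  next
    show "norm (v \<sigma>) \<le> \<epsilon>"
      if "norm x0 \<le> \<delta>" "volterra_solution \<alpha> A (\<lambda>\<sigma>. f (v \<sigma>)) x0 v" "0 \<le> \<sigma>" for x0 v \<sigma>
      using small[OF that] e(3) by simp
  next
    fix x0 v assume x0: "norm x0 \<le> \<delta>" and v: "volterra_solution \<alpha> A (\<lambda>\<sigma>. f (v \<sigma>)) x0 v"
    \<comment> \<open>One round turns the eventual bound b = e / 2 ^ n into C * eta * b plus the
      slack of the asymptotic estimate. The first is b / 4 and the second is chosen as b / 4, which
      together halve b.\<close>
    have ev: "\<forall>\<^sub>F t in at_top. norm (v t) \<le> e / 2 ^ n" for n
    proof (induction n)
      case 0
      show ?case using eventually_ge_at_top[of 0] by eventually_elim (simp add: small[OF x0 v])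
    next
      case (Suc n)
      have "\<forall>\<^sub>F t in at_top. norm (f (v t)) \<le> \<eta> * (e / 2 ^ n)"
        using Suc.IH eventually_ge_at_top[of 0]
      proof eventually_elim
        case (elim t)
        have "norm (f (v t)) \<le> \<eta> * norm (v t)" using small[OF x0 v] elim by (intro fb) auto
        also have "\<dots> \<le> \<eta> * (e / 2 ^ n)" using elim \<eta> by (intro mult_left_mono) auto
        finally show ?case .
      qed
      then have "\<forall>\<^sub>F t in at_top. norm (v t) \<le> C * (\<eta> * (e / 2 ^ n)) + e / 2 ^ n / 4"
        using e by (intro b2[OF v fe]) (auto intro: small[OF x0 v])
      moreover have "C * (\<eta> * (e / 2 ^ n)) + e / 2 ^ n / 4 = e / 2 ^ Suc n"
        unfolding mult.assoc[symmetric, of C \<eta>] \<eta>(2) by simp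
      ultimately show ?case by simp
    qed
    show "(v \<longlongrightarrow> 0) at_top"
      unfolding tendsto_iff dist_norm diff_zero
    proof (intro allI impI)
      fix d :: real assume d: "0 < d"
      have "(\<lambda>n. e / 2 ^ n) \<longlonglongrightarrow> 0" by real_asymp
      then have "\<forall>\<^sub>F n in sequentially. e / 2 ^ n < d" using d by (rule order_tendstoD(2))
      then obtain n where "e / 2 ^ n < d" by (auto simp: eventually_sequentially)
      then show "\<forall>\<^sub>F t in at_top. norm (v t) < d"
        using ev[of n] by (auto elim!: eventually_mono)
    qed
  qed
qed

theorem theorem3p1:
  fixes \<alpha> \<rho> t0 :: real and A :: "real^'n^'n" and f :: "real^'n \<Rightarrow> real^'n"
  assumes "0 < \<alpha>" and "\<alpha> < 1" and "0 < \<rho>" and "0 < t0"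
    and "\<forall>lam \<in> complex_spectrum A. \<bar>Arg lam\<bar> > \<alpha> * pi / 2"
    and "locally_lipschitz f" and "f 0 = 0"
    and "(lip_const f \<longlongrightarrow> 0) (at_right 0)"
  shows "CK_asymptotically_stable \<alpha> \<rho> t0 A f"
proof -
  note \<alpha> = assms(1,2) and time = assms(3,4)
  note fc = locally_lipschitz_continuous[OF assms(6)]
  have main: "\<exists>\<delta>>0. \<forall>x0. norm x0 \<le> \<delta> \<longrightarrow>
      (\<exists>x. CK_solution \<alpha> \<rho> t0 A f x0 {t0..} x) \<and>
      (\<forall>x. CK_solution \<alpha> \<rho> t0 A f x0 {t0..} x \<longrightarrow> (\<forall>t\<ge>t0. norm (x t) \<le> \<epsilon>) \<and> (x \<longlongrightarrow> 0) at_top)"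
    if \<epsilon>: "0 < \<epsilon>" for \<epsilon>
  proof -
    obtain \<delta> where \<delta>: "0 < \<delta>"
      and ex: "\<And>x0. norm x0 \<le> \<delta> \<Longrightarrow> \<exists>v. volterra_solution \<alpha> A (\<lambda>\<sigma>. f (v \<sigma>)) x0 v"
      and small: "\<And>x0 v \<sigma>. norm x0 \<le> \<delta> \<Longrightarrow> volterra_solution \<alpha> A (\<lambda>\<sigma>. f (v \<sigma>)) x0 v \<Longrightarrow> 0 \<le> \<sigma> \<Longrightarrow> norm (v \<sigma>) \<le> \<epsilon>"
      and conv: "\<And>x0 v. norm x0 \<le> \<delta> \<Longrightarrow> volterra_solution \<alpha> A (\<lambda>\<sigma>. f (v \<sigma>)) x0 v \<Longrightarrow> (v \<longlongrightarrow> 0) at_top"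
      by (rule volterra_asymptotic_stability[OF \<alpha> assms(5-8) \<epsilon>]) blast
    show ?thesis
    proof (intro exI[of _ \<delta>] conjI allI impI \<delta>)
      fix x0 :: "real^'n" assume x0: "norm x0 \<le> \<delta>"
      show "\<exists>x. CK_solution \<alpha> \<rho> t0 A f x0 {t0..} x"
        using ex[OF x0] volterra_imp_CK_solution[OF time \<alpha>] by blast
      fix x assume x: "CK_solution \<alpha> \<rho> t0 A f x0 {t0..} x"
      note v = CK_solution_imp_volterra[OF time \<alpha> fc x]
      show "norm (x t) \<le> \<epsilon>" if "t0 \<le> t" for t
        using small[OF x0 v CK_time_nonneg[OF time that]] CK_time_inv_CK_time[OF time that] by simp
      have "((\<lambda>t. x (CK_time_inv \<rho> t0 (CK_time \<rho> t0 t))) \<longlongrightarrow> 0) at_top"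
        by (rule filterlim_compose[OF conv[OF x0 v] CK_time_at_top[OF time]])
      then show "(x \<longlongrightarrow> 0) at_top"
      proof (rule Lim_transform_eventually)
        show "\<forall>\<^sub>F t in at_top. x (CK_time_inv \<rho> t0 (CK_time \<rho> t0 t)) = x t"
          using eventually_ge_at_top[of t0] by eventually_elim (simp add: CK_time_inv_CK_time[OF time])
      qed
    qed
  qed
  \<comment> \<open>The radius of attraction is the delta belonging to epsilon = 1.\<close>
  show ?thesis
    unfolding CK_asymptotically_stable_def CK_stable_def
    using main main[of 1] by (meson zero_less_one)
qed

end
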